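(* Let $D$ be an acyclic digraph with $n$ vertices and $m$ arcs. Then the algorithm MINLEAF, applied to $D$, returns an out-branching of $D$ with the minimum possible number of leaves if $D$ has an out-branching, and returns `NO' otherwise; its running time is $O(m+n^{1.5}\sqrt{m/\log n})$.
   Context: Digraphs are finite, without loops or parallel arcs. An out-tree in a digraph $D$ is a subgraph that is an oriented tree with exactly one vertex of in-degree zero (the root); its vertices of out-degree zero are leaves, the others internal vertices. An out-branching is a spanning out-tree. Algorithm MINLEAF on an acyclic digraph $D$: (1) if $D$ has exactly one vertex of in-degree 0, call it $r$; otherwise return `NO'. (2) With $V=V(D)$ and $V'=\{v': v\in V\}$ a disjoint copy, build the bipartite graph $B$ with parts $X=V$ and $X'=V'\setminus\{r'\}$ and edge set $\{xy' : x\in X, y'\in X', (x,y)\in A(D)\}$. (3) Find a maximum matching $M$ in $B$. (4) Set $M^*\leftarrow M$. (5) For each $y'\in X'$ not covered by $M$, add to $M^*$ an arbitrary edge of $B$ incident with $y'$. (6)-(7) Let $T$ be the digraph on $V$ with arc set $\{(x,y): xy'\in M^*\}$. (8) Return $T$. *)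

theory Defs
  imports Complex_Main "Graph_Theory.Graph_Theory"
begin

section \<open>Out-branchings\<close>

definition acyclic_digraph :: "'a pair_pre_digraph \<Rightarrow> bool" where
  "acyclic_digraph D \<longleftrightarrow> pair_digraph D \<and> (\<nexists>p. pre_digraph.cycle (with_proj D) p)"

text \<open>An oriented tree is an orientation of an undirected tree.  The predicate \<open>tree\<close> of the
  library is not usable here, because it only excludes directed cycles.  In the symmetric closure,
  a cycle of length 2 merely traverses one edge back and forth, so the cycles of the underlying
  undirected graph are those of length at least 3.\<close>

definition oriented_tree :: "'a pair_pre_digraph \<Rightarrow> bool" where
  "oriented_tree T \<longleftrightarrow> pair_digraph T \<and> (\<forall>u v. (u, v) \<in> parcs T \<longrightarrow> (v, u) \<notin> parcs T) \<and>
     connected (with_proj T) \<and>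
     (\<nexists>p. pre_digraph.cycle (with_proj (mk_symmetric (with_proj T))) p \<and> length p \<ge> 3)"

definition out_tree :: "'a pair_pre_digraph \<Rightarrow> 'a pair_pre_digraph \<Rightarrow> bool" where
  "out_tree T D \<longleftrightarrow> subgraph (with_proj T) (with_proj D) \<and> oriented_tree T \<and>
     (\<exists>!r. r \<in> pverts T \<and> in_degree (with_proj T) r = 0)"

definition leaves :: "'a pair_pre_digraph \<Rightarrow> 'a set" where
  "leaves T = {v \<in> pverts T. out_degree (with_proj T) v = 0}"

definition out_branching :: "'a pair_pre_digraph \<Rightarrow> 'a pair_pre_digraph \<Rightarrow> bool" where
  "out_branching T D \<longleftrightarrow> out_tree T D \<and> spanning (with_proj T) (with_proj D)"

definition min_leaf_out_branching :: "'a pair_pre_digraph \<Rightarrow> 'a pair_pre_digraph \<Rightarrow> bool" where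
  "min_leaf_out_branching T D \<longleftrightarrow> out_branching T D \<and>
     (\<forall>T'. out_branching T' D \<longrightarrow> card (leaves T) \<le> card (leaves T'))"

section \<open>Algorithm MINLEAF\<close>

definition is_matching :: "'b set set \<Rightarrow> 'b set set \<Rightarrow> bool" where
  "is_matching E M \<longleftrightarrow> M \<subseteq> E \<and> (\<forall>e\<in>M. \<forall>f\<in>M. e \<noteq> f \<longrightarrow> e \<inter> f = {})"

definition maximum_matching :: "'b set set \<Rightarrow> 'b set set \<Rightarrow> bool" where
  "maximum_matching E M \<longleftrightarrow> is_matching E M \<and> (\<forall>M'. is_matching E M' \<longrightarrow> card M' \<le> card M)"

definition sources :: "'a pair_pre_digraph \<Rightarrow> 'a set" where
  "sources D = {v \<in> pverts D. in_degree (with_proj D) v = 0}"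

text \<open>The vertex \<open>x\<close> of \<open>X = V\<close> is \<open>Inl x\<close>, the copy \<open>y'\<close> is \<open>Inr y\<close>.\<close>

definition bip_edges :: "'a pair_pre_digraph \<Rightarrow> 'a \<Rightarrow> ('a + 'a) set set" where
  "bip_edges D r =
     {{Inl x, Inr y} |x y. x \<in> pverts D \<and> y \<in> pverts D - {r} \<and> (x, y) \<in> parcs D}"

text \<open>Step 5: \<open>g y\<close> is the edge chosen for the uncovered vertex \<open>Inr y\<close>.\<close>

definition completes :: "'a pair_pre_digraph \<Rightarrow> 'a \<Rightarrow> ('a + 'a) set set \<Rightarrow> ('a + 'a) set set \<Rightarrow> bool"
  where
  "completes D r M Mstar \<longleftrightarrow>
     (let U = {y \<in> pverts D - {r}. Inr y \<notin> \<Union>M} in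
      \<exists>g. (\<forall>y\<in>U. g y \<in> bip_edges D r \<and> Inr y \<in> g y) \<and> Mstar = M \<union> g ` U)"

text \<open>A run of MINLEAF on \<open>D\<close> that does not answer `NO', finds \<open>M\<close> in step 3 and returns \<open>T\<close>.\<close>

definition minleaf_run ::
  "'a pair_pre_digraph \<Rightarrow> ('a + 'a) set set \<Rightarrow> 'a pair_pre_digraph \<Rightarrow> bool" where
  "minleaf_run D M T \<longleftrightarrow>
     (\<exists>r Mstar. sources D = {r} \<and> maximum_matching (bip_edges D r) M \<and> completes D r M Mstar \<and>
        T = \<lparr>pverts = pverts D, parcs = {(x, y). {Inl x, Inr y} \<in> Mstar}\<rparr>)"

text \<open>\<open>minleaf D res\<close>: some run of the (nondeterministic) algorithm returns \<open>res\<close>, where \<open>None\<close>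
  stands for `NO'.\<close>

inductive minleaf :: "'a pair_pre_digraph \<Rightarrow> 'a pair_pre_digraph option \<Rightarrow> bool" where
  no: "card (sources D) \<noteq> 1 \<Longrightarrow> minleaf D None"
| tree: "minleaf_run D M T \<Longrightarrow> minleaf D (Some T)"

section \<open>A unit-cost RAM\<close>

text \<open>Programs are while-programs over finitely many registers and arrays of natural numbers.  Every
  number that occurs has to be smaller than a bound \<open>W\<close>; a program gets stuck when it computes a
  larger one.  With \<open>W\<close> polynomial in the number of vertices \<open>n\<close> this is the RAM with word length
  \<open>O(log n)\<close>.  Every operation, register access and array access takes one unit of time.\<close>

datatype binop = Plus | Minus | Times | Div | Mod | Less | Equal

datatype exp = Const nat | Reg string | Get string exp | Bin binop exp exp

datatype com =
    Skip
  | Assign string exp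
  | Put string exp exp
  | Seq com com
  | Cond exp com com
  | While exp com

record state =
  reg :: "string \<Rightarrow> nat"
  arr :: "string \<Rightarrow> nat \<Rightarrow> nat"

text \<open>Subtraction is truncated at 0; division by 0 yields 0.\<close>

fun apply_binop :: "binop \<Rightarrow> nat \<Rightarrow> nat \<Rightarrow> nat" where
  "apply_binop Plus a b = a + b"
| "apply_binop Minus a b = a - b"
| "apply_binop Times a b = a * b"
| "apply_binop Div a b = a div b"
| "apply_binop Mod a b = a mod b"
| "apply_binop Less a b = (if a < b then 1 else 0)"
| "apply_binop Equal a b = (if a = b then 1 else 0)"

fun val :: "state \<Rightarrow> exp \<Rightarrow> nat" where
  "val s (Const a) = a"
| "val s (Reg x) = reg s x"
| "val s (Get A e) = arr s A (val s e)"
| "val s (Bin f e1 e2) = apply_binop f (val s e1) (val s e2)"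

fun fits :: "nat \<Rightarrow> state \<Rightarrow> exp \<Rightarrow> bool" where
  "fits W s (Const a) \<longleftrightarrow> a < W"
| "fits W s (Reg x) \<longleftrightarrow> reg s x < W"
| "fits W s (Get A e) \<longleftrightarrow> fits W s e \<and> arr s A (val s e) < W"
| "fits W s (Bin f e1 e2) \<longleftrightarrow> fits W s e1 \<and> fits W s e2 \<and> val s (Bin f e1 e2) < W"

fun cost :: "exp \<Rightarrow> nat" where
  "cost (Const a) = 1"
| "cost (Reg x) = 1"
| "cost (Get A e) = cost e + 1"
| "cost (Bin f e1 e2) = cost e1 + cost e2 + 1"

text \<open>\<open>exec W c s t s'\<close>: from state \<open>s\<close>, program \<open>c\<close> terminates in state \<open>s'\<close> after \<open>t\<close> units of
  time, all numbers staying below \<open>W\<close>.\<close>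

inductive exec :: "nat \<Rightarrow> com \<Rightarrow> state \<Rightarrow> nat \<Rightarrow> state \<Rightarrow> bool" for W :: nat where
  Skip: "exec W Skip s 1 s"
| Assign: "fits W s e \<Longrightarrow>
    exec W (Assign x e) s (cost e + 1) (s\<lparr>reg := (reg s)(x := val s e)\<rparr>)"
| Put: "fits W s i \<Longrightarrow> fits W s e \<Longrightarrow>
    exec W (Put A i e) s (cost i + cost e + 1)
      (s\<lparr>arr := (arr s)(A := (arr s A)(val s i := val s e))\<rparr>)"
| Seq: "exec W c1 s t1 s1 \<Longrightarrow> exec W c2 s1 t2 s2 \<Longrightarrow> exec W (Seq c1 c2) s (t1 + t2) s2"
| CondTrue: "fits W s e \<Longrightarrow> val s e \<noteq> 0 \<Longrightarrow> exec W c1 s t s' \<Longrightarrow>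
    exec W (Cond e c1 c2) s (cost e + 1 + t) s'"
| CondFalse: "fits W s e \<Longrightarrow> val s e = 0 \<Longrightarrow> exec W c2 s t s' \<Longrightarrow>
    exec W (Cond e c1 c2) s (cost e + 1 + t) s'"
| WhileFalse: "fits W s e \<Longrightarrow> val s e = 0 \<Longrightarrow> exec W (While e c) s (cost e + 1) s"
| WhileTrue: "fits W s e \<Longrightarrow> val s e \<noteq> 0 \<Longrightarrow> exec W c s t1 s1 \<Longrightarrow>
    exec W (While e c) s1 t2 s2 \<Longrightarrow> exec W (While e c) s (cost e + 1 + t1 + t2) s2"

section \<open>Input and output of an implementation of MINLEAF\<close>

text \<open>\<open>L ! v\<close> lists the out-neighbours of \<open>v\<close>, in any order.\<close>

definition adjacency_lists :: "nat pair_pre_digraph \<Rightarrow> nat list list \<Rightarrow> bool" where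
  "adjacency_lists D L \<longleftrightarrow> pverts D = {..<length L} \<and>
     (\<forall>v<length L. distinct (L ! v) \<and> set (L ! v) = {w. (v, w) \<in> parcs D})"

text \<open>The lists are stored consecutively in the array \<open>adj\<close>; the list of \<open>v\<close> occupies the positions
  from \<open>start v\<close> to \<open>start (v + 1) - 1\<close>.  The rest of the memory is zero.\<close>

definition input_state :: "nat list list \<Rightarrow> state" where
  "input_state L =
    \<lparr>reg = (\<lambda>_. 0)(''n'' := length L, ''m'' := length (concat L)),
     arr = (\<lambda>_ _. 0)
       (''start'' := (\<lambda>v. if v \<le> length L then length (concat (take v L)) else 0),
        ''adj'' := (\<lambda>i. if i < length (concat L) then concat L ! i else 0))\<rparr>"

text \<open>A set of pairs \<open>(x, y)\<close> with at most one \<open>x\<close> for each \<open>y < n\<close> is stored as an array \<open>a\<close> with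
  \<open>a y = x + 1\<close> if \<open>x\<close> exists, and \<open>a y = 0\<close> otherwise.\<close>

definition pairs_of :: "nat \<Rightarrow> (nat \<Rightarrow> nat) \<Rightarrow> (nat \<times> nat) set" where
  "pairs_of n a = {(x, y). y < n \<and> a y = Suc x}"

text \<open>The final state holds the answer of a run of MINLEAF: register \<open>yes\<close> is 0 for `NO'; otherwise
  the arrays \<open>mate\<close> and \<open>parent\<close> hold the matching of step 3 and the returned digraph.\<close>

definition minleaf_answer :: "nat pair_pre_digraph \<Rightarrow> state \<Rightarrow> bool" where
  "minleaf_answer D s \<longleftrightarrow>
     (let n = card (pverts D) in
      if reg s ''yes'' = 0 then minleaf D None
      else minleaf_run D {{Inl x, Inr y} |x y. (x, y) \<in> pairs_of n (arr s ''mate'')}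
             \<lparr>pverts = pverts D, parcs = pairs_of n (arr s ''parent'')\<rparr>)"

end

theory Submission
  imports Defs
begin

text \<open>Choosing one in-arc for every vertex other than the unique source of an acyclic digraph yields an
  out-branching.  Picking one child of each internal vertex turns an out-branching into a matching
  of \<open>B\<close>, and every vertex covered by \<open>M\<close> is internal in the tree built from \<open>M\<close>; hence the maximum
  number of internal vertices is the size of a maximum matching.

  For the running time, the neighbourhood of each vertex is packed into words of
  \<open>b = \<Theta>(log n)\<close> bits, keeping only the nonzero ones, so that there are
  \<open>N \<le> min(m, O(n\<^sup>2 / log n)) = O(n sqrt(m / log n))\<close> words.  A table finds a common element of two words
  in constant time.  The matching is computed in two phases, as in the algorithm of Alt, Blum,
  Mehlhorn and Paul.  The first relabels vertices up to level \<open>l = \<Theta>(sqrt n)\<close> in time \<open>O(l (N + n))\<close>;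
  each of its labels gives a vertex cover which shows that at most \<open>n / l\<close> edges are missing.  The
  second finds each missing edge by a depth-first search in time \<open>O(N + n)\<close>.  If \<open>m + 1 < n\<close>, there are
  several sources and the answer `NO' is given at once.\<close>

section \<open>Out-branchings of acyclic digraphs\<close>

text \<open>The bound on \<open>N\<close> is a geometric mean: \<open>N \<le> m\<close> and
  \<open>N = O(n^2 / log n)\<close> multiply to \<open>N^2 = O(n^2 m / log n)\<close>. A factor
  \<open>sqrt n\<close> then gives the target, and \<open>l\<close> close to \<open>sqrt n\<close>
  balances the \<open>l\<close> levels of the first phase against the \<open>n / l + 1\<close>
  searches of the second. Both phases also spend \<open>O(n)\<close> on vertices per level or
  search, \<open>n^1.5\<close> in total, which the target absorbs once \<open>m\<close> is at least
  \<open>log n\<close>. With \<open>m = 0\<close> the bound is a constant and does not even allow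
  one scan of the vertices; hence the test of \<open>m + 1 < n\<close> in constant time, after which
  \<open>m \<ge> n - 1 \<ge> log n\<close>. The word length is pinned from both sides: the table has
  \<open>4^b\<close> entries, one for each pair of words, and must be filled in time
  \<open>O(n)\<close>, while a shorter word would lose the logarithm. Optimality always comes from a
  vertex cover, never from a theorem on augmenting paths. Running times come from potentials: each
  loop invariant relates the remaining budget to a quantity that every iteration raises, so that
  termination and time are one argument.\<close>

lemma acyclic_digraphD:
  assumes "acyclic_digraph D"
  shows "pair_digraph D" "finite (pverts D)" "finite (parcs D)" "acyclic (parcs D)"
    "wf (parcs D)" "wf ((parcs D)\<inverse>)" "\<And>x y. (x, y) \<in> parcs D \<Longrightarrow> x \<in> pverts D \<and> y \<in> pverts D"
proof -
  show D: "pair_digraph D" using assms by (simp add: acyclic_digraph_def)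
  interpret pair_digraph D by (rule D)
  show "finite (pverts D)" "finite (parcs D)" by (rule pair_finite_verts pair_finite_arcs)+
  show ac: "acyclic (parcs D)"
  proof (rule ccontr)
    assume "\<not> acyclic (parcs D)"
    then obtain x where "(x, x) \<in> (parcs D)\<^sup>+" by (auto simp: acyclic_def)
    then obtain p where "awalk x p x" "p \<noteq> []" using reachable1_awalk by auto
    then have "closed_w p" by (auto simp: closed_w_def)
    then have "\<exists>p. cycle p" by (rule closed_w_imp_cycle)
    then show False using assms by (auto simp: acyclic_digraph_def)
  qed
  show "wf (parcs D)" by (rule finite_acyclic_wf[OF pair_finite_arcs ac])
  show "wf ((parcs D)\<inverse>)" by (rule finite_acyclic_wf_converse[OF pair_finite_arcs ac])
  show "\<And>x y. (x, y) \<in> parcs D \<Longrightarrow> x \<in> pverts D \<and> y \<in> pverts D" by (auto dest: wellformed')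
qed

lemma in_degree_eq_0_iff:
  "finite (parcs D) \<Longrightarrow> in_degree (with_proj D) v = 0 \<longleftrightarrow> (\<forall>u. (u, v) \<notin> parcs D)"
  by (auto simp: in_degree_def in_arcs_def)

lemma out_degree_eq_0_iff:
  "finite (parcs D) \<Longrightarrow> out_degree (with_proj D) v = 0 \<longleftrightarrow> v \<notin> fst ` parcs D"
  by (force simp: out_degree_def out_arcs_def)

lemma sources_eq:
  "finite (parcs D) \<Longrightarrow> sources D = pverts D - snd ` parcs D"
  by (force simp: sources_def in_degree_eq_0_iff)

lemma sources_singletonD:
  assumes "sources D = {r}" "finite (parcs D)"
  shows "r \<in> pverts D" "(x, r) \<notin> parcs D"
proof -
  have "r \<in> pverts D - snd ` parcs D" using assms by (simp flip: sources_eq)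
  then show "r \<in> pverts D" "(x, r) \<notin> parcs D" by force+
qed

lemma card_leaves:
  assumes "finite (pverts T)" "finite (parcs T)" "fst ` parcs T \<subseteq> pverts T"
  shows "card (leaves T) = card (pverts T) - card (fst ` parcs T)"
proof -
  have "leaves T = pverts T - fst ` parcs T"
    using assms by (auto simp: leaves_def out_degree_eq_0_iff)
  then show ?thesis using assms by (simp add: card_Diff_subset)
qed

lemma parcs_mk_symmetric_with_proj [simp]:
  "(u, v) \<in> parcs (mk_symmetric (with_proj T)) \<longleftrightarrow> (u, v) \<in> parcs T \<or> (v, u) \<in> parcs T"
proof -
  have "parcs (mk_symmetric (with_proj T)) = (\<Union>e\<in>parcs T. {e, (snd e, fst e)})"
    by (simp add: parcs_mk_symmetric)
  then show ?thesis by (force simp: prod_eq_iff)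
qed

lemma pcas_nth:
  assumes "pcas u p v" "i < length p"
  shows "fst (p ! i) = (if i = 0 then u else snd (p ! (i - 1)))" "snd (last p) = v"
  using assms
proof (induction p arbitrary: u i)
  case (Cons e es)
  { case 1
    then show ?case using Cons.IH(1)[of "snd e" "i - 1"] by (cases i) (auto simp: nth_Cons')
  next
    case 2
    then show ?case using Cons.IH(2)[of "snd e" 0] by (cases es) auto
  }
qed auto

lemma tl_pawalk_verts: "pcas u p v \<Longrightarrow> p \<noteq> [] \<Longrightarrow> tl (pawalk_verts u p) = map snd p"
proof (induction u p v rule: pcas.induct)
  case (2 u e es v)
  then show ?case by (cases es) auto
qed auto

text \<open>A last vertex of an undirected cycle would have its two neighbours on the cycle as
  in-neighbours.\<close>

lemma no_undirected_cycle:
  assumes T: "pair_digraph T" and wf: "wf ((parcs T)\<inverse>)"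
    and uniq: "\<And>u u' v. (u, v) \<in> parcs T \<Longrightarrow> (u', v) \<in> parcs T \<Longrightarrow> u = u'"
  shows "\<not> (pre_digraph.cycle (with_proj (mk_symmetric (with_proj T))) p \<and> length p \<ge> 3)"
proof
  let ?S = "mk_symmetric (with_proj T)"
  interpret T: pair_digraph T by (rule T)
  interpret S: pair_digraph ?S by (rule T.digraph_mk_symmetric)
  assume "S.cycle p \<and> length p \<ge> 3"
  then obtain u where p: "S.awalk u p u" "distinct (tl (pawalk_verts u p))" and len: "length p \<ge> 3"
    by (auto simp: S.cycle_def)
  then have cas: "pcas u p u" and arcs: "set p \<subseteq> parcs ?S" by (auto simp: S.awalk_def)
  from len have ne: "p \<noteq> []" by auto
  have dist: "distinct (map snd p)" using p(2) tl_pawalk_verts[OF cas ne] by simp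
  define l where "l = length p"
  \<comment> \<open>Vertex number \<open>i\<close> of the cycle is the head of its arc
    \<open>p ! i\<close>; the tail of that arc is then vertex number \<open>prev i\<close>, with
    indices read cyclically.\<close>
  define prev where "prev i = (if i = 0 then l - 1 else i - 1)" for i
  define nxt where "nxt i = (if i = l - 1 then 0 else i + 1)" for i
  have prev: "prev i < l" "fst (p ! i) = snd (p ! prev i)" if "i < l" for i
  proof -
    show "prev i < l" using that by (auto simp: prev_def)
    show "fst (p ! i) = snd (p ! prev i)"
      using pcas_nth[OF cas, of i] that ne by (auto simp: prev_def l_def last_conv_nth)
  qed
  \<comment> \<open>Length at least 3 enters here: on a closed walk of length 2 the two neighbours
    of a vertex coincide.\<close>
  have nxt: "nxt i < l" "prev (nxt i) = i" "prev i \<noteq> nxt i" if "i < l" for i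
    using that len by (auto simp: nxt_def prev_def l_def)
  define C where "C = set (map snd p)"
  have "snd (p ! 0) \<in> C" using ne by (auto simp: C_def)
  then obtain v where v: "v \<in> C" and max: "\<And>w. (v, w) \<in> parcs T \<Longrightarrow> w \<notin> C"
    by (rule wfE_min[OF wf]) auto
  from v obtain i where i: "i < l" "snd (p ! i) = v"
    by (auto simp: C_def l_def in_set_conv_nth)
  have inC: "snd (p ! j) \<in> C" if "j < l" for j using that by (auto simp: C_def l_def)
  have arc: "(fst (p ! j), snd (p ! j)) \<in> parcs ?S" if "j < l" for j
    using arcs that nth_mem[of j p] by (auto simp: l_def)
  have "(snd (p ! prev i), v) \<in> parcs T"
    using arc[OF i(1)] prev[OF i(1)] i max inC by (auto)
  moreover have "(snd (p ! nxt i), v) \<in> parcs T"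
    using arc[OF nxt(1)[OF i(1)]] prev[OF nxt(1)[OF i(1)]] nxt[OF i(1)] i max inC by auto
  ultimately have "snd (p ! prev i) = snd (p ! nxt i)" by (rule uniq)
  then show False
    using dist prev(1)[OF i(1)] nxt(1,3)[OF i(1)]
    by (auto simp: distinct_conv_nth l_def)
qed

text \<open>Following the arcs of \<open>A\<close> backwards must stop, by acyclicity, and can stop
  only at \<open>r\<close>; this connects every vertex to \<open>r\<close>. Unique in-arcs exclude
  undirected cycles.\<close>

lemma out_branchingI:
  assumes D: "acyclic_digraph D" and r: "r \<in> pverts D" and A: "A \<subseteq> parcs D"
    and ex1: "\<And>y. y \<in> pverts D \<Longrightarrow> y \<noteq> r \<Longrightarrow> \<exists>!x. (x, y) \<in> A"
    and root: "\<And>x. (x, r) \<notin> A"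
  shows "out_branching \<lparr>pverts = pverts D, parcs = A\<rparr> D"
proof -
  note D' = acyclic_digraphD[OF D]
  interpret D: pair_digraph D by (rule D')
  let ?T = "\<lparr>pverts = pverts D, parcs = A\<rparr>"
  have finA: "finite A" using A D'(3) by (rule finite_subset)
  have T: "pair_digraph ?T"
    using A D'(2) finA by unfold_locales (auto dest: D.wellformed' D.no_loops' simp: D'(7))
  interpret T: pair_digraph ?T by (rule T)
  interpret S: pair_digraph "mk_symmetric (with_proj ?T)" by (rule T.digraph_mk_symmetric)
  have sub: "subgraph (with_proj ?T) (with_proj D)"
    using A by (intro subgraphI) (auto intro: T.wf_digraph D.wf_digraph)
  have uniq: "u = u'" if "(u, v) \<in> A" "(u', v) \<in> A" for u u' v
    using ex1[of v] root that A D'(7) by blast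
  have reach: "r \<rightarrow>\<^sup>*\<^bsub>mk_symmetric (with_proj ?T)\<^esub> v" if "v \<in> pverts D" for v
    using that
  proof (induction v rule: wf_induct_rule[OF D'(5)])
    case (1 v)
    show ?case
    proof (cases "v = r")
      case True
      then show ?thesis using r by simp
    next
      case False
      then obtain x where x: "(x, v) \<in> A" using ex1[OF 1(2)] by blast
      then have "r \<rightarrow>\<^sup>*\<^bsub>mk_symmetric (with_proj ?T)\<^esub> x" using 1(1) A D'(7) by blast
      moreover have "(x, v) \<in> parcs (mk_symmetric (with_proj ?T))" using x by simp
      ultimately show ?thesis by (rule S.reachable_adj_trans)
    qed
  qed
  have sym: "symmetric (mk_symmetric (with_proj ?T))"
    by (auto simp: symmetric_def sym_def)
  have conn: "connected (with_proj ?T)"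
    unfolding connected_def
  proof (rule strongly_connectedI)
    show "verts (with_proj (mk_symmetric (with_proj ?T))) \<noteq> {}" using r by auto
    fix u v assume "u \<in> verts (with_proj (mk_symmetric (with_proj ?T)))"
      "v \<in> verts (with_proj (mk_symmetric (with_proj ?T)))"
    then have "u \<in> pverts D" "v \<in> pverts D" by auto
    then show "u \<rightarrow>\<^sup>*\<^bsub>mk_symmetric (with_proj ?T)\<^esub> v"
      using S.reachable_trans symmetric_reachable[OF sym] reach by blast
  qed
  have "acyclic A" using D'(4) A by (rule acyclic_subset)
  then have asym: "(u, v) \<in> A \<Longrightarrow> (v, u) \<notin> A" for u v
    by (meson acyclic_def trancl.r_into_trancl trancl_trans)
  have "wf ((parcs ?T)\<inverse>)" using D'(6) A by (auto intro: wf_subset)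
  then have nocyc: "\<nexists>p. pre_digraph.cycle (with_proj (mk_symmetric (with_proj ?T))) p \<and> length p \<ge> 3"
    using no_undirected_cycle[OF T] uniq by (metis pair_pre_digraph.select_convs(2))
  have "oriented_tree ?T"
    unfolding oriented_tree_def using T asym conn nocyc by simp
  moreover have "\<exists>!s. s \<in> pverts ?T \<and> in_degree (with_proj ?T) s = 0"
  proof (rule ex1I[of _ r])
    show "r \<in> pverts ?T \<and> in_degree (with_proj ?T) r = 0"
      using r root finA by (simp add: in_degree_eq_0_iff)
    show "\<And>s. s \<in> pverts ?T \<and> in_degree (with_proj ?T) s = 0 \<Longrightarrow> s = r"
      using ex1 finA by (auto simp: in_degree_eq_0_iff)
  qed
  ultimately show ?thesis
    using sub by (simp add: out_branching_def out_tree_def spanning_def)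
qed

text \<open>Two arcs entering \<open>v\<close> could be completed to an undirected cycle by a path through the root
  that stays within the ancestors of \<open>v\<close>.\<close>

lemma out_branchingD:
  assumes D: "acyclic_digraph D" and "out_branching T D"
  shows "pverts T = pverts D" "parcs T \<subseteq> parcs D" "\<exists>r. sources D = {r}"
    "\<And>u u' v. (u, v) \<in> parcs T \<Longrightarrow> (u', v) \<in> parcs T \<Longrightarrow> u = u'"
proof -
  note D' = acyclic_digraphD[OF D]
  interpret D: pair_digraph D by (rule D')
  from assms have sub: "subgraph (with_proj T) (with_proj D)" and T: "pair_digraph T"
    and nocyc: "\<nexists>p. pre_digraph.cycle (with_proj (mk_symmetric (with_proj T))) p \<and> length p \<ge> 3"
    and root: "\<exists>!r. r \<in> pverts T \<and> in_degree (with_proj T) r = 0"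
    and "spanning (with_proj T) (with_proj D)"
    by (auto simp: out_branching_def out_tree_def oriented_tree_def)
  then show V: "pverts T = pverts D" and A: "parcs T \<subseteq> parcs D"
    by (auto simp: spanning_def subgraph_def)
  interpret T: pair_digraph T by (rule T)
  let ?S = "mk_symmetric (with_proj T)"
  interpret S: pair_digraph ?S by (rule T.digraph_mk_symmetric)
  from root obtain r where r: "r \<in> pverts T" "\<And>x. (x, r) \<notin> parcs T"
    and r_uniq: "\<And>s. s \<in> pverts T \<Longrightarrow> \<forall>x. (x, s) \<notin> parcs T \<Longrightarrow> s = r"
    by (auto simp: in_degree_eq_0_iff T.pair_finite_arcs)
  have acT: "acyclic (parcs T)" using D'(4) A by (rule acyclic_subset)
  have reach: "(r, v) \<in> (parcs T)\<^sup>*" if "v \<in> pverts T" for v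
    using that
  proof (induction v rule: wf_induct_rule[OF D'(5)])
    case (1 v)
    show ?case
    proof (cases "v = r")
      case False
      then obtain x where x: "(x, v) \<in> parcs T" using r_uniq[OF 1(2)] by blast
      then have "(r, x) \<in> (parcs T)\<^sup>*" using 1(1) A T.wellformed' by blast
      with x show ?thesis by simp
    qed simp
  qed
  have src: "s = r" if s: "s \<in> sources D" for s
  proof -
    from s have "s \<in> pverts T" "s \<notin> snd ` parcs D" by (auto simp: sources_eq D'(3) V)
    with A show ?thesis by (intro r_uniq) force+
  qed
  moreover have "sources D \<noteq> {}"
  proof -
    have "r \<in> pverts D" using r(1) V by simp
    then obtain s where s: "s \<in> pverts D" "\<And>y. (y, s) \<in> parcs D \<Longrightarrow> y \<notin> pverts D"
      by (rule wfE_min[OF D'(5)]) auto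
    then have "s \<in> sources D" using D'(7) by (auto simp: sources_eq D'(3))
    then show ?thesis by blast
  qed
  ultimately show "\<exists>r. sources D = {r}" by blast
  show "u1 = u2" if arcs: "(u1, v) \<in> parcs T" "(u2, v) \<in> parcs T" for u1 u2 v
  proof (rule ccontr)
    assume ne: "u1 \<noteq> u2"
    \<comment> \<open>The ancestors of \<open>v\<close>. By acyclicity \<open>v\<close> is not among
      them, so a simple path inside this set can be closed through \<open>v\<close> without
      repeating a vertex.\<close>
    define X where "X = {x \<in> pverts T. (x, v) \<in> (parcs T)\<^sup>+}"
    define G where "G = \<lparr>pverts = X, parcs = parcs ?S \<inter> X \<times> X\<rparr>"
    interpret G: pair_wf_digraph G by unfold_locales (auto simp: G_def)
    have sym: "symmetric (with_proj G)" by (auto simp: symmetric_def sym_def G_def)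
    have toX: "r \<rightarrow>\<^sup>*\<^bsub>with_proj G\<^esub> x" if "x \<in> X" for x
    proof -
      have "(r, x) \<in> (parcs T)\<^sup>*" using reach that by (auto simp: X_def)
      then show ?thesis using that
      proof (induction rule: rtrancl_induct)
        case base
        then show ?case by (intro G.reachable_refl) (simp add: G_def)
      next
        case (step y z)
        then have y: "y \<in> X" using T.wellformed' by (auto simp: X_def)
        then have "(y, z) \<in> parcs G" using step by (auto simp: G_def)
        with step.IH[OF y] show ?case by (rule G.reachable_adj_trans)
      qed
    qed
    have uX: "u1 \<in> X" "u2 \<in> X" using arcs T.wellformed' by (auto simp: X_def)
    have "u1 \<rightarrow>\<^sup>*\<^bsub>with_proj G\<^esub> u2"
      using toX[OF uX(2)] symmetric_reachable[OF sym toX[OF uX(1)]] by (rule G.reachable_trans[rotated])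
    then obtain p where p: "G.apath u1 p u2" unfolding G.reachable_apath by blast
    then have pne: "p \<noteq> []" using ne by (auto simp: G.apath_def G.awalk_def)
    have aw: "G.awalk u1 p u2" and dist: "distinct (pawalk_verts u1 p)"
      using p by (simp_all add: G.apath_def)
    then have cas: "pcas u1 p u2" and "set p \<subseteq> parcs G" by (simp_all add: G.awalk_def)
    then have pS: "set p \<subseteq> parcs ?S" by (auto simp: G_def)
    have pX: "set (pawalk_verts u1 p) \<subseteq> X" using G.awalkE'[OF aw] by (simp add: G_def)
    have vX: "v \<notin> X" using acT by (auto simp: X_def acyclic_def)
    let ?c = "(v, u1) # p @ [(u2, v)]"
    have "pcas u1 (p @ [(u2, v)]) v" using cas by (induction u1 p u2 rule: pcas.induct) auto
    then have "S.awalk v ?c v"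
      using pS arcs T.wellformed' by (auto simp: S.awalk_def)
    moreover have "pawalk_verts u1 (p @ [(u2, v)]) = pawalk_verts u1 p @ [v]"
      using cas by (induction u1 p u2 rule: pcas.induct) auto
    then have "distinct (tl (pawalk_verts v ?c))"
      using dist pX vX by auto
    ultimately have "S.cycle ?c" by (auto simp: S.cycle_def)
    \<comment> \<open>The path between the two in-neighbours is nonempty because they differ;
      together with the two arcs at \<open>v\<close> this gives length at least 3.\<close>
    moreover have "length ?c \<ge> 3" using pne by (cases p) auto
    ultimately show False using nocyc by blast
  qed
qed

section \<open>Matchings as sets of pairs\<close>

text \<open>Turns arcs into edges of \<open>B\<close>, so that the matchings of the specification,
  sets of doubletons, can be handled as sets of pairs.\<close>

definition edge :: "'a \<times> 'b \<Rightarrow> ('a + 'b) set" where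
  "edge e = {Inl (fst e), Inr (snd e)}"

definition pair_matching :: "('a \<times> 'b) set \<Rightarrow> ('a \<times> 'b) set \<Rightarrow> bool" where
  "pair_matching A M \<longleftrightarrow> M \<subseteq> A \<and> inj_on fst M \<and> inj_on snd M"

definition maximum_pair_matching :: "('a \<times> 'b) set \<Rightarrow> ('a \<times> 'b) set \<Rightarrow> bool" where
  "maximum_pair_matching A M \<longleftrightarrow>
     pair_matching A M \<and> (\<forall>M'. pair_matching A M' \<longrightarrow> card M' \<le> card M)"

lemma edge_eq_iff [simp]: "edge e = edge f \<longleftrightarrow> e = f"
  by (auto simp: edge_def doubleton_eq_iff prod_eq_iff)

lemma inj_edge: "inj_on edge A"
  by (auto simp: inj_on_def)

lemma Inr_in_edge [simp]: "Inr y \<in> edge e \<longleftrightarrow> y = snd e"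
  and Inl_in_edge [simp]: "Inl x \<in> edge e \<longleftrightarrow> x = fst e"
  by (auto simp: edge_def)

lemma edge_Pair: "{Inl x, Inr y} = edge (x, y)"
  by (simp add: edge_def)

lemma is_matching_edge: "is_matching (edge ` A) (edge ` M) \<longleftrightarrow> pair_matching A M"
proof -
  have "edge e \<inter> edge f = {} \<longleftrightarrow> fst e \<noteq> fst f \<and> snd e \<noteq> snd f" for e f :: "'a \<times> 'b"
    by (auto simp: edge_def)
  then show ?thesis
    by (auto simp: is_matching_def pair_matching_def inj_image_subset_iff inj_edge inj_on_def)
qed

lemma maximum_matching_edge:
  "maximum_matching (edge ` A) (edge ` M) \<longleftrightarrow> maximum_pair_matching A M"
proof -
  have "(\<forall>M'. is_matching (edge ` A) M' \<longrightarrow> P M') \<longleftrightarrow>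
      (\<forall>M'. pair_matching A M' \<longrightarrow> P (edge ` M'))" for P :: "('a + 'b) set set \<Rightarrow> bool"
    by (metis is_matching_edge is_matching_def subset_imageE)
  then show ?thesis
    by (auto simp: maximum_matching_def maximum_pair_matching_def is_matching_edge
        card_image inj_edge)
qed

lemma maximum_pair_matching_exists:
  assumes "finite A"
  shows "\<exists>M. maximum_pair_matching A M"
proof -
  have "pair_matching A {}" by (simp add: pair_matching_def)
  moreover have "\<forall>M. pair_matching A M \<longrightarrow> card M < Suc (card A)"
    using assms by (auto simp: pair_matching_def less_Suc_eq_le intro: card_mono)
  ultimately obtain M where "pair_matching A M" "\<forall>M'. pair_matching A M' \<longrightarrow> card M' \<le> card M"
    using ex_has_greatest_nat[of "pair_matching A" "{}" card "Suc (card A)"] by auto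
  then show ?thesis by (auto simp: maximum_pair_matching_def)
qed

text \<open>The easy half of Koenig's theorem: the edges of a matching need distinct vertices of the
  cover.\<close>

lemma pair_matching_card_le_cover:
  assumes "pair_matching A M" "finite X" "finite Y"
    and cover: "\<And>x y. (x, y) \<in> A \<Longrightarrow> x \<in> X \<or> y \<in> Y"
  shows "card M \<le> card X + card Y"
proof -
  let ?MX = "{e \<in> M. fst e \<in> X}" and ?MY = "{e \<in> M. snd e \<in> Y}"
  have M: "M \<subseteq> A" "inj_on fst M" "inj_on snd M" using assms by (auto simp: pair_matching_def)
  have "card ?MX \<le> card X" "card ?MY \<le> card Y"
    using M assms(2,3) by (auto intro!: card_inj_on_le intro: inj_on_subset)
  moreover have "finite ?MX" "finite ?MY"
    using M assms(2,3) by (auto intro: inj_on_finite[of fst _ X] inj_on_finite[of snd _ Y] inj_on_subset)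
  moreover have "M = ?MX \<union> ?MY" using M cover by force
  ultimately show ?thesis by (metis (no_types, lifting) add_mono card_Un_le order_trans)
qed

section \<open>Correctness of MINLEAF\<close>

text \<open>No arc enters \<open>r\<close>, so leaving out the copy of \<open>r\<close> loses no
  edge, and the matchings of \<open>B\<close> are those of all arcs of \<open>D\<close>.\<close>

lemma bip_edges_eq:
  assumes "acyclic_digraph D" "sources D = {r}"
  shows "bip_edges D r = edge ` parcs D"
proof -
  note D' = acyclic_digraphD[OF assms(1)]
  have "(x, r) \<notin> parcs D" for x using assms(2) D'(3) by (rule sources_singletonD)
  then show ?thesis using D'(7) by (fastforce simp: bip_edges_def edge_Pair)
qed

text \<open>What an implementation has to deliver: a maximum set of pairs and an in-neighbour
  \<open>h y\<close> of every uncovered \<open>y\<close>.\<close>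

lemma minleaf_runI:
  assumes D: "acyclic_digraph D" and r: "sources D = {r}" and M: "maximum_pair_matching (parcs D) M"
    and h: "\<And>y. y \<in> U \<Longrightarrow> (h y, y) \<in> parcs D" and U: "U = pverts D - {r} - snd ` M"
  shows "minleaf_run D (edge ` M) \<lparr>pverts = pverts D, parcs = M \<union> (\<lambda>y. (h y, y)) ` U\<rparr>"
  unfolding minleaf_run_def
proof (intro exI conjI)
  show "sources D = {r}" by (rule r)
  show "maximum_matching (bip_edges D r) (edge ` M)"
    using M by (simp add: bip_edges_eq[OF D r] maximum_matching_edge)
  have U': "{y \<in> pverts D - {r}. Inr y \<notin> \<Union> (edge ` M)} = U" by (auto simp: U image_iff)
  show "completes D r (edge ` M) (edge ` (M \<union> (\<lambda>y. (h y, y)) ` U))"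
    unfolding completes_def Let_def U'
    by (intro exI[of _ "\<lambda>y. edge (h y, y)"])
      (auto simp: bip_edges_eq[OF D r] h image_Un image_image)
  show "\<lparr>pverts = pverts D, parcs = M \<union> (\<lambda>y. (h y, y)) ` U\<rparr> =
      \<lparr>pverts = pverts D, parcs = {(x, y). {Inl x, Inr y} \<in> edge ` (M \<union> (\<lambda>y. (h y, y)) ` U)}\<rparr>"
    by (auto simp: edge_Pair image_iff)
qed

lemma minleaf_runE:
  assumes D: "acyclic_digraph D" and "minleaf_run D M T"
  obtains r P h U where "sources D = {r}" "maximum_pair_matching (parcs D) P"
    "U = pverts D - {r} - snd ` P" "\<And>y. y \<in> U \<Longrightarrow> (h y, y) \<in> parcs D"
    "T = \<lparr>pverts = pverts D, parcs = P \<union> (\<lambda>y. (h y, y)) ` U\<rparr>"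
proof -
  from assms(2) obtain r Ms where r: "sources D = {r}" and max: "maximum_matching (bip_edges D r) M"
    and "completes D r M Ms" and T: "T = \<lparr>pverts = pverts D, parcs = {(x, y). {Inl x, Inr y} \<in> Ms}\<rparr>"
    by (auto simp: minleaf_run_def)
  note bip = bip_edges_eq[OF D r]
  define P where "P = {e \<in> parcs D. edge e \<in> M}"
  have "M \<subseteq> edge ` parcs D" using max by (simp add: bip maximum_matching_def is_matching_def)
  then have M: "M = edge ` P" by (auto simp: P_def)
  define U where "U = pverts D - {r} - snd ` P"
  have U': "{y \<in> pverts D - {r}. Inr y \<notin> \<Union> M} = U" by (auto simp: U_def M image_iff)
  from \<open>completes D r M Ms\<close> obtain g where g: "\<And>y. y \<in> U \<Longrightarrow> g y \<in> edge ` parcs D \<and> Inr y \<in> g y"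
    and Ms: "Ms = M \<union> g ` U"
    unfolding completes_def Let_def U' bip by auto
  have "\<exists>h. \<forall>y\<in>U. (h y, y) \<in> parcs D \<and> g y = edge (h y, y)"
    by (intro bchoice) (use g in fastforce)
  then obtain h where h: "\<And>y. y \<in> U \<Longrightarrow> (h y, y) \<in> parcs D \<and> g y = edge (h y, y)" by blast
  have "{(x, y). {Inl x, Inr y} \<in> Ms} = P \<union> (\<lambda>y. (h y, y)) ` U"
    using h by (auto simp: Ms M edge_Pair image_iff)
  with h show thesis
    using that[of r P U h] r max T U_def by (auto simp: M bip maximum_matching_edge)
qed

text \<open>An out-branching has as many internal vertices as the matching that picks one child of each
  of them.\<close>

lemma minleaf_run_optimal:
  assumes D: "acyclic_digraph D" and "minleaf_run D M T"
  shows "min_leaf_out_branching T D"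
proof -
  note D' = acyclic_digraphD[OF D]
  from assms obtain r P h U where r: "sources D = {r}" and P: "maximum_pair_matching (parcs D) P"
    and U: "U = pverts D - {r} - snd ` P" and h: "\<And>y. y \<in> U \<Longrightarrow> (h y, y) \<in> parcs D"
    and T: "T = \<lparr>pverts = pverts D, parcs = P \<union> (\<lambda>y. (h y, y)) ` U\<rparr>"
    by (rule minleaf_runE) blast
  have PA: "P \<subseteq> parcs D" "inj_on fst P" "inj_on snd P"
    using P by (auto simp: maximum_pair_matching_def pair_matching_def)
  have r': "r \<in> pverts D" "(x, r) \<notin> parcs D" for x
    using sources_singletonD[OF r D'(3)] by auto
  have ob: "out_branching T D"
    unfolding T
  proof (rule out_branchingI[OF D r'(1)])
    show sub: "P \<union> (\<lambda>y. (h y, y)) ` U \<subseteq> parcs D" using PA h by auto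
    show "(x, r) \<notin> P \<union> (\<lambda>y. (h y, y)) ` U" for x using sub r'(2) by blast
    show "\<exists>!x. (x, y) \<in> P \<union> (\<lambda>y. (h y, y)) ` U" if y: "y \<in> pverts D" "y \<noteq> r" for y
    proof (cases "y \<in> snd ` P")
      case True
      then obtain x where "(x, y) \<in> P" by force
      moreover have "x' = x" if "(x', y) \<in> P" for x'
        using inj_onD[OF PA(3), of "(x', y)" "(x, y)"] that calculation by auto
      ultimately show ?thesis using True by (auto simp: U)
    next
      case False
      then have "y \<in> U" "(x, y) \<notin> P" for x using y by (force simp: U)+
      then show ?thesis by auto
    qed
  qed
  have "card (leaves T) \<le> card (leaves T')" if T': "out_branching T' D" for T'
  proof -
    note T'' = out_branchingD[OF D T']
    have fin: "finite (parcs T')" using T''(2) D'(3) by (rule finite_subset)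
    have finT: "finite (parcs T)" using PA h D'(3) by (auto simp: T intro: finite_subset[OF _ D'(3)])
    let ?I = "fst ` parcs T'"
    have "\<exists>c. \<forall>x\<in>?I. (x, c x) \<in> parcs T'" by (intro bchoice) auto
    then obtain c where c: "\<And>x. x \<in> ?I \<Longrightarrow> (x, c x) \<in> parcs T'" by blast
    \<comment> \<open>A vertex of \<open>T'\<close> has only one in-arc, so different internal
      vertices have different chosen children.\<close>
    have "x = x'" if "x \<in> ?I" "x' \<in> ?I" "c x = c x'" for x x'
      using T''(4)[OF c[OF that(1)]] c[OF that(2)] that(3) by simp
    then have "inj_on snd ((\<lambda>x. (x, c x)) ` ?I)" by (simp add: inj_on_def)
    moreover have "(\<lambda>x. (x, c x)) ` ?I \<subseteq> parcs D" using c T''(2) by blast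
    moreover have "inj_on fst ((\<lambda>x. (x, c x)) ` ?I)" by (simp add: inj_on_def)
    ultimately have "pair_matching (parcs D) ((\<lambda>x. (x, c x)) ` ?I)"
      by (simp add: pair_matching_def)
    then have "card ((\<lambda>x. (x, c x)) ` ?I) \<le> card P"
      using P by (auto simp: maximum_pair_matching_def)
    then have "card ?I \<le> card P" by (simp add: card_image inj_on_def)
    also have "card P = card (fst ` P)" using PA(2) by (simp add: card_image)
    also have "\<dots> \<le> card (fst ` parcs T)"
      by (rule card_mono) (use finT in \<open>auto simp: T\<close>)
    finally have le: "card ?I \<le> card (fst ` parcs T)" .
    have "fst ` parcs T \<subseteq> pverts T" using PA h D'(7) by (force simp: T)
    moreover have "fst ` parcs T' \<subseteq> pverts T'" using T''(1,2) D'(7) by force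
    ultimately show ?thesis
      using le D'(2) fin finT T''(1) by (simp add: card_leaves T)
  qed
  with ob show ?thesis by (simp add: min_leaf_out_branching_def)
qed

lemma minleaf_run_exists:
  assumes D: "acyclic_digraph D" and r: "sources D = {r}"
  shows "\<exists>M T. minleaf_run D M T"
proof -
  note D' = acyclic_digraphD[OF D]
  obtain P where P: "maximum_pair_matching (parcs D) P"
    using maximum_pair_matching_exists[OF D'(3)] by blast
  let ?U = "pverts D - {r} - snd ` P"
  have "\<exists>h. \<forall>y\<in>?U. (h y, y) \<in> parcs D"
  proof (intro bchoice ballI)
    fix y assume "y \<in> ?U"
    then have "y \<in> pverts D" "y \<notin> sources D" using r by auto
    then show "\<exists>x. (x, y) \<in> parcs D" using D'(3) by (auto simp: sources_eq)
  qed
  then obtain h where "\<And>y. y \<in> ?U \<Longrightarrow> (h y, y) \<in> parcs D" by blast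
  from minleaf_runI[OF D r P this refl] show ?thesis by blast
qed

theorem minleaf_correct:
  assumes D: "acyclic_digraph D"
  shows "\<exists>res. minleaf D res"
    and "minleaf D res \<Longrightarrow>
      if \<exists>T. out_branching T D then \<exists>T. res = Some T \<and> min_leaf_out_branching T D else res = None"
proof -
  show "\<exists>res. minleaf D res"
    using minleaf_run_exists[OF D] minleaf.intros
    by (metis card_1_singletonE)
  have single: "card (sources D) = 1" if "out_branching T D" for T
    using out_branchingD(3)[OF D that] by auto
  show "if \<exists>T. out_branching T D then \<exists>T. res = Some T \<and> min_leaf_out_branching T D else res = None"
    if "minleaf D res"
    using that
  proof cases
    case no
    then show ?thesis using single by auto
  next
    case (tree M T)
    then show ?thesis using minleaf_run_optimal[OF D] by (auto simp: min_leaf_out_branching_def)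
  qed
qed

section \<open>Reasoning about programs\<close>

text \<open>\<open>run V c s i s'\<close> counts only the iterations of loops and bounds only the values that are
  stored; intermediate values then stay below a fixed power of \<open>V\<close>.\<close>

inductive run :: "nat \<Rightarrow> com \<Rightarrow> state \<Rightarrow> nat \<Rightarrow> state \<Rightarrow> bool" for V :: nat where
  "run V Skip s 0 s"
| "val s e < V \<Longrightarrow> run V (Assign x e) s 0 (s\<lparr>reg := (reg s)(x := val s e)\<rparr>)"
| "val s e < V \<Longrightarrow>
    run V (Put A i e) s 0 (s\<lparr>arr := (arr s)(A := (arr s A)(val s i := val s e))\<rparr>)"
| "run V c1 s i1 s1 \<Longrightarrow> run V c2 s1 i2 s2 \<Longrightarrow> run V (Seq c1 c2) s (i1 + i2) s2"
| "val s e \<noteq> 0 \<Longrightarrow> run V c1 s i s' \<Longrightarrow> run V (Cond e c1 c2) s i s'"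
| "val s e = 0 \<Longrightarrow> run V c2 s i s' \<Longrightarrow> run V (Cond e c1 c2) s i s'"
| "val s e = 0 \<Longrightarrow> run V (While e c) s 0 s"
| "val s e \<noteq> 0 \<Longrightarrow> run V c s i1 s1 \<Longrightarrow> run V (While e c) s1 i2 s2 \<Longrightarrow>
    run V (While e c) s (Suc (i1 + i2)) s2"

inductive_cases run_SkipE: "run V Skip s i s'"
inductive_cases run_AssignE: "run V (Assign x e) s i s'"
inductive_cases run_PutE: "run V (Put A j e) s i s'"
inductive_cases run_SeqE: "run V (Seq c1 c2) s i s'"
inductive_cases run_CondE: "run V (Cond e c1 c2) s i s'"

section \<open>From iteration counts and stored values to time and word size\<close>

definition bounded :: "nat \<Rightarrow> state \<Rightarrow> bool" where
  "bounded V s \<longleftrightarrow> (\<forall>x. reg s x < V) \<and> (\<forall>A i. arr s A i < V)"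

fun exp_ok :: "nat \<Rightarrow> exp \<Rightarrow> bool" where
  "exp_ok V (Const a) \<longleftrightarrow> a < V"
| "exp_ok V (Reg x) \<longleftrightarrow> True"
| "exp_ok V (Get A e) \<longleftrightarrow> exp_ok V e"
| "exp_ok V (Bin f e1 e2) \<longleftrightarrow> exp_ok V e1 \<and> exp_ok V e2"

fun atoms :: "exp \<Rightarrow> nat" where
  "atoms (Const a) = 1"
| "atoms (Reg x) = 1"
| "atoms (Get A e) = atoms e"
| "atoms (Bin f e1 e2) = atoms e1 + atoms e2"

fun com_ok :: "nat \<Rightarrow> nat \<Rightarrow> com \<Rightarrow> bool" where
  "com_ok V d Skip \<longleftrightarrow> True"
| "com_ok V d (Assign x e) \<longleftrightarrow> exp_ok V e \<and> atoms e \<le> d"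
| "com_ok V d (Put A i e) \<longleftrightarrow> exp_ok V i \<and> atoms i \<le> d \<and> exp_ok V e \<and> atoms e \<le> d"
| "com_ok V d (Seq c1 c2) \<longleftrightarrow> com_ok V d c1 \<and> com_ok V d c2"
| "com_ok V d (Cond e c1 c2) \<longleftrightarrow> exp_ok V e \<and> atoms e \<le> d \<and> com_ok V d c1 \<and> com_ok V d c2"
| "com_ok V d (While e c) \<longleftrightarrow> exp_ok V e \<and> atoms e \<le> d \<and> com_ok V d c"

fun com_cost :: "com \<Rightarrow> nat" where
  "com_cost Skip = 1"
| "com_cost (Assign x e) = cost e + 1"
| "com_cost (Put A i e) = cost i + cost e + 1"
| "com_cost (Seq c1 c2) = com_cost c1 + com_cost c2"
| "com_cost (Cond e c1 c2) = cost e + 1 + com_cost c1 + com_cost c2"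
| "com_cost (While e c) = cost e + 1 + com_cost c"

lemma atoms_pos [simp]: "0 < atoms e"
  by (induction e) auto

text \<open>Every operation stays below the product of the bounds of its operands, so exponents add
  up over the atoms; for \<open>Plus\<close> this uses \<open>2 \<le> V\<close>. An array access
  yields a stored number, below \<open>V\<close>, but keeps the exponent of its index, since the
  index has to fit as well.\<close>

lemma val_less:
  assumes "bounded V s" "exp_ok V e" "2 \<le> V"
  shows "val s e < V ^ atoms e"
  using assms(2)
proof (induction e)
  case (Get A e)
  have "V ^ 1 \<le> V ^ atoms e" using assms(3) by (intro power_increasing) (auto simp: Suc_le_eq)
  then show ?case using assms(1) by (auto simp: bounded_def intro: less_le_trans)
next
  case (Bin f e1 e2)
  let ?a = "val s e1" and ?b = "val s e2" and ?A = "V ^ atoms e1" and ?B = "V ^ atoms e2"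
  have ab: "?a < ?A" "?b < ?B" using Bin by auto
  have AB: "2 \<le> ?A" "2 \<le> ?B"
    using assms(3) power_increasing[of 1 "atoms e1" V] power_increasing[of 1 "atoms e2" V]
    by (auto simp: Suc_le_eq)
  obtain A' B' where "?A = A' + 2" "?B = B' + 2" using AB by (metis le_add_diff_inverse2)
  then have sum: "?A + ?B \<le> ?A * ?B" by (simp add: algebra_simps)
  have le: "x < ?A * ?B" if "x < ?A" for x
    using that AB by (simp add: less_le_trans)
  have "apply_binop f ?a ?b < ?A * ?B"
  proof (cases f)
    case Times
    have "?a * ?b < ?A * ?B" by (rule mult_strict_mono) (use ab AB assms(3) in auto)
    then show ?thesis using Times by simp
  next
    case Div
    have "?a div ?b < ?A" using div_le_dividend ab(1) by (rule le_less_trans)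
    then show ?thesis using Div le by simp
  next
    case Mod
    have "?a mod ?b < ?A" using mod_less_eq_dividend ab(1) by (rule le_less_trans)
    then show ?thesis using Mod le by simp
  qed (use ab AB sum le assms(3) in auto)
  then show ?case by (simp add: power_add)
qed (use assms in \<open>auto simp: bounded_def\<close>)

lemma fits_if_ok:
  assumes "bounded V s" "exp_ok V e" "2 \<le> V" "atoms e \<le> d"
  shows "fits (V ^ d) s e"
proof -
  have less: "val s e' < V ^ d" if "exp_ok V e'" "atoms e' \<le> d" for e'
    using val_less[OF assms(1) that(1) assms(3)] power_increasing[OF that(2), of V] assms(3)
    by linarith
  show ?thesis using assms(2,4)
  proof (induction e)
    case (Bin f e1 e2)
    then show ?case using less[of "Bin f e1 e2"] by simp
  qed (use less[of "Const _"] less[of "Reg _"] less[of "Get _ _"] in \<open>auto simp: Suc_le_eq\<close>)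
qed

text \<open>Between two loop iterations each part of the program text is executed at most once.
  Charging the whole text to every iteration, and once more to the remainder, bounds the
  time.\<close>

theorem run_imp_exec:
  assumes "run V c s i s'" "bounded V s" "com_ok V d c" "2 \<le> V"
  shows "bounded V s' \<and> (\<exists>t. exec (V ^ d) c s t s' \<and> t \<le> com_cost c * Suc i)"
  using assms(1-3)
proof induction
  case (1 s)
  then show ?case by (auto intro!: exI[of _ 1] exec.intros)
next
  case (2 s e x)
  then show ?case
    by (auto intro!: exI[of _ "cost e + 1"] exec.intros fits_if_ok assms(4) simp: bounded_def)
next
  case (3 s e A i)
  then show ?case
    by (auto intro!: exI[of _ "cost i + cost e + 1"] exec.intros fits_if_ok assms(4)
        simp: bounded_def)
next
  case (4 c1 s i1 s1 c2 i2 s2)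
  then obtain t1 t2 where "exec (V ^ d) c1 s t1 s1" "t1 \<le> com_cost c1 * Suc i1"
    "exec (V ^ d) c2 s1 t2 s2" "t2 \<le> com_cost c2 * Suc i2" "bounded V s2" by auto
  moreover from this have "t1 + t2 \<le> com_cost (Seq c1 c2) * Suc (i1 + i2)"
    by (simp add: algebra_simps)
  ultimately show ?case by (blast intro: exec.intros)
next
  case (5 s e c1 i s' c2)
  then obtain t where t: "exec (V ^ d) c1 s t s'" "t \<le> com_cost c1 * Suc i" "bounded V s'" by auto
  then have "exec (V ^ d) (Cond e c1 c2) s (cost e + 1 + t) s'"
    using 5 by (intro exec.CondTrue fits_if_ok assms(4)) auto
  moreover have "cost e + 1 + t \<le> com_cost (Cond e c1 c2) * Suc i"
    using t(2) by (simp add: algebra_simps)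
  ultimately show ?case using t(3) by blast
next
  case (6 s e c2 i s' c1)
  then obtain t where t: "exec (V ^ d) c2 s t s'" "t \<le> com_cost c2 * Suc i" "bounded V s'" by auto
  then have "exec (V ^ d) (Cond e c1 c2) s (cost e + 1 + t) s'"
    using 6 by (intro exec.CondFalse fits_if_ok assms(4)) auto
  moreover have "cost e + 1 + t \<le> com_cost (Cond e c1 c2) * Suc i"
    using t(2) by (simp add: algebra_simps)
  ultimately show ?case using t(3) by blast
next
  case (7 s e c)
  then show ?case
    by (auto intro!: exI[of _ "cost e + 1"] exec.WhileFalse fits_if_ok assms(4))
next
  case (8 s e c i1 s1 i2 s2)
  then obtain t1 t2 where t: "exec (V ^ d) c s t1 s1" "t1 \<le> com_cost c * Suc i1"
    "exec (V ^ d) (While e c) s1 t2 s2" "t2 \<le> com_cost (While e c) * Suc i2" "bounded V s2"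
    by auto
  then have "exec (V ^ d) (While e c) s (cost e + 1 + t1 + t2) s2"
    using 8 by (intro exec.WhileTrue[OF _ _ t(1,3)] fits_if_ok assms(4)) auto
  moreover have "cost e + 1 + t1 + t2 \<le> com_cost (While e c) * Suc (Suc (i1 + i2))"
    using t(2,4) by (simp add: algebra_simps)
  ultimately show ?case using t(5) by blast
qed

section \<open>Frame conditions and weakest preconditions with budgets\<close>

fun written_regs :: "com \<Rightarrow> string set" where
  "written_regs (Assign x e) = {x}"
| "written_regs (Seq c1 c2) = written_regs c1 \<union> written_regs c2"
| "written_regs (Cond e c1 c2) = written_regs c1 \<union> written_regs c2"
| "written_regs (While e c) = written_regs c"
| "written_regs _ = {}"

fun written_arrs :: "com \<Rightarrow> string set" where
  "written_arrs (Put A i e) = {A}"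
| "written_arrs (Seq c1 c2) = written_arrs c1 \<union> written_arrs c2"
| "written_arrs (Cond e c1 c2) = written_arrs c1 \<union> written_arrs c2"
| "written_arrs (While e c) = written_arrs c"
| "written_arrs _ = {}"

lemma run_frame:
  assumes "run V c s i s'"
  shows "x \<notin> written_regs c \<Longrightarrow> reg s' x = reg s x" "A \<notin> written_arrs c \<Longrightarrow> arr s' A = arr s A"
  using assms by induction auto

text \<open>The postcondition also receives the number of loop iterations that is left over from the
  budget \<open>k\<close>.  As every iteration uses up one, budgets also make loops terminate.\<close>

definition wp :: "nat \<Rightarrow> com \<Rightarrow> (state \<Rightarrow> nat \<Rightarrow> bool) \<Rightarrow> state \<Rightarrow> nat \<Rightarrow> bool" where
  "wp V c Q s k \<longleftrightarrow> (\<exists>i s'. run V c s i s' \<and> i \<le> k \<and> Q s' (k - i))"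

lemma wp_Skip [simp]: "wp V Skip Q s k \<longleftrightarrow> Q s k"
  by (auto simp: wp_def intro: run.intros elim!: run_SkipE intro!: exI[of _ 0])

lemma wp_Assign [simp]:
  "wp V (Assign x e) Q s k \<longleftrightarrow> val s e < V \<and> Q (s\<lparr>reg := (reg s)(x := val s e)\<rparr>) k"
  by (auto simp: wp_def intro: run.intros elim!: run_AssignE intro!: exI[of _ 0])

lemma wp_Put [simp]:
  "wp V (Put A i e) Q s k \<longleftrightarrow>
     val s e < V \<and> Q (s\<lparr>arr := (arr s)(A := (arr s A)(val s i := val s e))\<rparr>) k"
  by (auto simp: wp_def intro: run.intros elim!: run_PutE intro!: exI[of _ 0])

lemma wp_Seq [simp]: "wp V (Seq c1 c2) Q s k \<longleftrightarrow> wp V c1 (wp V c2 Q) s k"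
proof
  assume "wp V (Seq c1 c2) Q s k"
  then obtain i1 i2 s1 s2 where "run V c1 s i1 s1" "run V c2 s1 i2 s2" "i1 + i2 \<le> k"
    "Q s2 (k - (i1 + i2))"
    by (auto simp: wp_def elim!: run_SeqE)
  moreover from this have "i1 \<le> k" "i2 \<le> k - i1" "k - i1 - i2 = k - (i1 + i2)" by auto
  ultimately show "wp V c1 (wp V c2 Q) s k" unfolding wp_def by metis
next
  assume "wp V c1 (wp V c2 Q) s k"
  then obtain i1 i2 s1 s2 where "run V c1 s i1 s1" "run V c2 s1 i2 s2" "i1 \<le> k" "i2 \<le> k - i1"
    "Q s2 (k - i1 - i2)"
    by (auto simp: wp_def)
  moreover from this have "i1 + i2 \<le> k" "k - i1 - i2 = k - (i1 + i2)" by auto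
  ultimately show "wp V (Seq c1 c2) Q s k" unfolding wp_def by (metis run.intros(4))
qed

lemma wp_Cond [simp]:
  "wp V (Cond e c1 c2) Q s k \<longleftrightarrow> (if val s e \<noteq> 0 then wp V c1 Q s k else wp V c2 Q s k)"
  by (auto simp: wp_def intro: run.intros elim!: run_CondE)

text \<open>The frame conditions are handed to the postcondition, so the lemmas on single loops need
  not list what they leave unchanged.\<close>

lemma wp_conseq:
  assumes "wp V c P s k"
    and "\<And>s' k'. P s' k' \<Longrightarrow> k' \<le> k \<Longrightarrow> (\<And>x. x \<notin> written_regs c \<Longrightarrow> reg s' x = reg s x) \<Longrightarrow>
      (\<And>A. A \<notin> written_arrs c \<Longrightarrow> arr s' A = arr s A) \<Longrightarrow> Q s' k'"
  shows "wp V c Q s k"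
  using assms run_frame unfolding wp_def by (metis diff_le_self)

lemma wp_While:
  assumes "I s k"
    and step: "\<And>s k. I s k \<Longrightarrow> val s e \<noteq> 0 \<Longrightarrow> 0 < k \<and> wp V c I s (k - 1)"
    and "\<And>s k. I s k \<Longrightarrow> val s e = 0 \<Longrightarrow> Q s k"
  shows "wp V (While e c) Q s k"
  using assms(1)
proof (induction k arbitrary: s rule: less_induct)
  case (less k)
  show ?case
  proof (cases "val s e = 0")
    case True
    then show ?thesis
      using assms(3)[OF less.prems] by (auto simp: wp_def intro: run.intros intro!: exI[of _ 0])
  next
    case False
    then obtain i1 s1 where 1: "0 < k" "run V c s i1 s1" "i1 \<le> k - 1" "I s1 (k - 1 - i1)"
      using step[OF less.prems] by (auto simp: wp_def)
    moreover from this obtain i2 s2 where 2: "run V (While e c) s1 i2 s2" "i2 \<le> k - 1 - i1"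
      "Q s2 (k - 1 - i1 - i2)"
      using less.IH[of "k - 1 - i1" s1] by (auto simp: wp_def)
    ultimately show ?thesis
      unfolding wp_def
      by (intro exI[of _ "Suc (i1 + i2)"] exI[of _ s2]) (auto intro: run.intros(8)[OF False])
  qed
qed

section \<open>Matchings stored in arrays\<close>

definition matching_number :: "('a \<times> 'b) set \<Rightarrow> nat" where
  "matching_number A = card (SOME M. maximum_pair_matching A M)"

lemma maximum_pair_matching_some:
  assumes "finite A"
  shows "maximum_pair_matching A (SOME M. maximum_pair_matching A M)"
  using maximum_pair_matching_exists[OF assms] by (rule someI_ex)

lemma card_le_matching_number: "finite A \<Longrightarrow> pair_matching A M \<Longrightarrow> card M \<le> matching_number A"
  using maximum_pair_matching_some[of A] by (simp add: matching_number_def maximum_pair_matching_def)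

lemma matching_number_le_cover:
  assumes "finite A" "finite X" "finite Y" "\<And>x y. (x, y) \<in> A \<Longrightarrow> x \<in> X \<or> y \<in> Y"
  shows "matching_number A \<le> card X + card Y"
proof -
  have "pair_matching A M" if "maximum_pair_matching A M" for M
    using that by (simp add: maximum_pair_matching_def)
  from pair_matching_card_le_cover[OF this[OF maximum_pair_matching_some[OF assms(1)]] assms(2-4)]
  show ?thesis by (simp add: matching_number_def)
qed

lemma maximum_pair_matchingI:
  "finite A \<Longrightarrow> pair_matching A M \<Longrightarrow> matching_number A \<le> card M \<Longrightarrow> maximum_pair_matching A M"
  using card_le_matching_number unfolding maximum_pair_matching_def by (meson le_trans)

text \<open>The arrays store \<open>Suc\<close> of a partner.  If \<open>cur\<close> is not 0 then \<open>cur - 1\<close> is an unmatched vertex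
  that the algorithm is about to match.\<close>

definition mates :: "nat \<Rightarrow> (nat \<times> nat) set \<Rightarrow> (nat \<Rightarrow> nat) \<Rightarrow> (nat \<Rightarrow> nat) \<Rightarrow> nat \<Rightarrow> bool" where
  "mates n A mate mx cur \<longleftrightarrow>
     (\<forall>x<n. \<forall>y<n. mate y = Suc x \<longleftrightarrow> mx x = Suc y) \<and>
     (\<forall>y<n. \<forall>x. mate y = Suc x \<longrightarrow> (x, y) \<in> A) \<and>
     (\<forall>x<n. \<forall>y. mx x = Suc y \<longrightarrow> y < n) \<and>
     cur \<le> n \<and> (\<forall>x. cur = Suc x \<longrightarrow> mx x = 0)"

definition matched :: "nat \<Rightarrow> (nat \<Rightarrow> nat) \<Rightarrow> nat set" where
  "matched n mate = {y. y < n \<and> mate y \<noteq> 0}"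

lemma finite_matched [simp]: "finite (matched n mate)"
  by (simp add: matched_def)

lemma mx_mate: "mates n A mate mx cur \<Longrightarrow> x < n \<Longrightarrow> mx x = Suc y \<Longrightarrow> mate y = Suc x"
  and mx_less: "mates n A mate mx cur \<Longrightarrow> x < n \<Longrightarrow> mx x = Suc y \<Longrightarrow> y < n"
  and mate_mx: "mates n A mate mx cur \<Longrightarrow> x < n \<Longrightarrow> y < n \<Longrightarrow> mate y = Suc x \<Longrightarrow> mx x = Suc y"
  by (auto simp: mates_def)

locale bip_graph =
  fixes n :: nat and A :: "(nat \<times> nat) set"
  assumes A_subset: "A \<subseteq> {..<n} \<times> {..<n}"
begin

lemma finite_A: "finite A"
  using A_subset by (rule finite_subset) simp

lemma A_less: "(x, y) \<in> A \<Longrightarrow> x < n" "(x, y) \<in> A \<Longrightarrow> y < n"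
  using A_subset by auto

lemma mate_less: "mates n A mate mx cur \<Longrightarrow> y < n \<Longrightarrow> mate y = Suc x \<Longrightarrow> x < n"
  by (rule A_less(1)[of x y]) (simp add: mates_def)

lemma mate_le: "mates n A mate mx cur \<Longrightarrow> y < n \<Longrightarrow> mate y \<le> n"
  using mate_less by (cases "mate y") (auto simp: Suc_le_eq)

lemma mate_unique:
  "mates n A mate mx cur \<Longrightarrow> y < n \<Longrightarrow> y' < n \<Longrightarrow> mate y = Suc x \<Longrightarrow> mate y' = Suc x \<Longrightarrow> y = y'"
  using mate_mx[of n A mate mx cur x y] mate_mx[of n A mate mx cur x y']
    mate_less[of mate mx cur y x] by simp

lemma pair_matching_pairs_of:
  assumes "mates n A mate mx cur"
  shows "pair_matching A (pairs_of n mate)" "card (pairs_of n mate) = card (matched n mate)"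
proof -
  have snd: "inj_on snd (pairs_of n mate)" by (auto simp: inj_on_def pairs_of_def)
  moreover have "inj_on fst (pairs_of n mate)"
    using mate_unique[OF assms] by (auto simp: inj_on_def pairs_of_def)
  moreover have "pairs_of n mate \<subseteq> A" using assms by (auto simp: mates_def pairs_of_def)
  ultimately show "pair_matching A (pairs_of n mate)" by (simp add: pair_matching_def)
  have "snd ` pairs_of n mate = matched n mate"
    by (force simp: pairs_of_def matched_def gr0_conv_Suc)
  then show "card (pairs_of n mate) = card (matched n mate)" using snd by (metis card_image)
qed

lemma card_matched_le_number:
  "mates n A mate mx cur \<Longrightarrow> card (matched n mate) \<le> matching_number A"
  using pair_matching_pairs_of[of mate mx cur] card_le_matching_number[OF finite_A] by metis

lemma mates_augment:
  assumes "mates n A mate mx (Suc x)" "(x, y) \<in> A" "mate y = 0"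
  shows "mates n A (mate(y := Suc x)) (mx(x := Suc y)) 0"
proof -
  have y: "y < n" using A_less[OF assms(2)] by simp
  moreover have "\<forall>x<n. mx x \<noteq> Suc y" using mx_mate[OF assms(1)] assms(3) by fastforce
  ultimately show ?thesis using assms(1,2) unfolding mates_def by (auto split: if_splits)
qed

text \<open>The exchange by which both phases move along an alternating path: \<open>x\<close> takes
  \<open>y\<close>, and its former partner \<open>z\<close> becomes the vertex to be matched. Every
  matched \<open>y\<close> stays matched. Undoing a step of the depth-first search is the same
  exchange.\<close>

lemma mates_steal:
  assumes "mates n A mate mx (Suc x)" "(x, y) \<in> A" "mate y = Suc z"
  shows "mates n A (mate(y := Suc x)) (mx(x := Suc y, z := 0)) (Suc z)"
proof -
  have *: "x < n" "y < n" "z < n" using A_less[OF assms(2)] mate_less[OF assms(1) _ assms(3)] by auto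
  moreover have "mx z = Suc y" "mx x = 0" using assms * by (auto simp: mates_def)
  ultimately have zx: "z \<noteq> x" "mx z = Suc y" "mx x = 0" by auto
  show ?thesis
    unfolding mates_def
  proof (intro conjI allI impI)
    fix x' y' assume x': "x' < n" and y': "y' < n"
    show "(mate(y := Suc x)) y' = Suc x' \<longleftrightarrow> (mx(x := Suc y, z := 0)) x' = Suc y'"
    proof (cases "y' = y")
      case True
      have "mx x' \<noteq> Suc y" if "x' \<noteq> z"
        using mx_mate[OF assms(1) x'] assms(3) that by fastforce
      then show ?thesis using True zx(1) by (cases "x' = z"; cases "x' = x") simp_all
    next
      case False
      then have "mate y' \<noteq> Suc z" using mate_unique[OF assms(1) y' *(2) _ assms(3)] by blast
      moreover have "mate y' \<noteq> Suc x" using mate_mx[OF assms(1) *(1) y'] zx(3) by auto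
      moreover have "mate y' = Suc x' \<longleftrightarrow> mx x' = Suc y'"
        using assms(1) x' y' by (simp add: mates_def)
      ultimately show ?thesis using False by (cases "x' = z"; cases "x' = x") simp_all
    qed
  next
    fix x' y' assume "y' < n" "(mate(y := Suc x)) y' = Suc x'"
    then show "(x', y') \<in> A" using assms(1,2) by (cases "y' = y") (auto simp: mates_def)
  next
    fix x' y' assume "x' < n" "(mx(x := Suc y, z := 0)) x' = Suc y'"
    then show "y' < n" using mx_less[OF assms(1)] *(2) by (cases "x' = z"; cases "x' = x") auto
  qed (use * in auto)
qed

lemma matched_upd:
  "y < n \<Longrightarrow> matched n (mate(y := Suc x)) = insert y (matched n mate)"
  by (auto simp: matched_def)

text \<open>Bounds the left part of a vertex cover: matched vertices are counted through their
  partners, which are distinct.\<close>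

lemma card_le_partners:
  assumes "mates n A mate mx 0" and X: "\<And>x. x \<in> X \<Longrightarrow> x < n \<and> mx x \<noteq> 0 \<and> mx x - 1 \<in> Y"
    and "finite Y"
  shows "card X \<le> card Y"
proof (rule card_inj_on_le[of "\<lambda>x. mx x - 1"])
  show "inj_on (\<lambda>x. mx x - 1) X"
  proof (rule inj_onI)
    fix x x' assume xx: "x \<in> X" "x' \<in> X" and "mx x - 1 = mx x' - 1"
    then obtain y where "mx x = Suc y" "mx x' = Suc y"
      using X[OF xx(1)] X[OF xx(2)] by (metis One_nat_def Suc_pred neq0_conv)
    then have "mate y = Suc x" "mate y = Suc x'"
      using assms(1) X[OF xx(1)] X[OF xx(2)] by (auto simp: mates_def)
    then show "x = x'" by simp
  qed
qed (use X assms(3) in auto)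

end

section \<open>Sets of numbers as arrays of words\<close>

lemma nat_less_exp_if_bits:
  assumes "\<And>i. bit a i \<Longrightarrow> i < b"
  shows "(a :: nat) < 2 ^ b"
proof -
  have "take_bit b a = a" using assms by (auto intro: bit_eqI simp: bit_take_bit_iff)
  then show ?thesis by (simp add: take_bit_nat_eq_self_iff)
qed

text \<open>The machine has no bitwise operations: a bit known to be clear is set by adding a power
  of two, and a bit known to be set is cleared by subtracting one.\<close>

lemma bit_add_exp: "\<not> bit a i \<Longrightarrow> bit (a + 2 ^ i) j \<longleftrightarrow> bit a j \<or> j = i" for a :: nat
proof -
  assume "\<not> bit a i"
  then have "a + 2 ^ i = set_bit i a" by (simp add: set_bit_eq)
  then show ?thesis by (auto simp: bit_set_bit_iff)
qed

lemma bit_diff_exp: "bit a i \<Longrightarrow> bit (a - 2 ^ i) j \<longleftrightarrow> bit a j \<and> j \<noteq> i" for a :: nat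
proof -
  assume "bit a i"
  then have "set_bit i (unset_bit i a) = a"
    by (auto intro!: bit_eqI simp: bit_set_bit_iff bit_unset_bit_iff)
  then have "unset_bit i a + 2 ^ i = a" by (simp add: set_bit_eq bit_unset_bit_iff)
  then have "a - 2 ^ i = unset_bit i a" by (metis add_diff_cancel_right')
  then show ?thesis by (auto simp: bit_unset_bit_iff)
qed

text \<open>Only elements below \<open>n\<close> are represented, so \<open>T\<close> may be
  infinite; this allows \<open>UNIV\<close>, complements \<open>- V\<close> and the sets of all
  \<open>y\<close> with a given label.\<close>

definition reps :: "nat \<Rightarrow> nat \<Rightarrow> (nat \<Rightarrow> nat) \<Rightarrow> nat set \<Rightarrow> bool" where
  "reps n b U T \<longleftrightarrow> (\<forall>q<n. \<forall>i. bit (U q) i \<longleftrightarrow> i < b \<and> q * b + i < n \<and> q * b + i \<in> T)"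

lemma repsD: "reps n b U T \<Longrightarrow> q < n \<Longrightarrow> bit (U q) i \<longleftrightarrow> i < b \<and> q * b + i < n \<and> q * b + i \<in> T"
  by (simp add: reps_def)

lemma reps_word_less: "reps n b U T \<Longrightarrow> q < n \<Longrightarrow> U q < 2 ^ b"
  by (auto simp: reps_def intro: nat_less_exp_if_bits)

lemma word_index_eq:
  assumes "i < b" "j < b"
  shows "q * b + i = r * b + j \<longleftrightarrow> q = r \<and> i = (j :: nat)"
proof
  assume "q * b + i = r * b + j"
  then have "(q * b + i) div b = (r * b + j) div b" "(q * b + i) mod b = (r * b + j) mod b" by simp_all
  then show "q = r \<and> i = j" using assms by simp
qed simp

lemma reps_insert:
  assumes "reps n b U T" "q * b + i \<notin> T" "i < b" "q < n" "q * b + i < n"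
  shows "reps n b (U(q := U q + 2 ^ i)) (insert (q * b + i) T)"
proof -
  have "\<not> bit (U q) i" using assms by (simp add: reps_def)
  then have upd: "bit (U q + 2 ^ i) j \<longleftrightarrow> bit (U q) j \<or> j = i" for j by (rule bit_add_exp)
  show ?thesis unfolding reps_def
  proof (intro allI impI)
    fix r j assume r: "r < n"
    show "bit ((U(q := U q + 2 ^ i)) r) j \<longleftrightarrow>
        j < b \<and> r * b + j < n \<and> r * b + j \<in> insert (q * b + i) T"
      using repsD[OF assms(1) r, of j] upd[of j] assms(3,5) word_index_eq[OF _ assms(3), of j r q]
      by (cases "j < b"; cases "r = q") auto
  qed
qed

lemma reps_remove:
  assumes "reps n b U T" "q * b + i \<in> T" "i < b" "q < n" "q * b + i < n"
  shows "reps n b (U(q := U q - 2 ^ i)) (T - {q * b + i})"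
proof -
  have "bit (U q) i" using assms by (simp add: reps_def)
  then have upd: "bit (U q - 2 ^ i) j \<longleftrightarrow> bit (U q) j \<and> j \<noteq> i" for j by (rule bit_diff_exp)
  show ?thesis unfolding reps_def
  proof (intro allI impI)
    fix r j assume r: "r < n"
    show "bit ((U(q := U q - 2 ^ i)) r) j \<longleftrightarrow>
        j < b \<and> r * b + j < n \<and> r * b + j \<in> T - {q * b + i}"
      using repsD[OF assms(1) r, of j] upd[of j] assms(3) word_index_eq[OF _ assms(3), of j r q]
      by (cases "j < b"; cases "r = q") auto
  qed
qed

text \<open>The specification of a table entry \<open>t\<close> for the words \<open>a\<close> and
  \<open>c\<close>. Which common bit is named stays open, since both searches accept any eligible
  neighbour.\<close>

definition common_bit :: "nat \<Rightarrow> nat \<Rightarrow> nat \<Rightarrow> bool" where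
  "common_bit t a c \<longleftrightarrow>
     (case t of 0 \<Rightarrow> \<forall>i. \<not> (bit a i \<and> bit c i) | Suc i \<Rightarrow> bit a i \<and> bit c i)"

text \<open>The neighbours of \<open>x\<close> are kept as the words \<open>cw p\<close> at the positions \<open>cs x \<le> p < cs (x + 1)\<close>;
  bit \<open>i\<close> of the word stands for the vertex \<open>ci p * b + i\<close>.\<close>

locale word_graph = bip_graph +
  fixes b :: nat and cs ci cw tab :: "nat \<Rightarrow> nat"
  assumes b_pos: "0 < b"
    and cs_0: "cs 0 = 0" and cs_mono: "\<And>x. x < n \<Longrightarrow> cs x \<le> cs (Suc x)"
    and ci_less: "\<And>x p. x < n \<Longrightarrow> cs x \<le> p \<Longrightarrow> p < cs (Suc x) \<Longrightarrow> ci p < n"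
    and cw_sound: "\<And>x p i. x < n \<Longrightarrow> cs x \<le> p \<Longrightarrow> p < cs (Suc x) \<Longrightarrow> bit (cw p) i \<Longrightarrow>
      i < b \<and> (x, ci p * b + i) \<in> A"
    and cw_complete: "\<And>x y. (x, y) \<in> A \<Longrightarrow>
      \<exists>p. cs x \<le> p \<and> p < cs (Suc x) \<and> ci p = y div b \<and> bit (cw p) (y mod b)"
    and tab: "\<And>a c. a < 2 ^ b \<Longrightarrow> c < 2 ^ b \<Longrightarrow> common_bit (tab (a * 2 ^ b + c)) a c"
begin

abbreviation "len x \<equiv> cs (Suc x) - cs x"

lemma sum_len: "x \<le> n \<Longrightarrow> (\<Sum>x<x. len x) = cs x"
  by (induction x) (use cs_0 cs_mono in auto)

lemma cs_le: "x \<le> n \<Longrightarrow> cs x \<le> cs n"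
proof (induction rule: inc_induct)
  case (step x)
  then show ?case using cs_mono[of x] by linarith
qed simp

lemma scan_none:
  assumes "reps n b U T" "x < n" "cs x \<le> p" "p < cs (Suc x)" "tab (cw p * 2 ^ b + U (ci p)) = 0"
    "bit (cw p) i"
  shows "ci p * b + i \<notin> T"
proof -
  have *: "cw p < 2 ^ b" using cw_sound[OF assms(2-4)] by (auto intro: nat_less_exp_if_bits)
  have "ci p < n" using ci_less[OF assms(2-4)] .
  moreover from this have "U (ci p) < 2 ^ b" by (rule reps_word_less[OF assms(1)])
  from tab[OF * this] assms(5,6) have "\<not> bit (U (ci p)) i" by (auto simp: common_bit_def)
  ultimately show ?thesis
    using repsD[OF assms(1)] cw_sound[OF assms(2-4,6)] A_less by blast
qed

lemma scan_some:
  assumes "reps n b U T" "x < n" "cs x \<le> p" "p < cs (Suc x)" "tab (cw p * 2 ^ b + U (ci p)) = Suc i"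
  shows "i < b" "ci p < n" "ci p * b + i < n" "(x, ci p * b + i) \<in> A" "ci p * b + i \<in> T"
proof -
  have *: "cw p < 2 ^ b" using cw_sound[OF assms(2-4)] by (auto intro: nat_less_exp_if_bits)
  show "ci p < n" using ci_less[OF assms(2-4)] .
  moreover from this have "U (ci p) < 2 ^ b" by (rule reps_word_less[OF assms(1)])
  from tab[OF * this] assms(5) have bits: "bit (cw p) i" "bit (U (ci p)) i"
    by (auto simp: common_bit_def)
  ultimately show "i < b" "ci p * b + i < n" "(x, ci p * b + i) \<in> A" "ci p * b + i \<in> T"
    using repsD[OF assms(1)] cw_sound[OF assms(2-4) bits(1)] by blast+
qed

lemma seg_complete:
  assumes "(x, y) \<in> A"
  obtains p i where "cs x \<le> p" "p < cs (Suc x)" "bit (cw p) i" "ci p * b + i = y"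
  using cw_complete[OF assms] that by (metis div_mult_mod_eq)

end

lemma sum_change:
  fixes f g :: "nat \<Rightarrow> nat"
  assumes "x < n" "\<And>z. z \<noteq> x \<Longrightarrow> g z = f z"
  shows "sum g {..<n} + f x = sum f {..<n} + g x"
proof -
  have "sum g ({..<n} - {x}) = sum f ({..<n} - {x})" using assms(2) by (intro sum.cong) auto
  then show ?thesis using assms(1) by (simp add: sum.remove[of "{..<n}" x])
qed

context word_graph begin

section \<open>First phase: cheap augmentations by labels\<close>

text \<open>A free vertex \<open>x\<close> takes a neighbour \<open>y\<close> whose label \<open>d y\<close> equals the current level \<open>lev x\<close>, the
  smallest label among its neighbours, whereby \<open>d y\<close> grows by 1 and the previous partner of \<open>y\<close>
  becomes free; \<open>x\<close> is given up at level \<open>l\<close>.  Row \<open>i\<close> of \<open>S\<close> represents the set of vertices with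
  label \<open>i\<close>, and \<open>off x\<close> says how far the words of \<open>x\<close> have been searched at its present level.\<close>

definition budget1 :: "nat \<Rightarrow> nat" where
  "budget1 l = l * (cs n + n) + cs n + n * l + 2 * n + 1"

definition phase1 :: "nat \<Rightarrow> (nat \<Rightarrow> nat) \<Rightarrow> (nat \<Rightarrow> nat) \<Rightarrow> (nat \<Rightarrow> nat) \<Rightarrow> nat \<Rightarrow> nat \<Rightarrow> (nat \<Rightarrow> nat) \<Rightarrow>
    (nat \<Rightarrow> nat) \<Rightarrow> (nat \<Rightarrow> nat) \<Rightarrow> nat \<Rightarrow> bool" where
  "phase1 l d mate mx cur idx lev off S k \<longleftrightarrow>
     mates n A mate mx cur \<and> idx \<le> n \<and>
     (\<forall>x<n. cs x + off x \<le> cs (Suc x) \<and> lev x \<le> l) \<and>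
     (\<forall>x y. (x, y) \<in> A \<longrightarrow> lev x \<le> d y) \<and>
     (\<forall>x<n. \<forall>p i. cs x \<le> p \<longrightarrow> p < cs x + off x \<longrightarrow> bit (cw p) i \<longrightarrow> lev x < d (ci p * b + i)) \<and>
     (\<forall>y<n. d y \<le> l \<and> (mate y = 0 \<longleftrightarrow> d y = 0) \<and> (\<forall>x. mate y = Suc x \<longrightarrow> d y = Suc (lev x))) \<and>
     (\<forall>i\<le>l. reps n b (\<lambda>q. S (i * n + q)) {y. d y = i}) \<and>
     (\<forall>x<idx. mx x = 0 \<longrightarrow> lev x = l \<or> cur = Suc x) \<and>
     budget1 l + (if cur = 0 then 0 else 1) \<le>
       k + (\<Sum>x<n. lev x * Suc (len x) + off x) + (\<Sum>y<n. d y) + 2 * idx"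

text \<open>The potential in the last conjunct of \<open>phase1\<close> never exceeds
  \<open>budget1 l - 1\<close>, so something is left to pay for an iteration. Each case of the loop
  body raises the potential, or resets \<open>cur\<close> to 0. In a full sweep \<open>x\<close>
  contributes \<open>Suc (len x)\<close> per level: \<open>len x\<close> words and the change of
  level. The weight 2 of \<open>idx\<close> pays for starting a vertex and for giving one
  up.\<close>

lemma phase1_k_pos:
  assumes "phase1 l d mate mx cur idx lev off S k"
  shows "0 < k"
proof -
  have bounds: "lev x * Suc (len x) + off x \<le> l * Suc (len x) + len x" if "x < n" for x
  proof -
    have "lev x \<le> l" "off x \<le> len x" using assms that by (auto simp: phase1_def)
    then show ?thesis by (intro add_mono mult_le_mono) auto
  qed
  have "(\<Sum>x<n. lev x * Suc (len x) + off x) \<le> (\<Sum>x<n. l * Suc (len x) + len x)"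
    using bounds by (intro sum_mono) simp
  also have "\<dots> = l * (\<Sum>x<n. Suc (len x)) + (\<Sum>x<n. len x)"
    by (simp only: sum.distrib sum_distrib_left)
  also have "\<dots> = l * (cs n + n) + cs n" by (simp only: sum_Suc sum_len) simp
  finally have "(\<Sum>x<n. lev x * Suc (len x) + off x) \<le> l * (cs n + n) + cs n" .
  moreover have "(\<Sum>y<n. d y) \<le> n * l"
    using sum_bounded_above[of "{..<n}" d l] assms by (auto simp: phase1_def)
  moreover have "idx \<le> n" "budget1 l \<le>
      k + (\<Sum>x<n. lev x * Suc (len x) + off x) + (\<Sum>y<n. d y) + 2 * idx"
    using assms by (auto simp: phase1_def split: if_splits)
  ultimately show ?thesis by (simp add: budget1_def)
qed

lemma phase1_next_root:
  assumes "phase1 l d mate mx 0 idx lev off S k" "idx < n"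
  shows "mx idx = 0 \<Longrightarrow> phase1 l d mate mx (Suc idx) (Suc idx) lev off S (k - 1)"
    and "mx idx \<noteq> 0 \<Longrightarrow> phase1 l d mate mx 0 (Suc idx) lev off S (k - 1)"
  using assms phase1_k_pos[OF assms(1)] unfolding phase1_def mates_def less_Suc_eq by auto

lemma phase1_give_up:
  assumes "phase1 l d mate mx (Suc x) idx lev off S k" "lev x = l"
  shows "phase1 l d mate mx 0 idx lev off S (k - 1)"
  using assms phase1_k_pos[OF assms(1)] unfolding phase1_def mates_def by auto

text \<open>All vertices of a rejected word have labels above the level of \<open>x\<close>. Labels
  never decrease, so the word need not be searched again at this level, even if \<open>x\<close> is
  matched and robbed in between; this is why \<open>off x\<close> survives such changes.\<close>

lemma phase1_skip_word:
  assumes inv: "phase1 l d mate mx (Suc x) idx lev off S k" and "lev x < l"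
    and p: "p = cs x + off x" "p < cs (Suc x)" "tab (cw p * 2 ^ b + S (lev x * n + ci p)) = 0"
  shows "phase1 l d mate mx (Suc x) idx lev (off(x := Suc (off x))) S (k - 1)"
proof -
  have x: "x < n" using inv by (auto simp: phase1_def mates_def)
  have reps: "reps n b (\<lambda>q. S (lev x * n + q)) {y. d y = lev x}"
    using inv x by (auto simp: phase1_def)
  have "lev x < d (ci p * b + i)" if "bit (cw p) i" for i
  proof -
    have "d (ci p * b + i) \<noteq> lev x"
      using scan_none[OF reps x _ p(2) p(3) that] p(1) by simp
    moreover have "(x, ci p * b + i) \<in> A" using cw_sound[OF x _ p(2) that] p(1) by simp
    ultimately show ?thesis using inv by (fastforce simp: phase1_def)
  qed
  then have "\<forall>z<n. \<forall>p i. cs z \<le> p \<longrightarrow> p < cs z + (off(x := Suc (off x))) z \<longrightarrow> bit (cw p) i \<longrightarrow>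
      lev z < d (ci p * b + i)"
    using inv p(1) by (auto simp: phase1_def less_Suc_eq)
  moreover have "(\<Sum>z<n. lev z * Suc (len z) + (off(x := Suc (off x))) z) =
      Suc (\<Sum>z<n. lev z * Suc (len z) + off z)"
    using sum_change[OF x, of "\<lambda>z. lev z * Suc (len z) + (off(x := Suc (off x))) z"
        "\<lambda>z. lev z * Suc (len z) + off z"] by simp
  moreover have "\<forall>z<n. cs z + (off(x := Suc (off x))) z \<le> cs (Suc z) \<and> lev z \<le> l"
    using inv p by (auto simp: phase1_def)
  ultimately show ?thesis
    using inv phase1_k_pos[OF inv] unfolding phase1_def by simp
qed

lemma phase1_next_level:
  assumes inv: "phase1 l d mate mx (Suc x) idx lev off S k" and "lev x < l"
    and p: "\<not> cs x + off x < cs (Suc x)"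
  shows "phase1 l d mate mx (Suc x) idx (lev(x := Suc (lev x))) (off(x := 0)) S (k - 1)"
proof -
  have x: "x < n" "mx x = 0" using inv by (auto simp: phase1_def mates_def)
  then have off: "off x = len x" "cs x + off x = cs (Suc x)"
    using inv p cs_mono[of x] by (auto simp: phase1_def)
  have "Suc (lev x) \<le> d y" if xy: "(x, y) \<in> A" for y
  proof -
    obtain p i where "cs x \<le> p" "p < cs (Suc x)" "bit (cw p) i" "ci p * b + i = y"
      using xy by (rule seg_complete)
    moreover from this have "lev x < d (ci p * b + i)" using inv x off by (auto simp: phase1_def)
    ultimately show ?thesis by auto
  qed
  then have "\<forall>z y. (z, y) \<in> A \<longrightarrow> (lev(x := Suc (lev x))) z \<le> d y"
    using inv by (auto simp: phase1_def)
  \<comment> \<open>As \<open>x\<close> is free, no label is tied to its level, and raising the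
    level violates no equation \<open>d y = Suc (lev x)\<close>.\<close>
  moreover have "mate y \<noteq> Suc x" if "y < n" for y
    using mate_mx[of n A mate mx "Suc x" x y] inv x that by (auto simp: phase1_def)
  then have "\<forall>y<n. d y \<le> l \<and> (mate y = 0 \<longleftrightarrow> d y = 0) \<and>
      (\<forall>z. mate y = Suc z \<longrightarrow> d y = Suc ((lev(x := Suc (lev x))) z))"
    using inv by (auto simp: phase1_def)
  moreover have "(\<Sum>z<n. (lev(x := Suc (lev x))) z * Suc (len z) + (off(x := 0)) z) =
      Suc (\<Sum>z<n. lev z * Suc (len z) + off z)"
    using sum_change[OF x(1), of "\<lambda>z. (lev(x := Suc (lev x))) z * Suc (len z) + (off(x := 0)) z"
        "\<lambda>z. lev z * Suc (len z) + off z"] off by simp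
  moreover have "\<forall>z<n. cs z + (off(x := 0)) z \<le> cs (Suc z) \<and> (lev(x := Suc (lev x))) z \<le> l"
    using inv assms(2) cs_mono[OF x(1)] by (auto simp: phase1_def)
  moreover have "\<forall>z<n. \<forall>p i. cs z \<le> p \<longrightarrow> p < cs z + (off(x := 0)) z \<longrightarrow> bit (cw p) i \<longrightarrow>
      (lev(x := Suc (lev x))) z < d (ci p * b + i)"
    using inv by (auto simp: phase1_def)
  moreover have "\<forall>z<idx. mx z = 0 \<longrightarrow> (lev(x := Suc (lev x))) z = l \<or> Suc x = Suc z"
    using inv by (auto simp: phase1_def)
  ultimately show ?thesis
    using inv phase1_k_pos[OF inv] unfolding phase1_def by simp
qed

lemma row_index_eq:
  assumes "q < n" "r < n"
  shows "i * n + q = j * n + r \<longleftrightarrow> i = j \<and> q = r"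
  using word_index_eq[OF assms] .

text \<open>The label of \<open>y\<close> becomes \<open>Suc (lev x)\<close>, as its new partner
  requires, so \<open>y\<close> moves to the next row of \<open>S\<close>. A robbed vertex
  \<open>z\<close> has a level one below that of \<open>x\<close>, since the old label of
  \<open>y\<close> was \<open>Suc (lev z)\<close>.\<close>

lemma phase1_take:
  assumes inv: "phase1 l d mate mx (Suc x) idx lev off S k" and lev: "lev x < l"
    and p: "p = cs x + off x" "p < cs (Suc x)" "tab (cw p * 2 ^ b + S (lev x * n + ci p)) = Suc i"
    and y: "y = ci p * b + i"
    and S1: "S1 = S(lev x * n + ci p := S (lev x * n + ci p) - 2 ^ i)"
    and S2: "S2 = S1(Suc (lev x) * n + ci p := S1 (Suc (lev x) * n + ci p) + 2 ^ i)"
  shows "mate y = 0 \<Longrightarrow>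
      phase1 l (d(y := Suc (d y))) (mate(y := Suc x)) (mx(x := Suc y)) 0 idx lev off S2 (k - 1)"
    and "mate y = Suc z \<Longrightarrow> phase1 l (d(y := Suc (d y))) (mate(y := Suc x))
      (mx(x := Suc y, z := 0)) (Suc z) idx lev off S2 (k - 1)"
proof -
  let ?d = "d(y := Suc (d y))"
  have m: "mates n A mate mx (Suc x)" using inv by (simp add: phase1_def)
  have x: "x < n" "mx x = 0" using inv by (auto simp: phase1_def mates_def)
  have reps: "reps n b (\<lambda>q. S (j * n + q)) {y. d y = j}" if "j \<le> l" for j
    using inv that by (simp add: phase1_def)
  have lx: "lev x \<le> l" using lev by simp
  have px: "cs x \<le> p" using p(1) by simp
  note some = scan_some[OF reps[OF lx] x(1) px p(2,3), folded y]
  have dy: "d y = lev x" using some(5) by simp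
  have reps': "\<forall>j\<le>l. reps n b (\<lambda>q. S2 (j * n + q)) {y. ?d y = j}"
  proof (intro allI impI)
    fix j assume j: "j \<le> l"
    define R where "R = (\<lambda>q. S (j * n + q))"
    define T where "T = {y. d y = j}"
    have RT: "reps n b R T" using reps[OF j] by (simp add: R_def T_def)
    have S2_eq: "S2 (j * n + q) =
        (if j = lev x then R(ci p := R (ci p) - 2 ^ i)
         else if j = Suc (lev x) then R(ci p := R (ci p) + 2 ^ i) else R) q" if "q < n" for q
    proof -
      note idx = row_index_eq[OF that some(2)] row_index_eq[OF some(2) some(2)]
      show ?thesis
        by (cases "j = lev x"; cases "j = Suc (lev x)"; cases "q = ci p")
          (simp_all only: S2 S1 fun_upd_apply R_def idx n_not_Suc_n simp_thms if_True if_False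
            Suc_n_not_n)
    qed
    have "reps n b (if j = lev x then R(ci p := R (ci p) - 2 ^ i)
         else if j = Suc (lev x) then R(ci p := R (ci p) + 2 ^ i) else R) {y. ?d y = j}"
    proof -
      consider "j = lev x" | "j = Suc (lev x)" | "j \<noteq> lev x" "j \<noteq> Suc (lev x)" by blast
      then show ?thesis
      proof cases
        case 1
        moreover from this have "{y. ?d y = j} = T - {y}" by (auto simp: T_def dy)
        moreover have "y \<in> T" using 1 dy by (simp add: T_def)
        ultimately show ?thesis using reps_remove[OF RT _ some(1,2), folded y] some(3) by simp
      next
        case 2
        moreover from this have "{y. ?d y = j} = insert y T" by (auto simp: T_def dy)
        moreover have "y \<notin> T" using 2 dy by (simp add: T_def)
        ultimately show ?thesis using reps_insert[OF RT _ some(1,2), folded y] some(3) by simp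
      next
        case 3
        then have "{y. ?d y = j} = T" by (auto simp: T_def dy)
        then show ?thesis using RT 3 by simp
      qed
    qed
    then show "reps n b (\<lambda>q. S2 (j * n + q)) {y. ?d y = j}"
      unfolding reps_def using S2_eq by simp
  qed
  have sum: "(\<Sum>y<n. ?d y) = Suc (\<Sum>y<n. d y)"
    using sum_change[OF some(3), of ?d d] by simp
  have mono: "d y' \<le> ?d y'" for y' by simp
  have c1: "\<forall>x y. (x, y) \<in> A \<longrightarrow> lev x \<le> ?d y"
    using inv mono by (auto simp: phase1_def intro: le_SucI)
  have c2: "\<forall>x<n. \<forall>p i. cs x \<le> p \<longrightarrow> p < cs x + off x \<longrightarrow> bit (cw p) i \<longrightarrow> lev x < ?d (ci p * b + i)"
  proof (intro allI impI)
    fix x p i assume "x < n" "cs x \<le> p" "p < cs x + off x" "bit (cw p) i"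
    then have "lev x < d (ci p * b + i)" using inv unfolding phase1_def by blast
    then show "lev x < ?d (ci p * b + i)" using mono less_le_trans by blast
  qed
  have c3: "\<forall>y'<n. ?d y' \<le> l \<and> ((mate(y := Suc x)) y' = 0 \<longleftrightarrow> ?d y' = 0) \<and>
      (\<forall>x'. (mate(y := Suc x)) y' = Suc x' \<longrightarrow> ?d y' = Suc (lev x'))"
    using inv dy lev by (auto simp: phase1_def)
  show "phase1 l ?d (mate(y := Suc x)) (mx(x := Suc y)) 0 idx lev off S2 (k - 1)" if "mate y = 0"
    unfolding phase1_def
  proof (intro conjI)
    show "mates n A (mate(y := Suc x)) (mx(x := Suc y)) 0"
      by (rule mates_augment[OF m some(4) that])
    show "\<forall>x'<idx. (mx(x := Suc y)) x' = 0 \<longrightarrow> lev x' = l \<or> 0 = Suc x'"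
      using inv by (auto simp: phase1_def)
  qed (use inv reps' c1 c2 c3 sum phase1_k_pos[OF inv] in \<open>simp_all add: phase1_def\<close>)
  show "phase1 l ?d (mate(y := Suc x)) (mx(x := Suc y, z := 0)) (Suc z) idx lev off S2 (k - 1)"
    if "mate y = Suc z"
    unfolding phase1_def
  proof (intro conjI)
    show "mates n A (mate(y := Suc x)) (mx(x := Suc y, z := 0)) (Suc z)"
      by (rule mates_steal[OF m some(4) that])
    show "\<forall>x'<idx. (mx(x := Suc y, z := 0)) x' = 0 \<longrightarrow> lev x' = l \<or> Suc z = Suc x'"
      using inv by (auto simp: phase1_def)
  qed (use inv reps' c1 c2 c3 sum phase1_k_pos[OF inv] in \<open>simp_all add: phase1_def\<close>)
qed

text \<open>For each \<open>i\<close> between 1 and \<open>l\<close>, the vertices \<open>y\<close> with label at least \<open>i\<close> and the partners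
  of those with label at most \<open>i\<close> form a vertex cover.  Only label \<open>i\<close> is counted twice.\<close>

lemma phase1_final:
  assumes inv: "phase1 l d mate mx 0 n lev off S k"
  shows "l * matching_number A \<le> l * card (matched n mate) + n"
proof -
  have m: "mates n A mate mx 0" using inv by (simp add: phase1_def)
  have step: "matching_number A \<le> card (matched n mate) + card {y. y < n \<and> d y = i}"
    if i: "i \<in> {1..l}" for i
  proof -
    let ?X = "{x. x < n \<and> mx x \<noteq> 0 \<and> lev x < i}" and ?Y = "{y. y < n \<and> i \<le> d y}"
    let ?Z = "{y. y < n \<and> 1 \<le> d y \<and> d y \<le> i}"
    have "x \<in> ?X \<or> y \<in> ?Y" if xy: "(x, y) \<in> A" for x y
    proof -
      have "x < n" "y < n" "lev x \<le> d y" using inv xy A_less[OF xy] by (auto simp: phase1_def)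
      \<comment> \<open>A free vertex was given up at level \<open>l\<close>, so all its neighbours
        have label \<open>l\<close> and belong to \<open>?Y\<close>.\<close>
      moreover have "mx x = 0 \<longrightarrow> lev x = l" using inv \<open>x < n\<close> by (auto simp: phase1_def)
      ultimately show ?thesis using i by auto
    qed
    then have "matching_number A \<le> card ?X + card ?Y"
      by (intro matching_number_le_cover[OF finite_A]) auto
    also have "card ?X \<le> card ?Z"
    proof (rule card_le_partners[OF m])
      fix x assume x: "x \<in> ?X"
      then obtain y where y: "mx x = Suc y" by (auto simp: gr0_conv_Suc)
      then have "mate y = Suc x" "y < n" using mx_mate[OF m] mx_less[OF m] x by auto
      then have "d y = Suc (lev x)" using inv by (auto simp: phase1_def)
      then show "x < n \<and> mx x \<noteq> 0 \<and> mx x - 1 \<in> ?Z" using x y \<open>y < n\<close> by auto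
    qed simp
    also have "card ?Z + card ?Y = card (?Z \<union> ?Y) + card (?Z \<inter> ?Y)"
      by (rule card_Un_Int) auto
    also have "?Z \<union> ?Y = matched n mate"
      using inv i by (auto simp: phase1_def matched_def)
    also have "?Z \<inter> ?Y = {y. y < n \<and> d y = i}" using i by auto
    finally show ?thesis by simp
  qed
  \<comment> \<open>Averaging over the \<open>l\<close> covers: the label classes are disjoint, so
    their sizes add up to at most \<open>n\<close>.\<close>
  have "l * matching_number A = (\<Sum>i\<in>{1..l}. matching_number A)" by simp
  also have "\<dots> \<le> (\<Sum>i\<in>{1..l}. card (matched n mate) + card {y. y < n \<and> d y = i})"
    by (rule sum_mono) (rule step)
  also have "\<dots> = l * card (matched n mate) + (\<Sum>i\<in>{1..l}. card {y. y < n \<and> d y = i})"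
    by (simp add: sum.distrib)
  also have "(\<Sum>i\<in>{1..l}. card {y. y < n \<and> d y = i}) = card (\<Union>i\<in>{1..l}. {y. y < n \<and> d y = i})"
    by (rule card_UN_disjoint[symmetric]) auto
  also have "\<dots> \<le> card {..<n}" by (rule card_mono) auto
  finally show ?thesis by simp
qed

section \<open>Second phase: depth-first search for augmenting paths\<close>

text \<open>The search matches \<open>cur - 1\<close> to any neighbour outside the set \<open>V\<close> of visited vertices and
  continues with the previous partner.  At a dead end the last such step is undone.  The stack
  \<open>stk\<close> holds the vertices taken in the steps that are not undone yet.\<close>

definition closed :: "nat set \<Rightarrow> nat \<Rightarrow> bool" where
  "closed V x \<longleftrightarrow> (\<forall>y. (x, y) \<in> A \<longrightarrow> y \<in> V)"

definition budget2 :: nat where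
  "budget2 = cs n + 4 * n + 1"

definition dfs :: "nat \<Rightarrow> nat set \<Rightarrow> (nat \<Rightarrow> nat) \<Rightarrow> (nat \<Rightarrow> nat) \<Rightarrow> nat \<Rightarrow> nat \<Rightarrow> (nat \<Rightarrow> nat) \<Rightarrow>
    (nat \<Rightarrow> nat) \<Rightarrow> (nat \<Rightarrow> nat) \<Rightarrow> nat \<Rightarrow> nat \<Rightarrow> bool" where
  "dfs c V mate mx cur idx off U stk sp k \<longleftrightarrow>
     mates n A mate mx cur \<and> idx \<le> n \<and> card (matched n mate) = c \<and>
     (\<forall>x<n. cs x + off x \<le> cs (Suc x)) \<and>
     (\<forall>x<n. \<forall>p i. cs x \<le> p \<longrightarrow> p < cs x + off x \<longrightarrow> bit (cw p) i \<longrightarrow> ci p * b + i \<in> V) \<and>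
     V \<subseteq> matched n mate \<and> reps n b U (- V) \<and>
     inj_on stk {..<sp} \<and> stk ` {..<sp} \<subseteq> V \<and> (cur = 0 \<longrightarrow> sp = 0) \<and>
     (\<forall>i<sp. ((if Suc i < sp then mate (stk (Suc i)) else cur) - 1, stk i) \<in> A) \<and>
     (\<forall>y\<in>V. y \<in> stk ` {..<sp} \<or> closed V (mate y - 1)) \<and>
     (\<forall>x<idx. mx x = 0 \<longrightarrow> closed V x \<or> cur = Suc x) \<and>
     budget2 + sp + (if cur = 0 then 0 else 1) \<le> k + (\<Sum>x<n. off x) + 2 * card V + 2 * idx"

lemma dfs_V_subset: "dfs c V mate mx cur idx off U stk sp k \<Longrightarrow> V \<subseteq> {..<n}"
  by (auto simp: dfs_def matched_def)

lemma dfs_finite_V: "dfs c V mate mx cur idx off U stk sp k \<Longrightarrow> finite V"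
  by (rule finite_subset[OF dfs_V_subset finite_lessThan])

text \<open>The potential is at most \<open>budget2 - 1\<close>: \<open>cs n\<close> for searched
  words, \<open>2 * n\<close> for visited vertices and \<open>2 * n\<close> for roots. A visited
  vertex counts twice because it is pushed once and possibly popped once; the term \<open>sp\<close>
  stores the prepaid pops.\<close>

lemma dfs_k_pos:
  assumes "dfs c V mate mx cur idx off U stk sp k"
  shows "0 < k"
proof -
  have "(\<Sum>x<n. off x) \<le> (\<Sum>x<n. len x)"
    using assms by (intro sum_mono) (auto simp: dfs_def)
  then have "(\<Sum>x<n. off x) \<le> cs n" using sum_len[of n] by simp
  moreover have "card V \<le> n" using card_mono[OF _ dfs_V_subset[OF assms]] by simp
  moreover have "idx \<le> n" "budget2 \<le> k + (\<Sum>x<n. off x) + 2 * card V + 2 * idx"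
    using assms by (auto simp: dfs_def split: if_splits)
  ultimately show ?thesis by (simp add: budget2_def)
qed

lemma dfs_start:
  assumes "mates n A mate mx 0" "reps n b U UNIV" "\<And>x. x < n \<Longrightarrow> off x = 0" "budget2 \<le> k"
  shows "dfs (card (matched n mate)) {} mate mx 0 0 off U stk 0 k"
  using assms cs_mono by (simp add: dfs_def)

lemma dfs_next_root:
  assumes "dfs c V mate mx 0 idx off U stk sp k" "idx < n"
  shows "mx idx = 0 \<Longrightarrow> dfs c V mate mx (Suc idx) (Suc idx) off U stk 0 (k - 1)"
    and "mx idx \<noteq> 0 \<Longrightarrow> dfs c V mate mx 0 (Suc idx) off U stk 0 (k - 1)"
  using assms dfs_k_pos[OF assms(1)] unfolding dfs_def mates_def less_Suc_eq by auto

lemma dfs_skip_word: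
  assumes inv: "dfs c V mate mx (Suc x) idx off U stk sp k"
    and p: "p = cs x + off x" "p < cs (Suc x)" "tab (cw p * 2 ^ b + U (ci p)) = 0"
  shows "dfs c V mate mx (Suc x) idx (off(x := Suc (off x))) U stk sp (k - 1)"
proof -
  have x: "x < n" using inv by (auto simp: dfs_def mates_def)
  have reps: "reps n b U (- V)" using inv by (simp add: dfs_def)
  have "ci p * b + i \<in> V" if "bit (cw p) i" for i
    using scan_none[OF reps x _ p(2) p(3) that] p(1) by simp
  then have "\<forall>z<n. \<forall>p i. cs z \<le> p \<longrightarrow> p < cs z + (off(x := Suc (off x))) z \<longrightarrow> bit (cw p) i \<longrightarrow>
      ci p * b + i \<in> V"
    using inv p(1) by (auto simp: dfs_def less_Suc_eq)
  moreover have "(\<Sum>z<n. (off(x := Suc (off x))) z) = Suc (\<Sum>z<n. off z)"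
    using sum_change[OF x, of "off(x := Suc (off x))" off] by simp
  moreover have "\<forall>z<n. cs z + (off(x := Suc (off x))) z \<le> cs (Suc z)"
    using inv p by (auto simp: dfs_def)
  ultimately show ?thesis
    using inv dfs_k_pos[OF inv] unfolding dfs_def by simp
qed

lemma dfs_exhausted:
  assumes inv: "dfs c V mate mx (Suc x) idx off U stk sp k" and p: "\<not> cs x + off x < cs (Suc x)"
  shows "closed V x"
proof -
  have x: "x < n" using inv by (auto simp: dfs_def mates_def)
  then have off: "cs x + off x = cs (Suc x)" using inv p by (auto simp: dfs_def)
  show ?thesis unfolding closed_def
  proof (intro allI impI)
    fix y assume "(x, y) \<in> A"
    then obtain p i where "cs x \<le> p" "p < cs (Suc x)" "bit (cw p) i" "ci p * b + i = y"
      by (rule seg_complete)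
    then show "y \<in> V" using inv x off by (auto simp: dfs_def)
  qed
qed

lemma dfs_finish_root:
  assumes inv: "dfs c V mate mx (Suc x) idx off U stk 0 k" and p: "\<not> cs x + off x < cs (Suc x)"
  shows "dfs c V mate mx 0 idx off U stk 0 (k - 1)"
  using assms dfs_k_pos[OF inv] dfs_exhausted[OF assms] unfolding dfs_def mates_def by auto

text \<open>The former partner of a stack entry is stored nowhere: it is now the mate of the next
  entry, or \<open>cur - 1\<close> for the top one, and the invariant keeps the arc from it to the
  entry. After the undo, the partner of \<open>y\<close> is the exhausted vertex \<open>x\<close>,
  so \<open>y\<close> may leave the stack while remaining visited.\<close>

lemma dfs_undo:
  assumes inv: "dfs c V mate mx (Suc x) idx off U stk (Suc sp) k"
    and p: "\<not> cs x + off x < cs (Suc x)" and y: "y = stk sp"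
  obtains z where "mate y = Suc z" "y < n" "z < n"
    "dfs c V (mate(y := Suc x)) (mx(x := Suc y, z := 0)) (Suc z) idx off U stk sp (k - 1)"
proof -
  have m: "mates n A mate mx (Suc x)" using inv by (simp add: dfs_def)
  have x: "x < n" using m by (simp add: mates_def)
  have "y \<in> V" using inv y by (auto simp: dfs_def)
  then have yM: "y \<in> matched n mate" using inv by (auto simp: dfs_def)
  then obtain z where z: "mate y = Suc z" and yn: "y < n" by (auto simp: matched_def gr0_conv_Suc)
  have zn: "z < n" using mate_less[OF m yn z] .
  have xy: "(x, y) \<in> A" using inv y by (auto simp: dfs_def dest: spec[of _ sp])
  have ninj: "stk i \<noteq> y" if "i < sp" for i
    using inv that y by (auto simp: dfs_def inj_on_def)
  have cx: "closed V x" by (rule dfs_exhausted[OF inv p])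
  have mt: "matched n (mate(y := Suc x)) = matched n mate"
    using matched_upd[OF yn] yM by auto
  have "dfs c V (mate(y := Suc x)) (mx(x := Suc y, z := 0)) (Suc z) idx off U stk sp (k - 1)"
    unfolding dfs_def mt
  proof (intro conjI)
    show "mates n A (mate(y := Suc x)) (mx(x := Suc y, z := 0)) (Suc z)"
      by (rule mates_steal[OF m xy z])
    show "inj_on stk {..<sp}" using inv by (auto simp: dfs_def intro: inj_on_subset)
    show "\<forall>i<sp. ((if Suc i < sp then (mate(y := Suc x)) (stk (Suc i)) else Suc z) - 1, stk i) \<in> A"
    proof (intro allI impI)
      fix i assume i: "i < sp"
      have "\<forall>i<Suc sp. ((if Suc i < Suc sp then mate (stk (Suc i)) else Suc x) - 1, stk i) \<in> A"
        using inv unfolding dfs_def by (elim conjE)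
      then have "((if Suc i < Suc sp then mate (stk (Suc i)) else Suc x) - 1, stk i) \<in> A"
        using i less_SucI by blast
      moreover have "stk (Suc i) = y" if "\<not> Suc i < sp"
        using that i y by (simp add: le_less_Suc_eq not_less Suc_le_eq flip: less_Suc_eq_le)
      ultimately show "((if Suc i < sp then (mate(y := Suc x)) (stk (Suc i)) else Suc z) - 1, stk i) \<in> A"
        using i z ninj by auto
    qed
    show "\<forall>v\<in>V. v \<in> stk ` {..<sp} \<or> closed V ((mate(y := Suc x)) v - 1)"
    proof
      fix v assume "v \<in> V"
      then have "v \<in> stk ` {..<Suc sp} \<or> closed V (mate v - 1)" using inv by (auto simp: dfs_def)
      then show "v \<in> stk ` {..<sp} \<or> closed V ((mate(y := Suc x)) v - 1)"
        using cx y by (auto simp: lessThan_Suc)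
    qed
    show "\<forall>x'<idx. (mx(x := Suc y, z := 0)) x' = 0 \<longrightarrow> closed V x' \<or> Suc z = Suc x'"
      using inv by (auto simp: dfs_def)
  qed (use inv dfs_k_pos[OF inv] in \<open>auto simp: dfs_def lessThan_Suc\<close>)
  with z yn zn show thesis by (rule that)
qed

lemma dfs_augment:
  assumes inv: "dfs c V mate mx (Suc x) idx off U stk sp k"
    and p: "p = cs x + off x" "p < cs (Suc x)" "tab (cw p * 2 ^ b + U (ci p)) = Suc i"
    and y: "y = ci p * b + i" "mate y = 0"
  shows "mates n A (mate(y := Suc x)) (mx(x := Suc y)) 0"
    "card (matched n (mate(y := Suc x))) = Suc c"
proof -
  have m: "mates n A mate mx (Suc x)" using inv by (simp add: dfs_def)
  have x: "x < n" using m by (simp add: mates_def)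
  have "reps n b U (- V)" using inv by (simp add: dfs_def)
  note some = scan_some[OF this x _ p(2,3), folded y]
  have px: "cs x \<le> p" using p(1) by simp
  show "mates n A (mate(y := Suc x)) (mx(x := Suc y)) 0"
    by (rule mates_augment[OF m some(4)[OF px] y(2)])
  have "y \<notin> matched n mate" using y(2) by (simp add: matched_def)
  then show "card (matched n (mate(y := Suc x))) = Suc c"
    using inv matched_upd[OF some(3)[OF px]] by (simp add: dfs_def)
qed

lemma dfs_push:
  assumes inv: "dfs c V mate mx (Suc x) idx off U stk sp k"
    and p: "p = cs x + off x" "p < cs (Suc x)" "tab (cw p * 2 ^ b + U (ci p)) = Suc i"
    and y: "y = ci p * b + i" "mate y = Suc z"
  shows "dfs c (insert y V) (mate(y := Suc x)) (mx(x := Suc y, z := 0)) (Suc z) idx off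
      (U(ci p := U (ci p) - 2 ^ i)) (stk(sp := y)) (Suc sp) (k - 1)"
proof -
  have m: "mates n A mate mx (Suc x)" using inv by (simp add: dfs_def)
  have x: "x < n" using m by (simp add: mates_def)
  have reps: "reps n b U (- V)" using inv by (simp add: dfs_def)
  have px: "cs x \<le> p" using p(1) by simp
  note some = scan_some[OF reps x px p(2,3), folded y]
  have yV: "y \<notin> V" using some(5) by simp
  have yM: "y \<in> matched n mate" using y(2) some(3) by (simp add: matched_def)
  have mt: "matched n (mate(y := Suc x)) = matched n mate"
    using matched_upd[OF some(3)] yM by auto
  have stkV: "stk i \<in> V" if "i < sp" for i using inv that by (auto simp: dfs_def)
  have img: "(stk(sp := y)) ` {..<Suc sp} = insert y (stk ` {..<sp})"
    by (auto simp: lessThan_Suc)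
  have closed_mono: "closed V x' \<Longrightarrow> closed (insert y V) x'" for x' by (auto simp: closed_def)
  show ?thesis
    unfolding dfs_def mt img
  proof (intro conjI)
    show "mates n A (mate(y := Suc x)) (mx(x := Suc y, z := 0)) (Suc z)"
      by (rule mates_steal[OF m some(4) y(2)])
    show "reps n b (U(ci p := U (ci p) - 2 ^ i)) (- insert y V)"
    proof -
      have "- insert y V = - V - {y}" by auto
      then show ?thesis using reps_remove[OF reps _ some(1,2), folded y] some(3,5) by simp
    qed
    show "inj_on (stk(sp := y)) {..<Suc sp}"
      using inv stkV yV by (auto simp: dfs_def inj_on_def less_Suc_eq)
    show "\<forall>j<Suc sp. ((if Suc j < Suc sp then (mate(y := Suc x)) ((stk(sp := y)) (Suc j)) else Suc z) - 1,
        (stk(sp := y)) j) \<in> A"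
    proof (intro allI impI)
      fix j assume j: "j < Suc sp"
      \<comment> \<open>The edge given up here is the one that an undo of this step
        restores.\<close>
      have zy: "(z, y) \<in> A" using m y(2) some(3) by (auto simp: mates_def)
      consider "j = sp" | "Suc j = sp" | "Suc j < sp" using j by linarith
      then show "((if Suc j < Suc sp then (mate(y := Suc x)) ((stk(sp := y)) (Suc j)) else Suc z) - 1,
        (stk(sp := y)) j) \<in> A"
      proof cases
        case 1
        then show ?thesis using zy by simp
      next
        case 2
        then have "(if Suc j < sp then mate (stk (Suc j)) else Suc x) - 1 = x" by simp
        then have "(x, stk j) \<in> A" using inv 2 unfolding dfs_def by (metis lessI)
        then show ?thesis using 2 by auto
      next
        case 3
        then have "(mate (stk (Suc j)) - 1, stk j) \<in> A" using inv unfolding dfs_def by (metis Suc_lessD)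
        moreover have "stk (Suc j) \<noteq> y" using stkV[OF 3] yV by auto
        ultimately show ?thesis using 3 by auto
      qed
    qed
    show "\<forall>v\<in>insert y V. v \<in> insert y (stk ` {..<sp}) \<or> closed (insert y V) ((mate(y := Suc x)) v - 1)"
      using inv closed_mono by (auto simp: dfs_def)
    show "\<forall>x'<idx. (mx(x := Suc y, z := 0)) x' = 0 \<longrightarrow> closed (insert y V) x' \<or> Suc z = Suc x'"
      using inv closed_mono by (auto simp: dfs_def)
    show "budget2 + Suc sp + (if Suc z = 0 then 0 else 1)
        \<le> k - 1 + (\<Sum>x<n. off x) + 2 * card (insert y V) + 2 * idx"
      using inv dfs_k_pos[OF inv] yV dfs_finite_V[OF inv] by (simp add: dfs_def)
  qed (use inv yM in \<open>auto simp: dfs_def\<close>)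
qed

text \<open>The visited vertices together with the vertices that still have an unvisited neighbour form
  a vertex cover.\<close>

lemma dfs_final:
  assumes inv: "dfs c V mate mx 0 n off U stk sp k"
  shows "matching_number A = card (matched n mate)"
proof (rule antisym)
  have m: "mates n A mate mx 0" using inv by (simp add: dfs_def)
  let ?X = "{x. x < n \<and> \<not> closed V x}"
  have VM: "V \<subseteq> matched n mate" using inv by (simp add: dfs_def)
  have "x \<in> ?X \<or> y \<in> V" if "(x, y) \<in> A" for x y
    using that A_less[OF that] by (auto simp: closed_def)
  then have "matching_number A \<le> card ?X + card V"
    using dfs_finite_V[OF inv] by (intro matching_number_le_cover[OF finite_A]) auto
  also have "card ?X \<le> card (matched n mate - V)"
  proof (rule card_le_partners[OF m])
    fix x assume x: "x \<in> ?X"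
    then have "mx x \<noteq> 0" using inv by (auto simp: dfs_def)
    then obtain y where y: "mx x = Suc y" by (auto simp: gr0_conv_Suc)
    then have my: "mate y = Suc x" "y < n" using mx_mate[OF m] mx_less[OF m] x by auto
    \<comment> \<open>With an empty stack, the partner of every visited vertex is closed; so a
      vertex that is not closed has an unvisited partner.\<close>
    have "sp = 0" using inv by (simp add: dfs_def)
    then have "closed V (mate y - 1)" if "y \<in> V" using inv that by (auto simp: dfs_def)
    then have "y \<notin> V" using x my by auto
    then show "x < n \<and> mx x \<noteq> 0 \<and> mx x - 1 \<in> matched n mate - V"
      using x y my by (auto simp: matched_def)
  qed simp
  also have "card (matched n mate - V) + card V = card (matched n mate)"
    using VM by (metis card_Diff_subset card_mono dfs_finite_V finite_matched inv le_add_diff_inverse2)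
  finally show "matching_number A \<le> card (matched n mate)" by simp
  show "card (matched n mate) \<le> matching_number A" by (rule card_matched_le_number[OF m])
qed

end

section \<open>The two phases as programs\<close>

abbreviation plus_exp (infixl "\<oplus>" 65) where "a \<oplus> c \<equiv> Bin Plus a c"
abbreviation minus_exp (infixl "\<ominus>" 65) where "a \<ominus> c \<equiv> Bin Minus a c"
abbreviation times_exp (infixl "\<otimes>" 70) where "a \<otimes> c \<equiv> Bin Times a c"
abbreviation less_exp (infix "\<prec>" 50) where "a \<prec> c \<equiv> Bin Less a c"
abbreviation seq_com (infixr ";;" 40) where "c1 ;; c2 \<equiv> Seq c1 c2"

text \<open>As \<open>cur\<close> is \<open>x + 1\<close>, reading \<open>cs\<close> at
  \<open>cur\<close> gives the end of the words of \<open>x\<close>. Adding \<open>n\<close> to the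
  index \<open>r\<close> leads to the same word in the next row of \<open>S\<close>.\<close>

definition phase1_body :: com where
  "phase1_body =
    Cond (Reg ''cur'')
      (Assign ''x'' (Reg ''cur'' \<ominus> Const 1) ;;
       Cond (Get ''lev'' (Reg ''x'') \<prec> Reg ''l'')
         (Assign ''p'' (Get ''cs'' (Reg ''x'') \<oplus> Get ''off'' (Reg ''x'')) ;;
          Cond (Reg ''p'' \<prec> Get ''cs'' (Reg ''cur''))
            (Assign ''r'' (Get ''lev'' (Reg ''x'') \<otimes> Reg ''n'' \<oplus> Get ''ci'' (Reg ''p'')) ;;
             Assign ''t'' (Get ''tab'' (Get ''cw'' (Reg ''p'') \<otimes> Get ''pw'' (Reg ''b'') \<oplus> Get ''S'' (Reg ''r''))) ;;
             Cond (Reg ''t'')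
               (Assign ''y'' (Get ''ci'' (Reg ''p'') \<otimes> Reg ''b'' \<oplus> (Reg ''t'' \<ominus> Const 1)) ;;
                Put ''S'' (Reg ''r'') (Get ''S'' (Reg ''r'') \<ominus> Get ''pw'' (Reg ''t'' \<ominus> Const 1)) ;;
                Assign ''r'' (Reg ''n'' \<oplus> Reg ''r'') ;;
                Put ''S'' (Reg ''r'') (Get ''S'' (Reg ''r'') \<oplus> Get ''pw'' (Reg ''t'' \<ominus> Const 1)) ;;
                Assign ''z'' (Get ''mate'' (Reg ''y'')) ;;
                Put ''mate'' (Reg ''y'') (Reg ''cur'') ;;
                Put ''mx'' (Reg ''x'') (Reg ''y'' \<oplus> Const 1) ;;
                Cond (Reg ''z'') (Put ''mx'' (Reg ''z'' \<ominus> Const 1) (Const 0)) Skip ;;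
                Assign ''cur'' (Reg ''z''))
               (Put ''off'' (Reg ''x'') (Get ''off'' (Reg ''x'') \<oplus> Const 1)))
            (Put ''lev'' (Reg ''x'') (Get ''lev'' (Reg ''x'') \<oplus> Const 1) ;;
             Put ''off'' (Reg ''x'') (Const 0)))
         (Assign ''cur'' (Const 0)))
      (Cond (Get ''mx'' (Reg ''idx'')) Skip (Assign ''cur'' (Reg ''idx'' \<oplus> Const 1)) ;;
       Assign ''idx'' (Reg ''idx'' \<oplus> Const 1))"

text \<open>On success, \<open>cur\<close> and \<open>idx\<close> are set to values that end the
  loop.\<close>

definition dfs_body :: com where
  "dfs_body =
    Cond (Reg ''cur'')
      (Assign ''x'' (Reg ''cur'' \<ominus> Const 1) ;;
       Assign ''p'' (Get ''cs'' (Reg ''x'') \<oplus> Get ''off'' (Reg ''x'')) ;;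
       Cond (Reg ''p'' \<prec> Get ''cs'' (Reg ''cur''))
         (Assign ''r'' (Get ''ci'' (Reg ''p'')) ;;
          Assign ''t'' (Get ''tab'' (Get ''cw'' (Reg ''p'') \<otimes> Get ''pw'' (Reg ''b'') \<oplus> Get ''U'' (Reg ''r''))) ;;
          Cond (Reg ''t'')
            (Assign ''y'' (Reg ''r'' \<otimes> Reg ''b'' \<oplus> (Reg ''t'' \<ominus> Const 1)) ;;
             Put ''U'' (Reg ''r'') (Get ''U'' (Reg ''r'') \<ominus> Get ''pw'' (Reg ''t'' \<ominus> Const 1)) ;;
             Assign ''z'' (Get ''mate'' (Reg ''y'')) ;;
             Put ''mate'' (Reg ''y'') (Reg ''cur'') ;;
             Put ''mx'' (Reg ''x'') (Reg ''y'' \<oplus> Const 1) ;;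
             Cond (Reg ''z'')
               (Put ''mx'' (Reg ''z'' \<ominus> Const 1) (Const 0) ;;
                Put ''stk'' (Reg ''sp'') (Reg ''y'') ;;
                Assign ''sp'' (Reg ''sp'' \<oplus> Const 1) ;;
                Assign ''cur'' (Reg ''z''))
               (Assign ''found'' (Const 1) ;;
                Assign ''cur'' (Const 0) ;;
                Assign ''idx'' (Reg ''n'')))
            (Put ''off'' (Reg ''x'') (Get ''off'' (Reg ''x'') \<oplus> Const 1)))
         (Cond (Reg ''sp'')
           (Assign ''sp'' (Reg ''sp'' \<ominus> Const 1) ;;
            Assign ''y'' (Get ''stk'' (Reg ''sp'')) ;;
            Assign ''z'' (Get ''mate'' (Reg ''y'')) ;;
            Put ''mate'' (Reg ''y'') (Reg ''cur'') ;;
            Put ''mx'' (Reg ''x'') (Reg ''y'' \<oplus> Const 1) ;;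
            Put ''mx'' (Reg ''z'' \<ominus> Const 1) (Const 0) ;;
            Assign ''cur'' (Reg ''z''))
           (Assign ''cur'' (Const 0))))
      (Cond (Get ''mx'' (Reg ''idx'')) Skip (Assign ''cur'' (Reg ''idx'' \<oplus> Const 1)) ;;
       Assign ''idx'' (Reg ''idx'' \<oplus> Const 1))"

text \<open>As \<open>idx \<le> n\<close>, the guard says that \<open>idx < n\<close> or \<open>cur \<noteq> 0\<close>.\<close>

definition search_loop :: "com \<Rightarrow> com" where
  "search_loop c =
    (Assign ''idx'' (Const 0) ;; Assign ''cur'' (Const 0) ;;
     While (Reg ''idx'' \<prec> Reg ''n'' \<oplus> Reg ''cur'') c)"

text \<open>\<open>F\<close> permanently holds the words of the full vertex set, from which the set
  \<open>U\<close> of unvisited vertices is restored before every search.\<close>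

definition reset_loop :: com where
  "reset_loop =
    (Assign ''i'' (Const 0) ;;
     While (Reg ''i'' \<prec> Reg ''n'')
       (Put ''U'' (Reg ''i'') (Get ''F'' (Reg ''i'')) ;;
        Put ''off'' (Reg ''i'') (Const 0) ;;
        Assign ''i'' (Reg ''i'' \<oplus> Const 1)))"

definition rounds :: com where
  "rounds =
    (Assign ''found'' (Const 1) ;;
     While (Reg ''found'')
       (Assign ''found'' (Const 0) ;; Assign ''sp'' (Const 0) ;; reset_loop ;; search_loop dfs_body))"

section \<open>Verification of the two search programs\<close>

lemma wp_extra:
  assumes "wp V c (\<lambda>s' _. Q s') s k"
  shows "wp V c (\<lambda>s' k'. Q s' \<and> e \<le> k') s (k + e)"
proof -
  obtain i s' where "run V c s i s'" "i \<le> k" "Q s'" using assms by (auto simp: wp_def)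
  then show ?thesis unfolding wp_def by (intro exI[of _ i] exI[of _ s']) simp
qed

text \<open>Only stored values need bounds: \<open>2 * 2 ^ b\<close> covers a word to which a bit is
  added, and \<open>(l + 2) * n\<close> the index \<open>n + r\<close> into the row after the
  current one.\<close>

locale word_program = word_graph +
  fixes V l :: nat
  assumes V_bounds: "n + 2 < V" "b < V" "2 * 2 ^ b < V" "cs n + 1 < V" "(l + 2) * n < V" "l + 1 < V"
begin

definition ctx :: "state \<Rightarrow> bool" where
  "ctx s \<longleftrightarrow> reg s ''n'' = n \<and> reg s ''b'' = b \<and> reg s ''l'' = l \<and> arr s ''cs'' = cs \<and>
     arr s ''ci'' = ci \<and> arr s ''cw'' = cw \<and> arr s ''tab'' = tab \<and> (\<forall>i\<le>b. arr s ''pw'' i = 2 ^ i)"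

text \<open>The labels \<open>d\<close> are not stored; the program knows them only through the rows
  of \<open>S\<close>. Hence the quantifier.\<close>

definition inv1 :: "state \<Rightarrow> nat \<Rightarrow> bool" where
  "inv1 s k \<longleftrightarrow> ctx s \<and>
     (\<exists>d. phase1 l d (arr s ''mate'') (arr s ''mx'') (reg s ''cur'') (reg s ''idx'')
        (arr s ''lev'') (arr s ''off'') (arr s ''S'') k)"

lemma inv1_step:
  assumes "inv1 s k" and guard: "reg s ''idx'' < reg s ''n'' + reg s ''cur''"
  shows "0 < k \<and> wp V phase1_body inv1 s (k - 1)"
proof
  let ?mate = "arr s ''mate''" and ?mx = "arr s ''mx''" and ?cur = "reg s ''cur''"
    and ?idx = "reg s ''idx''" and ?lev = "arr s ''lev''" and ?off = "arr s ''off''" and ?S = "arr s ''S''"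
  obtain d where inv: "phase1 l d ?mate ?mx ?cur ?idx ?lev ?off ?S k" and ctx: "ctx s"
    using assms by (auto simp: inv1_def)
  show "0 < k" using phase1_k_pos[OF inv] .
  show "wp V phase1_body inv1 s (k - 1)"
  proof (cases ?cur)
    case 0
    then have idx: "?idx < n" using guard ctx by (simp add: ctx_def)
    show ?thesis
    proof (cases "?mx ?idx = 0")
      case True
      then have "\<exists>d. phase1 l d ?mate ?mx (Suc ?idx) (Suc ?idx) ?lev ?off ?S (k - 1)"
        using phase1_next_root(1)[OF inv[unfolded 0] idx] by blast
      then show ?thesis
        using True 0 ctx idx V_bounds by (simp add: phase1_body_def inv1_def ctx_def)
    next
      case False
      then have "\<exists>d. phase1 l d ?mate ?mx 0 (Suc ?idx) ?lev ?off ?S (k - 1)"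
        using phase1_next_root(2)[OF inv[unfolded 0] idx] by blast
      then show ?thesis
        using False 0 ctx idx V_bounds by (simp add: phase1_body_def inv1_def ctx_def)
    qed
  next
    case (Suc x)
    note inv = inv[unfolded Suc]
    have m: "mates n A ?mate ?mx (Suc x)" using inv by (simp add: phase1_def)
    have x: "x < n" using m by (simp add: mates_def)
    show ?thesis
    proof (cases "?lev x < l")
      case False
      then have "?lev x = l" using inv x by (auto simp: phase1_def)
      then have "\<exists>d. phase1 l d ?mate ?mx 0 ?idx ?lev ?off ?S (k - 1)"
        using phase1_give_up[OF inv] by blast
      then show ?thesis
        using False Suc ctx x V_bounds by (simp add: phase1_body_def inv1_def ctx_def)
    next
      case True
      define p where "p = cs x + ?off x"
      have p_le: "p \<le> cs (Suc x)" "cs (Suc x) \<le> cs n"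
        using inv x cs_le[of "Suc x"] by (auto simp: phase1_def p_def)
      show ?thesis
      proof (cases "p < cs (Suc x)")
        case False
        then have "\<exists>d. phase1 l d ?mate ?mx (Suc x) ?idx (?lev(x := Suc (?lev x))) (?off(x := 0)) ?S (k - 1)"
          using phase1_next_level[OF inv True] by (auto simp: p_def)
        then show ?thesis
          using False True Suc ctx x V_bounds p_le
          by (simp add: phase1_body_def inv1_def ctx_def p_def[symmetric])
      next
        case p: True
        let ?r = "?lev x * n + ci p"
        have reps: "reps n b (\<lambda>q. ?S (j * n + q)) {y. d y = j}" if "j \<le> l" for j
          using inv that by (simp add: phase1_def)
        have px: "cs x \<le> p" by (simp add: p_def)
        have ci: "ci p < n" using ci_less[OF x px p] .
        have "?lev x * n \<le> l * n" using True by (intro mult_le_mono1) simp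
        moreover have "l * n + n + n < V" using V_bounds(5) by (simp add: algebra_simps)
        ultimately have rV: "?r < V" "n + ?r < V" using ci by linarith+
        show ?thesis
        proof (cases "tab (cw p * 2 ^ b + ?S ?r)")
          case 0
          then have "\<exists>d. phase1 l d ?mate ?mx (Suc x) ?idx ?lev (?off(x := Suc (?off x))) ?S (k - 1)"
            using phase1_skip_word[OF inv True p_def p] by blast
          moreover have "Suc (?off x) < V" using p p_le V_bounds by (simp add: p_def)
          ultimately show ?thesis
            using 0 True Suc ctx x V_bounds p p_le rV
            by (simp add: phase1_body_def inv1_def ctx_def p_def[symmetric])
        next
          case t: (Suc i)
          define y where "y = ci p * b + i"
          define S1 where "S1 = ?S(?r := ?S ?r - 2 ^ i)"
          define S2 where "S2 = S1(n + ?r := S1 (n + ?r) + 2 ^ i)"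
          have S2': "S2 = S1(Suc (?lev x) * n + ci p := S1 (Suc (?lev x) * n + ci p) + 2 ^ i)"
            by (simp add: S2_def add.assoc)
          have lx: "?lev x \<le> l" using True by simp
          note some = scan_some[OF reps[OF lx] x px p t, folded y_def]
          note take = phase1_take[OF inv True p_def p t y_def S1_def S2']
          have word: "?S ?r < 2 ^ b" using reps_word_less[OF reps[OF lx] ci] .
          moreover have "Suc (?lev x) * n + ci p = n + ?r" by simp
          then have "?S (n + ?r) < 2 ^ b"
            using reps_word_less[OF reps ci, of "Suc (?lev x)"] True by (simp add: add.assoc)
          moreover have "(2 :: nat) ^ i \<le> 2 ^ b" by (rule power_increasing) (use some(1) in auto)
          moreover have "S1 (n + ?r) = ?S (n + ?r)" using ci by (simp add: S1_def)
          ultimately have SV: "?S ?r - 2 ^ i < V" "S1 (n + ?r) + 2 ^ i < V"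
            using V_bounds(3) by linarith+
          have i: "i < b" "Suc i < V" "y < n" "?mate y \<le> n"
            using some(1,3) V_bounds mate_le[OF m some(3)] by auto
          have pw: "arr s ''pw'' i = 2 ^ i" "arr s ''pw'' b = 2 ^ b" using ctx i by (simp_all add: ctx_def)
          show ?thesis
          proof (cases "?mate y")
            case 0
            have "\<exists>d. phase1 l d (?mate(y := Suc x)) (?mx(x := Suc y)) 0 ?idx ?lev ?off S2 (k - 1)"
              using take(1)[OF 0] by blast
            then show ?thesis
              using 0 t True Suc ctx x V_bounds p p_le rV SV i pw
              by (simp add: phase1_body_def inv1_def ctx_def p_def[symmetric] y_def[symmetric]
                  S1_def[symmetric] S2_def[symmetric])
          next
            case z: (Suc z)
            have "\<exists>d. phase1 l d (?mate(y := Suc x)) (?mx(x := Suc y, z := 0)) (Suc z) ?idx ?lev ?off S2 (k - 1)"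
              using take(2)[OF z] by blast
            then show ?thesis
              using z t True Suc ctx x V_bounds p p_le rV SV i pw
              by (simp add: phase1_body_def inv1_def ctx_def p_def[symmetric] y_def[symmetric]
                  S1_def[symmetric] S2_def[symmetric])
          qed
        qed
      qed
    qed
  qed
qed

lemma wp_phase1:
  assumes ctx: "ctx s" and zero: "\<And>i. arr s ''mate'' i = 0" "\<And>i. arr s ''mx'' i = 0"
    "\<And>i. arr s ''lev'' i = 0" "\<And>i. arr s ''off'' i = 0"
    and S: "reps n b (arr s ''S'') UNIV" "\<And>i. n \<le> i \<Longrightarrow> arr s ''S'' i = 0"
  shows "wp V (search_loop phase1_body)
    (\<lambda>s' _. mates n A (arr s' ''mate'') (arr s' ''mx'') 0 \<and>
      l * matching_number A \<le> l * card (matched n (arr s' ''mate'')) + n) s (budget1 l)"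
proof -
  \<comment> \<open>At the start all labels are 0: row 0 is the full set, and the later rows, being
    zero, represent the empty set.\<close>
  have "reps n b (\<lambda>q. arr s ''S'' (i * n + q)) {y. 0 = i}" for i
    using S by (cases i) (auto simp: reps_def)
  then have "phase1 l (\<lambda>_. 0) (arr s ''mate'') (arr s ''mx'') 0 0
      (arr s ''lev'') (arr s ''off'') (arr s ''S'') (budget1 l)"
    using zero cs_mono by (simp add: phase1_def mates_def)
  then have "inv1 (s\<lparr>reg := (reg s)(''idx'' := 0, ''cur'' := 0)\<rparr>) (budget1 l)"
    using ctx by (auto simp: inv1_def ctx_def)
  moreover have "mates n A (arr s' ''mate'') (arr s' ''mx'') 0 \<and>
      l * matching_number A \<le> l * card (matched n (arr s' ''mate'')) + n"
    if "inv1 s' k" "\<not> reg s' ''idx'' < reg s' ''n'' + reg s' ''cur''" for s' k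
  proof -
    obtain d where inv: "phase1 l d (arr s' ''mate'') (arr s' ''mx'') (reg s' ''cur'') (reg s' ''idx'')
        (arr s' ''lev'') (arr s' ''off'') (arr s' ''S'') k" and "ctx s'"
      using \<open>inv1 s' k\<close> by (auto simp: inv1_def)
    then have "reg s' ''cur'' = 0" "reg s' ''idx'' = n"
      using that(2) by (auto simp: ctx_def phase1_def)
    then have "phase1 l d (arr s' ''mate'') (arr s' ''mx'') 0 n
        (arr s' ''lev'') (arr s' ''off'') (arr s' ''S'') k" using inv by simp
    moreover from this have "mates n A (arr s' ''mate'') (arr s' ''mx'') 0" by (simp add: phase1_def)
    ultimately show ?thesis using phase1_final by blast
  qed
  ultimately show ?thesis
    using inv1_step V_bounds
    by (auto simp: search_loop_def intro!: wp_While[where I = inv1] split: if_splits)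
qed

definition inv2 :: "nat \<Rightarrow> state \<Rightarrow> nat \<Rightarrow> bool" where
  "inv2 c s k \<longleftrightarrow> ctx s \<and>
     (reg s ''found'' = 0 \<and>
      (\<exists>Vis. dfs c Vis (arr s ''mate'') (arr s ''mx'') (reg s ''cur'') (reg s ''idx'')
        (arr s ''off'') (arr s ''U'') (arr s ''stk'') (reg s ''sp'') k) \<or>
      reg s ''found'' = 1 \<and> reg s ''cur'' = 0 \<and> reg s ''idx'' = n \<and>
      mates n A (arr s ''mate'') (arr s ''mx'') 0 \<and> card (matched n (arr s ''mate'')) = Suc c)"

lemma dfs_sp_le:
  assumes "dfs c Vis mate mx cur idx off U stk sp k"
  shows "sp \<le> n"
proof -
  have "card {..<sp} \<le> card {..<n}"
    using assms dfs_V_subset[OF assms] by (intro card_inj_on_le[of stk]) (auto simp: dfs_def)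
  then show ?thesis by simp
qed

lemma inv2_step:
  assumes "inv2 c s k" and guard: "reg s ''idx'' < reg s ''n'' + reg s ''cur''"
  shows "0 < k \<and> wp V dfs_body (inv2 c) s (k - 1)"
proof
  let ?mate = "arr s ''mate''" and ?mx = "arr s ''mx''" and ?cur = "reg s ''cur''"
    and ?idx = "reg s ''idx''" and ?off = "arr s ''off''" and ?U = "arr s ''U''"
    and ?stk = "arr s ''stk''" and ?sp = "reg s ''sp''"
  obtain Vis where inv: "dfs c Vis ?mate ?mx ?cur ?idx ?off ?U ?stk ?sp k" and ctx: "ctx s"
    and found: "reg s ''found'' = 0"
    using assms by (auto simp: inv2_def ctx_def)
  show "0 < k" using dfs_k_pos[OF inv] .
  have sp: "?sp \<le> n" using dfs_sp_le[OF inv] .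
  show "wp V dfs_body (inv2 c) s (k - 1)"
  proof (cases ?cur)
    case 0
    then have idx: "?idx < n" using guard ctx by (simp add: ctx_def)
    have sp0: "?sp = 0" using inv 0 by (simp add: dfs_def)
    show ?thesis
    proof (cases "?mx ?idx = 0")
      case True
      then have "\<exists>Vis. dfs c Vis ?mate ?mx (Suc ?idx) (Suc ?idx) ?off ?U ?stk 0 (k - 1)"
        using dfs_next_root(1)[OF inv[unfolded 0] idx] by blast
      then show ?thesis
        using True 0 sp0 found ctx idx V_bounds by (simp add: dfs_body_def inv2_def ctx_def)
    next
      case False
      then have "\<exists>Vis. dfs c Vis ?mate ?mx 0 (Suc ?idx) ?off ?U ?stk 0 (k - 1)"
        using dfs_next_root(2)[OF inv[unfolded 0] idx] by blast
      then show ?thesis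
        using False 0 sp0 found ctx idx V_bounds by (simp add: dfs_body_def inv2_def ctx_def)
    qed
  next
    case (Suc x)
    note inv = inv[unfolded Suc]
    have m: "mates n A ?mate ?mx (Suc x)" using inv by (simp add: dfs_def)
    have x: "x < n" using m by (simp add: mates_def)
    define p where "p = cs x + ?off x"
    have p_le: "p \<le> cs (Suc x)" "cs (Suc x) \<le> cs n"
      using inv x cs_le[of "Suc x"] by (auto simp: dfs_def p_def)
    show ?thesis
    proof (cases "p < cs (Suc x)")
      case False
      show ?thesis
      proof (cases ?sp)
        case 0
        then have "\<exists>Vis. dfs c Vis ?mate ?mx 0 ?idx ?off ?U ?stk 0 (k - 1)"
          using dfs_finish_root[OF inv[unfolded 0]] False by (auto simp: p_def)
        then show ?thesis
          using False 0 found Suc ctx x V_bounds p_le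
          by (simp add: dfs_body_def inv2_def ctx_def p_def[symmetric])
      next
        case sp': (Suc sp')
        obtain z where z: "?mate (?stk sp') = Suc z" "?stk sp' < n" "z < n"
          "dfs c Vis (?mate(?stk sp' := Suc x)) (?mx(x := Suc (?stk sp'), z := 0)) (Suc z) ?idx ?off ?U ?stk sp' (k - 1)"
          using dfs_undo[OF inv[unfolded sp'] _ refl] False by (auto simp: p_def)
        then have "\<exists>Vis. dfs c Vis (?mate(?stk sp' := Suc x)) (?mx(x := Suc (?stk sp'), z := 0)) (Suc z) ?idx ?off ?U ?stk sp' (k - 1)"
          by blast
        then show ?thesis
          using False sp sp' z(1-3) found Suc ctx x V_bounds p_le
          by (simp add: dfs_body_def inv2_def ctx_def p_def[symmetric])
      qed
    next
      case p: True
      have reps: "reps n b ?U (- Vis)" using inv by (simp add: dfs_def)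
      have px: "cs x \<le> p" by (simp add: p_def)
      have ci: "ci p < n" using ci_less[OF x px p] .
      show ?thesis
      proof (cases "tab (cw p * 2 ^ b + ?U (ci p))")
        case 0
        then have "\<exists>Vis. dfs c Vis ?mate ?mx (Suc x) ?idx (?off(x := Suc (?off x))) ?U ?stk ?sp (k - 1)"
          using dfs_skip_word[OF inv p_def p] by blast
        moreover have "Suc (?off x) < V" using p p_le V_bounds by (simp add: p_def)
        ultimately show ?thesis
          using 0 found Suc ctx x V_bounds p p_le ci
          by (simp add: dfs_body_def inv2_def ctx_def p_def[symmetric])
      next
        case t: (Suc i)
        define y where "y = ci p * b + i"
        note some = scan_some[OF reps x px p t, folded y_def]
        have word: "?U (ci p) < 2 ^ b" using reps_word_less[OF reps ci] .
        then have UV: "?U (ci p) - 2 ^ i < V" using V_bounds by simp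
        have i: "i < b" "Suc i < V" "y < n" "?mate y \<le> n"
          using some(1,3) V_bounds mate_le[OF m some(3)] by auto
        have pw: "arr s ''pw'' i = 2 ^ i" "arr s ''pw'' b = 2 ^ b" using ctx i by (simp_all add: ctx_def)
        show ?thesis
        proof (cases "?mate y")
          case 0
          have "mates n A (?mate(y := Suc x)) (?mx(x := Suc y)) 0"
            "card (matched n (?mate(y := Suc x))) = Suc c"
            using dfs_augment[OF inv p_def p t y_def 0] .
          then show ?thesis
            using 0 t found Suc ctx x V_bounds p p_le ci UV i pw
            by (simp add: dfs_body_def inv2_def ctx_def p_def[symmetric] y_def[symmetric])
        next
          case z: (Suc z)
          have "\<exists>Vis. dfs c Vis (?mate(y := Suc x)) (?mx(x := Suc y, z := 0)) (Suc z) ?idx ?off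
              (?U(ci p := ?U (ci p) - 2 ^ i)) (?stk(?sp := y)) (Suc ?sp) (k - 1)"
            using dfs_push[OF inv p_def p t y_def z] by blast
          then show ?thesis
            using z t found Suc ctx x V_bounds p p_le ci UV i pw sp
            by (simp add: dfs_body_def inv2_def ctx_def p_def[symmetric] y_def[symmetric])
        qed
      qed
    qed
  qed
qed

lemma wp_dfs:
  assumes ctx: "ctx s" and "reg s ''found'' = 0" "reg s ''sp'' = 0"
    and m: "mates n A (arr s ''mate'') (arr s ''mx'') 0" and U: "reps n b (arr s ''U'') UNIV"
    and off: "\<And>x. x < n \<Longrightarrow> arr s ''off'' x = 0"
  shows "wp V (search_loop dfs_body)
    (\<lambda>s' _. ctx s' \<and> mates n A (arr s' ''mate'') (arr s' ''mx'') 0 \<and>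
      (if reg s' ''found'' = 0 then card (matched n (arr s' ''mate'')) = matching_number A
       else card (matched n (arr s' ''mate'')) = Suc (card (matched n (arr s ''mate''))))) s budget2"
proof -
  let ?c = "card (matched n (arr s ''mate''))"
  let ?Q = "\<lambda>s'. ctx s' \<and> mates n A (arr s' ''mate'') (arr s' ''mx'') 0 \<and>
      (if reg s' ''found'' = 0 then card (matched n (arr s' ''mate'')) = matching_number A
       else card (matched n (arr s' ''mate'')) = Suc ?c)"
  have "ctx (s\<lparr>reg := (reg s)(''idx'' := 0, ''cur'' := 0)\<rparr>)" using ctx by (simp add: ctx_def)
  moreover have "dfs ?c {} (arr s ''mate'') (arr s ''mx'') 0 0 (arr s ''off'') (arr s ''U'')
      (arr s ''stk'') 0 budget2"
    by (rule dfs_start[OF m U off order.refl])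
  ultimately have start: "inv2 ?c (s\<lparr>reg := (reg s)(''idx'' := 0, ''cur'' := 0)\<rparr>) budget2"
    using assms(2,3) by (auto simp: inv2_def)
  have final: "?Q s'"
    if I: "inv2 ?c s' k" "\<not> reg s' ''idx'' < reg s' ''n'' + reg s' ''cur''" for s' k
  proof (cases "reg s' ''found'' = 0")
    case True
    then obtain Vis where inv: "dfs ?c Vis (arr s' ''mate'') (arr s' ''mx'') (reg s' ''cur'')
        (reg s' ''idx'') (arr s' ''off'') (arr s' ''U'') (arr s' ''stk'') (reg s' ''sp'') k" and "ctx s'"
      using I(1) by (auto simp: inv2_def)
    then have "reg s' ''cur'' = 0" "reg s' ''idx'' = n"
      using I(2) by (auto simp: ctx_def dfs_def)
    then have "dfs ?c Vis (arr s' ''mate'') (arr s' ''mx'') 0 n (arr s' ''off'') (arr s' ''U'')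
        (arr s' ''stk'') (reg s' ''sp'') k" using inv by simp
    then show ?thesis using dfs_final[of ?c Vis] True \<open>ctx s'\<close> by (auto simp: dfs_def)
  qed (use I in \<open>auto simp: inv2_def\<close>)
  show ?thesis
    unfolding search_loop_def wp_Seq wp_Assign
  proof (intro conjI, goal_cases)
    case 3
    show ?case
    proof (rule wp_While[where I = "inv2 ?c"], goal_cases)
      case 1
      then show ?case using start by simp
    next
      case (2 s k)
      then show ?case using inv2_step[of ?c s k] by (simp split: if_splits)
    next
      case (3 s k)
      then show ?case using final[of s k] by (simp split: if_splits)
    qed
  qed (use V_bounds in auto)
qed

lemma wp_reset:
  assumes ctx: "ctx s" and F: "\<And>q. q < n \<Longrightarrow> arr s ''F'' q < V"
  shows "wp V reset_loop (\<lambda>s' _. \<forall>q<n. arr s' ''U'' q = arr s ''F'' q \<and> arr s' ''off'' q = 0) s n"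
proof -
  let ?I = "\<lambda>s' k. reg s' ''n'' = n \<and> arr s' ''F'' = arr s ''F'' \<and> reg s' ''i'' \<le> n \<and> n \<le> k + reg s' ''i'' \<and>
    (\<forall>q<reg s' ''i''. arr s' ''U'' q = arr s ''F'' q \<and> arr s' ''off'' q = 0)"
  show ?thesis
    unfolding reset_loop_def wp_Seq wp_Assign
  proof (intro conjI, goal_cases)
    case 2
    show ?case
    proof (rule wp_While[where I = ?I], goal_cases)
      case (2 s' k)
      then have "reg s' ''i'' < n" by (simp split: if_splits)
      then show ?case using 2 F V_bounds by (auto simp: less_Suc_eq)
    qed (use ctx in \<open>auto simp: ctx_def split: if_splits\<close>)
  qed (use V_bounds in auto)
qed

definition budget_round :: nat where
  "budget_round = budget2 + n + 1"

text \<open>Each successful round reduces the number of missing edges by one; the \<open>Suc\<close>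
  pays for the last round, which fails and thereby certifies maximality.\<close>

lemma wp_rounds:
  assumes ctx: "ctx s" and m: "mates n A (arr s ''mate'') (arr s ''mx'') 0"
    and F: "reps n b (arr s ''F'') UNIV"
    and k: "Suc (matching_number A - card (matched n (arr s ''mate''))) * budget_round \<le> k"
  shows "wp V rounds (\<lambda>s' _. mates n A (arr s' ''mate'') (arr s' ''mx'') 0 \<and>
      card (matched n (arr s' ''mate'')) = matching_number A) s k"
proof -
  let ?I = "\<lambda>s' k. ctx s' \<and> arr s' ''F'' = arr s ''F'' \<and> mates n A (arr s' ''mate'') (arr s' ''mx'') 0 \<and>
     (if reg s' ''found'' = 0 then card (matched n (arr s' ''mate'')) = matching_number A
      else Suc (matching_number A - card (matched n (arr s' ''mate''))) * budget_round \<le> k)"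
  have FV: "arr s ''F'' q < V" if "q < n" for q
    using reps_word_less[OF F that] V_bounds by simp
  show ?thesis
    unfolding rounds_def wp_Seq wp_Assign
  proof (intro conjI, goal_cases)
    case 2
    show ?case
    proof (rule wp_While[where I = ?I], goal_cases)
      case 1
      then show ?case using assms by (simp add: ctx_def)
    next
      case (2 s1 k1)
      then have inv: "ctx s1" "arr s1 ''F'' = arr s ''F''" "mates n A (arr s1 ''mate'') (arr s1 ''mx'') 0"
        "Suc (matching_number A - card (matched n (arr s1 ''mate''))) * budget_round \<le> k1"
        by auto
      let ?c = "card (matched n (arr s1 ''mate''))"
      let ?s2 = "s1\<lparr>reg := (reg s1)(''found'' := 0, ''sp'' := 0)\<rparr>"
      define e where "e = k1 - budget_round"
      have k1: "k1 - 1 = n + (budget2 + e)" "(matching_number A - ?c) * budget_round \<le> e"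
        and "0 < k1"
        using inv(4) by (auto simp: e_def budget_round_def)
      have ctx2: "ctx ?s2" using inv(1) by (simp add: ctx_def)
      have "wp V (reset_loop ;; search_loop dfs_body) ?I ?s2 (n + (budget2 + e))"
        unfolding wp_Seq
      proof (rule wp_conseq[OF wp_extra[OF wp_reset[OF ctx2]]], goal_cases)
        case (1 q)
        then show ?case using FV inv(2) by simp
      next
        case (2 s3 k3)
        have w: "written_regs reset_loop = {''i''}" "written_arrs reset_loop = {''U'', ''off''}"
          by (auto simp: reset_loop_def)
        have s3: "reg s3 x = reg ?s2 x" if "x \<noteq> ''i''" for x using 2(3) that by (simp add: w)
        have s3a: "arr s3 X = arr ?s2 X" if "X \<noteq> ''U''" "X \<noteq> ''off''" for X
          using 2(4) that by (simp add: w)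
        have ctx3: "ctx s3" using ctx2 by (simp add: ctx_def s3 s3a)
        have "reps n b (arr s3 ''U'') UNIV"
          using F 2(1) inv(2) by (auto simp: reps_def)
        moreover have mate3: "arr s3 ''mate'' = arr s1 ''mate''" by (simp add: s3a)
        ultimately have dfs: "wp V (search_loop dfs_body)
          (\<lambda>s' _. ctx s' \<and> mates n A (arr s' ''mate'') (arr s' ''mx'') 0 \<and>
            (if reg s' ''found'' = 0 then card (matched n (arr s' ''mate'')) = matching_number A
             else card (matched n (arr s' ''mate'')) = Suc ?c)) s3 budget2"
          using wp_dfs[OF ctx3, unfolded mate3] inv(3) 2(1) by (simp add: s3 s3a)
        obtain e3 where e3: "k3 = budget2 + e3" "e \<le> e3" using 2(1) by (metis add.assoc le_Suc_ex add_le_cancel_left le_add1)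
        show ?case
          unfolding e3(1)
        proof (rule wp_conseq[OF wp_extra[OF dfs, of e3]], goal_cases)
          case (1 s4 k4)
          have "''F'' \<notin> written_arrs (search_loop dfs_body)"
            by (simp add: search_loop_def dfs_body_def)
          then have F4: "arr s4 ''F'' = arr s ''F''" using 1(4) inv(2) by (simp add: s3a)
          show ?case
          proof (cases "reg s4 ''found'' = 0")
            case False
            then have c4: "card (matched n (arr s4 ''mate'')) = Suc ?c" using 1(1) by simp
            \<comment> \<open>Keeps the truncated subtraction exact in the next line.\<close>
            then have "Suc ?c \<le> matching_number A" using 1(1) card_matched_le_number by metis
            then have "Suc (matching_number A - Suc ?c) = matching_number A - ?c" by simp
            then show ?thesis using 1(1) c4 F4 False k1(2) e3(2) by simp
          qed (use 1 F4 in simp)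
        qed
      qed
      then show ?case using \<open>0 < k1\<close> V_bounds by (simp add: k1(1)[unfolded One_nat_def] split del: if_split)
    qed (auto split: if_splits)
  qed (use V_bounds in auto)
qed

end

section \<open>Packing the adjacency lists into words\<close>

text \<open>The packed form of one neighbourhood \<open>N\<close>. Words are nonzero and have
  distinct indices, which later limits how many there are.\<close>

definition seg :: "nat \<Rightarrow> (nat \<Rightarrow> nat) \<Rightarrow> (nat \<Rightarrow> nat) \<Rightarrow> nat set \<Rightarrow> nat \<Rightarrow> nat \<Rightarrow> bool" where
  "seg b ci cw N lo hi \<longleftrightarrow> lo \<le> hi \<and> inj_on ci {lo..<hi} \<and>
     (\<forall>p. lo \<le> p \<longrightarrow> p < hi \<longrightarrow> (\<exists>i. bit (cw p) i) \<and>
        (\<forall>i. bit (cw p) i \<longrightarrow> i < b \<and> ci p * b + i \<in> N)) \<and>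
     (\<forall>y\<in>N. \<exists>p. lo \<le> p \<and> p < hi \<and> ci p = y div b \<and> bit (cw p) (y mod b))"

lemma seg_cong:
  assumes "seg b ci cw N lo hi" "\<And>p. lo \<le> p \<Longrightarrow> p < hi \<Longrightarrow> ci' p = ci p \<and> cw' p = cw p"
  shows "seg b ci' cw' N lo hi"
proof -
  have "inj_on ci' {lo..<hi} \<longleftrightarrow> inj_on ci {lo..<hi}" using assms(2) by (intro inj_on_cong) auto
  then show ?thesis using assms unfolding seg_def by metis
qed

lemma seg_empty: "seg b ci cw {} lo lo"
  by (simp add: seg_def)

lemma seg_new_word:
  assumes s: "seg b ci cw N lo hi" and new: "\<And>p. lo \<le> p \<Longrightarrow> p < hi \<Longrightarrow> ci p \<noteq> w div b" and b: "0 < b"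
  shows "seg b (ci(hi := w div b)) (cw(hi := 2 ^ (w mod b))) (insert w N) lo (Suc hi)"
proof -
  let ?ci = "ci(hi := w div b)" and ?cw = "cw(hi := 2 ^ (w mod b))"
  have old: "seg b ?ci ?cw N lo hi" by (rule seg_cong[OF s]) auto
  then have le: "lo \<le> hi" and inj: "inj_on ?ci {lo..<hi}" by (simp_all add: seg_def)
  have bit: "bit ((2 :: nat) ^ (w mod b)) i \<longleftrightarrow> i = w mod b" for i
    by (auto simp: bit_exp_iff)
  have wb: "w mod b < b" "w div b * b + w mod b = w" using b by simp_all
  have "?ci hi \<notin> ?ci ` {lo..<hi}"
  proof
    assume "?ci hi \<in> ?ci ` {lo..<hi}"
    then obtain r where "lo \<le> r" "r < hi" "ci r = w div b" by auto
    with new show False by blast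
  qed
  with inj le have inj': "inj_on ?ci {lo..<Suc hi}" by (simp add: atLeastLessThanSuc)
  show ?thesis
    unfolding seg_def
  proof (intro conjI allI impI ballI)
    fix r i assume r: "lo \<le> r" "r < Suc hi" "bit (?cw r) i"
    show "i < b" "?ci r * b + i \<in> insert w N"
    proof (atomize (full), cases "r = hi")
      case True
      then show "i < b \<and> ?ci r * b + i \<in> insert w N" using r(3) bit wb by simp
    next
      case False
      then show "i < b \<and> ?ci r * b + i \<in> insert w N" using r old unfolding seg_def by simp
    qed
  next
    fix r assume r: "lo \<le> r" "r < Suc hi"
    show "\<exists>i. bit (?cw r) i"
    proof (cases "r = hi")
      case False
      then show ?thesis using r old unfolding seg_def by simp
    qed (use bit in auto)
  next
    fix y assume "y \<in> insert w N"
    then show "\<exists>r\<ge>lo. r < Suc hi \<and> ?ci r = y div b \<and> bit (?cw r) (y mod b)"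
    proof
      assume "y = w"
      then show ?thesis using le bit by (intro exI[of _ hi]) simp
    next
      assume "y \<in> N"
      then show ?thesis using old less_SucI unfolding seg_def by blast
    qed
  qed (use le inj' in auto)
qed

text \<open>Adding the power of two sets exactly one bit because \<open>w\<close> is new to
  \<open>N\<close>; for the input this is the distinctness of the adjacency lists.\<close>

lemma seg_old_word:
  assumes s: "seg b ci cw N lo hi" and p: "lo \<le> p" "p < hi" "ci p = w div b" and w: "w \<notin> N" and b: "0 < b"
  shows "seg b ci (cw(p := cw p + 2 ^ (w mod b))) (insert w N) lo hi"
proof -
  have "\<not> bit (cw p) (w mod b)"
    using s p w unfolding seg_def by (metis div_mult_mod_eq)
  note bit = bit_add_exp[OF this]
  have wb: "w mod b < b" "w div b * b + w mod b = w" using b by simp_all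
  show ?thesis
    unfolding seg_def
  proof (intro conjI allI impI ballI)
    fix r i assume r: "lo \<le> r" "r < hi" "bit ((cw(p := cw p + 2 ^ (w mod b))) r) i"
    have "bit (cw r) i \<or> r = p \<and> i = w mod b" using r(3) bit by (auto split: if_splits)
    then show "i < b" "ci r * b + i \<in> insert w N"
      using s r p wb unfolding seg_def by auto
  next
    fix r assume r: "lo \<le> r" "r < hi"
    then obtain i where "bit (cw r) i" using s unfolding seg_def by blast
    then show "\<exists>i. bit ((cw(p := cw p + 2 ^ (w mod b))) r) i" using bit by auto
  next
    fix y assume "y \<in> insert w N"
    then show "\<exists>r. lo \<le> r \<and> r < hi \<and> ci r = y div b \<and>
        bit ((cw(p := cw p + 2 ^ (w mod b))) r) (y mod b)"
    proof
      assume "y = w"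
      then show ?thesis using p bit by (intro exI[of _ p]) simp
    next
      assume "y \<in> N"
      then obtain r where "lo \<le> r" "r < hi" "ci r = y div b" "bit (cw r) (y mod b)"
        using s unfolding seg_def by blast
      then show ?thesis using bit by (intro exI[of _ r]) auto
    qed
  qed (use s in \<open>auto simp: seg_def\<close>)
qed

locale adj_array = bip_graph +
  fixes m b :: nat and start adj :: "nat \<Rightarrow> nat"
  assumes b_pos: "0 < b"
    and start_0: "start 0 = 0" and start_n: "start n = m"
    and start_mono: "\<And>x. x < n \<Longrightarrow> start x \<le> start (Suc x)"
    and adj_image: "\<And>x. x < n \<Longrightarrow> adj ` {start x..<start (Suc x)} = {y. (x, y) \<in> A}"
    and adj_inj: "\<And>x. x < n \<Longrightarrow> inj_on adj {start x..<start (Suc x)}"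
begin

lemma start_le: "x \<le> n \<Longrightarrow> start x \<le> m"
proof (induction rule: inc_induct)
  case base
  then show ?case by (simp add: start_n)
next
  case (step x)
  then show ?case using start_mono[of x] by linarith
qed

text \<open>The lists before that of \<open>x\<close> have been processed, and that of \<open>x\<close> up to position \<open>p\<close>.  The
  stamp \<open>st q = Suc x\<close> says that \<open>x\<close> already has a word with index \<open>q\<close>, at position \<open>pos q\<close>; stamps of
  earlier vertices need not be erased.\<close>

definition build :: "nat \<Rightarrow> nat \<Rightarrow> nat \<Rightarrow> (nat \<Rightarrow> nat) \<Rightarrow> (nat \<Rightarrow> nat) \<Rightarrow> (nat \<Rightarrow> nat) \<Rightarrow> (nat \<Rightarrow> nat) \<Rightarrow>
    (nat \<Rightarrow> nat) \<Rightarrow> (nat \<Rightarrow> nat) \<Rightarrow> nat \<Rightarrow> bool" where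
  "build x p e st pos ci cw cs inn k \<longleftrightarrow>
     x \<le> n \<and> start x \<le> p \<and> (x < n \<longrightarrow> p \<le> start (Suc x)) \<and> (x = n \<longrightarrow> p = m) \<and> e \<le> p \<and>
     cs 0 = 0 \<and> (\<forall>z<x. cs z \<le> cs (Suc z) \<and> cs (Suc z) \<le> cs x) \<and>
     (\<forall>z<x. seg b ci cw {y. (z, y) \<in> A} (cs z) (cs (Suc z))) \<and>
     seg b ci cw (adj ` {start x..<p}) (cs x) e \<and> (x = n \<longrightarrow> e = cs n) \<and>
     (\<forall>q. st q \<le> Suc x \<and> (st q = Suc x \<longrightarrow> cs x \<le> pos q \<and> pos q < e \<and> ci (pos q) = q)) \<and>
     (\<forall>r. cs x \<le> r \<longrightarrow> r < e \<longrightarrow> st (ci r) = Suc x) \<and>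
     (\<forall>y z. inn y = Suc z \<longrightarrow> (z, y) \<in> A) \<and>
     (\<forall>y. (\<exists>z<x. (z, y) \<in> A) \<or> y \<in> adj ` {start x..<p} \<longrightarrow> inn y \<noteq> 0) \<and>
     n + m \<le> k + x + p"

lemma build_next_vertex:
  assumes "build x p e st pos ci cw cs inn k" "x < n" "\<not> p < start (Suc x)"
  shows "0 < k \<and> build (Suc x) p e st pos ci cw (cs(Suc x := e)) inn (k - 1)"
proof -
  have p: "p = start (Suc x)" using assms by (auto simp: build_def)
  have N: "adj ` {start x..<p} = {y. (x, y) \<in> A}" using adj_image[OF assms(2)] p by simp
  have kpos: "0 < k" using assms(1,2) start_le[of "Suc x"] p by (auto simp: build_def)
  have "start (Suc x) = m" if "Suc x = n" using that start_n by simp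
  moreover have "seg b ci cw {y. (x, y) \<in> A} (cs x) e" using assms(1) N by (simp add: build_def)
  moreover from this have "cs x \<le> e" by (simp add: seg_def)
  moreover have "st q \<le> Suc x" for q using assms(1) by (simp add: build_def)
  then have "st q \<le> Suc (Suc x)" "st q \<noteq> Suc (Suc x)" for q
    by (metis le_SucI, metis Suc_n_not_le_n)
  ultimately show ?thesis
    using assms(1,2) start_mono[of "Suc x"] kpos N
    unfolding build_def p by (auto simp: less_Suc_eq seg_empty)
qed

lemma build_edge:
  assumes inv: "build x p e st pos ci cw cs inn k" and x: "x < n" and p: "p < start (Suc x)"
    and w: "w = adj p" and q: "q = w div b"
  shows "0 < k" and "w < n" and "p < m"
    and "st q = Suc x \<Longrightarrow> cw (pos q) < 2 ^ b \<and>
      build x (Suc p) e st pos ci (cw(pos q := cw (pos q) + 2 ^ (w mod b))) cs (inn(w := Suc x)) (k - 1)"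
    and "st q \<noteq> Suc x \<Longrightarrow> build x (Suc p) (Suc e) (st(q := Suc x)) (pos(q := e)) (ci(e := q))
      (cw(e := 2 ^ (w mod b))) cs (inn(w := Suc x)) (k - 1)"
proof -
  let ?N = "adj ` {start x..<p}"
  have sp: "start x \<le> p" using inv by (simp add: build_def)
  have pin: "p \<in> {start x..<start (Suc x)}" using sp p by simp
  then have xw: "(x, w) \<in> A" using adj_image[OF x] w by blast
  then show "w < n" by (rule A_less)
  have N': "adj ` {start x..<Suc p} = insert w ?N"
    using sp by (simp add: atLeastLessThanSuc w)
  have wN: "w \<notin> ?N"
  proof
    assume "w \<in> ?N"
    then obtain r where r: "r \<in> {start x..<p}" "adj r = adj p" using w by auto
    then have "r \<in> {start x..<start (Suc x)}" using p by auto
    then have "r = p" using inj_onD[OF adj_inj[OF x] r(2) _ pin] by blast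
    with r(1) show False by simp
  qed
  show pm: "p < m" using p start_le[of "Suc x"] x by simp
  then show kpos: "0 < k" using inv x by (simp add: build_def)
  have segx: "seg b ci cw ?N (cs x) e" using inv by (simp add: build_def)
  have segs: "seg b ci cw {y. (z, y) \<in> A} (cs z) (cs (Suc z))" "cs (Suc z) \<le> cs x" if "z < x" for z
    using inv that by (auto simp: build_def)
  have cse: "cs x \<le> e" using segx by (simp add: seg_def)
  have inn: "(\<forall>y z. (inn(w := Suc x)) y = Suc z \<longrightarrow> (z, y) \<in> A)"
    "(\<forall>y. (\<exists>z<x. (z, y) \<in> A) \<or> y \<in> insert w ?N \<longrightarrow> (inn(w := Suc x)) y \<noteq> 0)"
    using inv xw by (auto simp: build_def)
  show "cw (pos q) < 2 ^ b \<and> build x (Suc p) e st pos ci (cw(pos q := cw (pos q) + 2 ^ (w mod b))) cs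
      (inn(w := Suc x)) (k - 1)" if st: "st q = Suc x"
  proof
    have pos: "cs x \<le> pos q" "pos q < e" "ci (pos q) = w div b"
      using inv st q by (auto simp: build_def)
    then show "cw (pos q) < 2 ^ b" using segx by (intro nat_less_exp_if_bits) (auto simp: seg_def)
    have "seg b ci (cw(pos q := cw (pos q) + 2 ^ (w mod b))) (insert w ?N) (cs x) e"
      by (rule seg_old_word[OF segx pos wN b_pos])
    moreover have "\<forall>z<x. seg b ci (cw(pos q := cw (pos q) + 2 ^ (w mod b))) {y. (z, y) \<in> A} (cs z) (cs (Suc z))"
    proof (intro allI impI)
      fix z assume z: "z < x"
      show "seg b ci (cw(pos q := cw (pos q) + 2 ^ (w mod b))) {y. (z, y) \<in> A} (cs z) (cs (Suc z))"
        by (rule seg_cong[OF segs(1)[OF z]]) (use segs(2)[OF z] pos(1) in auto)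
    qed
    ultimately show "build x (Suc p) e st pos ci (cw(pos q := cw (pos q) + 2 ^ (w mod b))) cs
        (inn(w := Suc x)) (k - 1)"
      unfolding build_def N' using inv inn kpos x p by (simp add: build_def)
  qed
  show "build x (Suc p) (Suc e) (st(q := Suc x)) (pos(q := e)) (ci(e := q))
      (cw(e := 2 ^ (w mod b))) cs (inn(w := Suc x)) (k - 1)" if st: "st q \<noteq> Suc x"
  proof -
    have new: "ci r \<noteq> w div b" if "cs x \<le> r" "r < e" for r
      using inv that st q by (auto simp: build_def)
    have seg1: "seg b (ci(e := q)) (cw(e := 2 ^ (w mod b))) (insert w ?N) (cs x) (Suc e)"
      unfolding q by (rule seg_new_word[OF segx new b_pos])
    have seg2: "\<forall>z<x. seg b (ci(e := q)) (cw(e := 2 ^ (w mod b))) {y. (z, y) \<in> A} (cs z) (cs (Suc z))"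
    proof (intro allI impI)
      fix z assume z: "z < x"
      show "seg b (ci(e := q)) (cw(e := 2 ^ (w mod b))) {y. (z, y) \<in> A} (cs z) (cs (Suc z))"
        by (rule seg_cong[OF segs(1)[OF z]]) (use segs(2)[OF z] cse in auto)
    qed
    have st1: "\<forall>r. (st(q := Suc x)) r \<le> Suc x \<and> ((st(q := Suc x)) r = Suc x \<longrightarrow>
        cs x \<le> (pos(q := e)) r \<and> (pos(q := e)) r < Suc e \<and> (ci(e := q)) ((pos(q := e)) r) = r)"
      using inv cse by (auto simp: build_def less_Suc_eq)
    have st2: "\<forall>r. cs x \<le> r \<longrightarrow> r < Suc e \<longrightarrow> (st(q := Suc x)) ((ci(e := q)) r) = Suc x"
      using inv by (auto simp: build_def less_Suc_eq)
    show ?thesis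
      unfolding build_def N' using inv inn kpos x p seg1 seg2 st1 st2 by (simp add: build_def)
  qed
qed

lemma build_bounds:
  assumes "build x p e st pos ci cw cs inn k"
  shows "x \<le> n" "e \<le> p" "p \<le> m" "n + m \<le> k + x + p"
proof -
  show *: "x \<le> n" "e \<le> p" "n + m \<le> k + x + p" using assms by (simp_all add: build_def)
  have "p \<le> start (Suc x) \<or> p = m" "x < n \<or> x = n" using assms by (auto simp: build_def)
  then show "p \<le> m" using start_le[of "Suc x"] assms by (auto simp: build_def)
qed

lemma seg_ci_less:
  assumes "x < n" "seg b ci cw {y. (x, y) \<in> A} lo hi" "lo \<le> p" "p < hi"
  shows "ci p \<le> (n - 1) div b"
proof -
  obtain i where "bit (cw p) i" using assms unfolding seg_def by blast
  then have "(x, ci p * b + i) \<in> A" "i < b" using assms unfolding seg_def by auto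
  then have "ci p * b + i \<le> n - 1" "(ci p * b + i) div b = ci p" using A_less[of x] b_pos by fastforce+
  then show ?thesis by (metis div_le_mono)
qed

text \<open>The two bounds on the number of words have different sources: every list entry creates
  at most one word, and the words of one vertex have distinct indices up to
  \<open>(n - 1) div b\<close>.\<close>

lemma build_final:
  assumes inv: "build n p e st pos ci cw cs inn k"
    and tab: "\<And>a c. a < 2 ^ b \<Longrightarrow> c < 2 ^ b \<Longrightarrow> common_bit (tab (a * 2 ^ b + c)) a c"
  shows "word_graph n A b cs ci cw tab" "cs n \<le> m" "cs n \<le> n * Suc ((n - 1) div b)"
proof -
  have segs: "seg b ci cw {y. (x, y) \<in> A} (cs x) (cs (Suc x))" "cs x \<le> cs (Suc x)" if "x < n" for x
    using inv that by (auto simp: build_def)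
  show "cs n \<le> m" using inv by (simp add: build_def)
  have "cs x \<le> x * Suc ((n - 1) div b)" if "x \<le> n" for x
    using that
  proof (induction x)
    case 0
    then show ?case using inv by (simp add: build_def)
  next
    case (Suc x)
    then have x: "x < n" by simp
    have "card {cs x..<cs (Suc x)} \<le> card {..(n - 1) div b}"
      using segs(1)[OF x] seg_ci_less[OF x segs(1)[OF x]]
      by (intro card_inj_on_le[of ci]) (auto simp: seg_def)
    then show ?case using Suc by simp
  qed
  then show "cs n \<le> n * Suc ((n - 1) div b)" by simp
  show "word_graph n A b cs ci cw tab"
  proof unfold_locales
    show "cs 0 = 0" using inv by (simp add: build_def)
    fix x p assume x: "x < n" "cs x \<le> p" "p < cs (Suc x)"
    have "(n - 1) div b \<le> n - 1" by (rule div_le_dividend)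
    then show "ci p < n" using seg_ci_less[OF x(1) segs(1)[OF x(1)] x(2,3)] x(1) by linarith
    show "i < b \<and> (x, ci p * b + i) \<in> A" if "bit (cw p) i" for i
      using segs(1)[OF x(1)] x that by (auto simp: seg_def)
  next
    fix x y assume xy: "(x, y) \<in> A"
    then show "\<exists>p\<ge>cs x. p < cs (Suc x) \<and> ci p = y div b \<and> bit (cw p) (y mod b)"
      using segs(1)[OF A_less(1)[OF xy]] by (auto simp: seg_def)
  qed (use b_pos segs(2) tab in auto)
qed

text \<open>\<open>inn\<close> serves two purposes: its zeros are the sources, and its other entries
  are the arbitrary edges of step 5.\<close>

lemma build_inn:
  assumes inv: "build n p e st pos ci cw cs inn k"
  shows "inn y = Suc z \<Longrightarrow> (z, y) \<in> A" "inn y = 0 \<longleftrightarrow> (\<forall>z. (z, y) \<notin> A)"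
proof -
  show 1: "inn y = Suc z \<Longrightarrow> (z, y) \<in> A" for z using inv by (simp add: build_def)
  have "inn y \<noteq> 0" if "(z, y) \<in> A" for z
    using inv that A_less[OF that] by (auto simp: build_def)
  moreover have "\<exists>z. (z, y) \<in> A" if "inn y \<noteq> 0" using that 1 by (cases "inn y") auto
  ultimately show "inn y = 0 \<longleftrightarrow> (\<forall>z. (z, y) \<notin> A)" by auto
qed

end

definition build_loop :: com where
  "build_loop =
    (Assign ''x'' (Const 0) ;; Assign ''p'' (Const 0) ;; Assign ''e'' (Const 0) ;;
     While (Reg ''x'' \<prec> Reg ''n'')
       (Cond (Reg ''p'' \<prec> Get ''start'' (Reg ''x'' \<oplus> Const 1))
         (Assign ''w'' (Get ''adj'' (Reg ''p'')) ;;
          Put ''inn'' (Reg ''w'') (Reg ''x'' \<oplus> Const 1) ;;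
          Assign ''q'' (Bin Div (Reg ''w'') (Reg ''b'')) ;;
          Cond (Bin Equal (Get ''st'' (Reg ''q'')) (Reg ''x'' \<oplus> Const 1))
            (Put ''cw'' (Get ''pos'' (Reg ''q''))
              (Get ''cw'' (Get ''pos'' (Reg ''q'')) \<oplus> Get ''pw'' (Bin Mod (Reg ''w'') (Reg ''b''))))
            (Put ''st'' (Reg ''q'') (Reg ''x'' \<oplus> Const 1) ;;
             Put ''pos'' (Reg ''q'') (Reg ''e'') ;;
             Put ''ci'' (Reg ''e'') (Reg ''q'') ;;
             Put ''cw'' (Reg ''e'') (Get ''pw'' (Bin Mod (Reg ''w'') (Reg ''b''))) ;;
             Assign ''e'' (Reg ''e'' \<oplus> Const 1)) ;;
          Assign ''p'' (Reg ''p'' \<oplus> Const 1))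
         (Assign ''x'' (Reg ''x'' \<oplus> Const 1) ;;
          Put ''cs'' (Reg ''x'') (Reg ''e''))))"

lemma (in adj_array) wp_build:
  assumes V: "n + 2 < V" "m + 2 < V" "2 * 2 ^ b < V"
    and s: "reg s ''n'' = n" "reg s ''b'' = b" "\<And>x. x \<le> n \<Longrightarrow> arr s ''start'' x = start x"
      "\<And>p. p < m \<Longrightarrow> arr s ''adj'' p = adj p" "\<And>i. i \<le> b \<Longrightarrow> arr s ''pw'' i = 2 ^ i"
    and zero: "\<And>i. arr s ''st'' i = 0" "\<And>i. arr s ''inn'' i = 0" "\<And>i. arr s ''cs'' i = 0"
  shows "wp V build_loop (\<lambda>s' _. \<exists>p e k. build n p e (arr s' ''st'') (arr s' ''pos'')
      (arr s' ''ci'') (arr s' ''cw'') (arr s' ''cs'') (arr s' ''inn'') k) s (n + m)"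
proof -
  let ?I = "\<lambda>s' k. reg s' ''n'' = n \<and> reg s' ''b'' = b \<and> arr s' ''start'' = arr s ''start'' \<and>
    arr s' ''adj'' = arr s ''adj'' \<and> arr s' ''pw'' = arr s ''pw'' \<and>
    build (reg s' ''x'') (reg s' ''p'') (reg s' ''e'') (arr s' ''st'') (arr s' ''pos'')
      (arr s' ''ci'') (arr s' ''cw'') (arr s' ''cs'') (arr s' ''inn'') k"
  have init: "build 0 0 0 (arr s ''st'') (arr s ''pos'') (arr s ''ci'') (arr s ''cw'') (arr s ''cs'')
      (arr s ''inn'') (n + m)"
  proof -
    \<comment> \<open>For \<open>n = 0\<close> the loop starts at its end, where the invariant
      demands \<open>p = m\<close>.\<close>
    have "n = 0 \<longrightarrow> m = 0" using start_0 start_n by auto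
    then show ?thesis using start_0 zero by (auto simp: build_def seg_empty)
  qed
  show ?thesis
    unfolding build_loop_def wp_Seq wp_Assign
  proof (intro conjI, goal_cases)
    case 4
    show ?case
    proof (rule wp_While[where I = ?I], goal_cases)
      case 1
      then show ?case using init s by simp
    next
      case (2 s1 k)
      let ?x = "reg s1 ''x''" and ?p = "reg s1 ''p''"
      have fr: "reg s1 ''n'' = n" "reg s1 ''b'' = b" "arr s1 ''start'' = arr s ''start''"
        "arr s1 ''adj'' = arr s ''adj''" "arr s1 ''pw'' = arr s ''pw''"
        and inv: "build ?x ?p (reg s1 ''e'') (arr s1 ''st'') (arr s1 ''pos'')
        (arr s1 ''ci'') (arr s1 ''cw'') (arr s1 ''cs'') (arr s1 ''inn'') k" using 2(1) by auto
      have x: "?x < n" using 2 by (simp split: if_splits)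
      note bounds = build_bounds[OF inv]
      have st: "arr s ''start'' (Suc ?x) = start (Suc ?x)" using s(3) x by simp
      show ?case
      proof (cases "?p < start (Suc ?x)")
        case False
        then show ?thesis
          using build_next_vertex[OF inv x False] fr st x bounds V by (simp)
      next
        case True
        define w where "w = adj ?p"
        define q where "q = w div b"
        note edge = build_edge[OF inv x True w_def q_def]
        have pw: "arr s ''pw'' (w mod b) = 2 ^ (w mod b)" using s(5) b_pos by (simp add: less_imp_le)
        have adj: "arr s ''adj'' ?p = w" using s(4)[OF edge(3)] by (simp add: w_def)
        have exp: "(2 :: nat) ^ (w mod b) \<le> 2 ^ b"
          by (rule power_increasing) (use b_pos in \<open>auto simp: less_imp_le\<close>)
        have qw: "q \<le> w" unfolding q_def by (rule div_le_dividend)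
        show ?thesis
        proof (cases "arr s1 ''st'' q = Suc ?x")
          case eq: True
          have "arr s1 ''cw'' (arr s1 ''pos'' q) + 2 ^ (w mod b) < V"
            using edge(4)[OF eq] exp V(3) by linarith
          then show ?thesis
            using edge(1-3) edge(4)[OF eq] eq True fr st x bounds V pw adj qw
            by (simp add: q_def[symmetric])
        next
          case ne: False
          have "(2 :: nat) ^ (w mod b) < V" using exp V(3) by linarith
          then show ?thesis
            using edge(1-3) edge(5)[OF ne] ne True fr st x bounds V pw adj qw
            by (simp add: q_def[symmetric])
        qed
      qed
    next
      case (3 s1 k)
      then have "reg s1 ''x'' = n" using build_bounds(1) by (force split: if_splits)
      then show ?case using 3 by auto
    qed
  qed (use V in auto)
qed

section \<open>Tables and remaining loops\<close>

text \<open>The guard says that \<open>4 ^ (b + 1)\<close> is at most \<open>n\<close>. At the end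
  \<open>4 ^ b\<close> is at most \<open>n\<close>, or \<open>b\<close> is still 1, hence the bound
  \<open>n + 3\<close>; and \<open>2 * (b + 1)\<close> exceeds the logarithm of
  \<open>n\<close>.\<close>

definition word_loop :: com where
  "word_loop =
    (Assign ''b'' (Const 1) ;; Put ''pw'' (Const 0) (Const 1) ;; Put ''pw'' (Const 1) (Const 2) ;;
     While (Const 4 \<otimes> Get ''pw'' (Reg ''b'') \<otimes> Get ''pw'' (Reg ''b'') \<prec> Reg ''n'' \<oplus> Const 1)
       (Put ''pw'' (Reg ''b'' \<oplus> Const 1) (Const 2 \<otimes> Get ''pw'' (Reg ''b'')) ;;
        Assign ''b'' (Reg ''b'' \<oplus> Const 1)))"

text \<open>A dynamic program over pairs of words: bit 0 is common if both words are odd; otherwise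
  a common bit of the halves is shifted by one. The pair of halves has a smaller index, unless both
  words are 0.\<close>

definition table_loop :: com where
  "table_loop =
    (Assign ''i'' (Const 0) ;;
     While (Reg ''i'' \<prec> Get ''pw'' (Reg ''b'') \<otimes> Get ''pw'' (Reg ''b''))
       (Assign ''a'' (Bin Div (Reg ''i'') (Get ''pw'' (Reg ''b''))) ;;
        Assign ''c'' (Bin Mod (Reg ''i'') (Get ''pw'' (Reg ''b''))) ;;
        Cond (Bin Mod (Reg ''a'') (Const 2) \<otimes> Bin Mod (Reg ''c'') (Const 2))
          (Put ''tab'' (Reg ''i'') (Const 1))
          (Assign ''t'' (Get ''tab'' (Bin Div (Reg ''a'') (Const 2) \<otimes> Get ''pw'' (Reg ''b'') \<oplus>
             Bin Div (Reg ''c'') (Const 2))) ;;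
           Cond (Reg ''t'') (Put ''tab'' (Reg ''i'') (Reg ''t'' \<oplus> Const 1)) Skip) ;;
        Assign ''i'' (Reg ''i'' \<oplus> Const 1)))"

text \<open>Besides counting the sources, this fills \<open>F\<close> and row 0 of \<open>S\<close>
  with the full vertex set.\<close>

definition count_loop :: com where
  "count_loop =
    (Assign ''y'' (Const 0) ;; Assign ''cnt'' (Const 0) ;;
     While (Reg ''y'' \<prec> Reg ''n'')
       (Cond (Get ''inn'' (Reg ''y'')) Skip (Assign ''cnt'' (Reg ''cnt'' \<oplus> Const 1)) ;;
        Assign ''q'' (Bin Div (Reg ''y'') (Reg ''b'')) ;;
        Put ''F'' (Reg ''q'') (Get ''F'' (Reg ''q'') \<oplus> Get ''pw'' (Bin Mod (Reg ''y'') (Reg ''b''))) ;;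
        Put ''S'' (Reg ''q'') (Get ''F'' (Reg ''q'')) ;;
        Assign ''y'' (Reg ''y'' \<oplus> Const 1)))"

definition sqrt_loop :: com where
  "sqrt_loop =
    (Assign ''l'' (Const 0) ;;
     While (Reg ''l'' \<otimes> Reg ''l'' \<prec> Reg ''n'') (Assign ''l'' (Reg ''l'' \<oplus> Const 1)))"

definition final_loop :: com where
  "final_loop =
    (Assign ''y'' (Const 0) ;;
     While (Reg ''y'' \<prec> Reg ''n'')
       (Cond (Get ''mate'' (Reg ''y''))
          (Put ''parent'' (Reg ''y'') (Get ''mate'' (Reg ''y'')))
          (Put ''parent'' (Reg ''y'') (Get ''inn'' (Reg ''y''))) ;;
        Assign ''y'' (Reg ''y'' \<oplus> Const 1)) ;;
     Assign ''yes'' (Const 1))"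

text \<open>Register \<open>yes\<close> is 0 in the input state, so every \<open>Skip\<close>
  amounts to the answer NO. The first two tests take constant time.\<close>

definition minleaf_program :: com where
  "minleaf_program =
    Cond (Reg ''n'')
      (Cond (Reg ''m'' \<oplus> Const 1 \<prec> Reg ''n'') Skip
        (word_loop ;; table_loop ;; build_loop ;; count_loop ;;
         Cond (Bin Equal (Reg ''cnt'') (Const 1))
           (sqrt_loop ;; search_loop phase1_body ;; rounds ;; final_loop)
           Skip))
      Skip"

section \<open>Iteration counts and results of the auxiliary loops\<close>

lemma four_power: "(4 :: nat) ^ b = 2 ^ b * 2 ^ b"
  by (simp flip: power_mult_distrib)

lemma wp_word_loop:
  assumes n: "reg s ''n'' = n" "0 < n" and V: "n + 5 < V"
  shows "wp V word_loop (\<lambda>s' _. \<exists>b. 0 < b \<and> reg s' ''b'' = b \<and> (\<forall>i\<le>b. arr s' ''pw'' i = 2 ^ i) \<and>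
      4 ^ b \<le> n + 3 \<and> n < 4 ^ Suc b) s n"
proof -
  let ?I = "\<lambda>s' k. reg s' ''n'' = n \<and> 0 < reg s' ''b'' \<and> (\<forall>i\<le>reg s' ''b''. arr s' ''pw'' i = 2 ^ i) \<and>
    4 ^ reg s' ''b'' \<le> n + 3 \<and> n < k + reg s' ''b''"
  show ?thesis
    unfolding word_loop_def wp_Seq wp_Assign wp_Put
  proof (intro conjI, goal_cases)
    case 4
    show ?case
    proof (rule wp_While[where I = ?I], goal_cases)
      case 1
      then show ?case using n by (simp add: le_Suc_eq)
    next
      case (2 s1 k)
      let ?b = "reg s1 ''b''"
      have le: "4 ^ Suc ?b \<le> n" using 2 by (simp add: four_power split: if_splits)
      have "2 ^ Suc ?b \<le> (4 :: nat) ^ Suc ?b" by (rule power_mono) simp_all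
      moreover from less_exp this have "Suc ?b < 4 ^ Suc ?b" by (rule less_le_trans)
      ultimately show ?case using 2 le V by (auto simp: le_Suc_eq)
    next
      case (3 s1 k)
      then have "n < 4 ^ Suc (reg s1 ''b'')" by (simp add: four_power split: if_splits)
      then show ?case using 3 by blast
    qed
  qed (use V in auto)
qed

lemma common_bit_double:
  "odd a \<Longrightarrow> odd c \<Longrightarrow> common_bit 1 a c"
  "common_bit 0 (a div 2) (c div 2) \<Longrightarrow> \<not> (odd a \<and> odd c) \<Longrightarrow> common_bit 0 a c"
  "common_bit (Suc i) (a div 2) (c div 2) \<Longrightarrow> common_bit (Suc (Suc i)) a c"
proof -
  have bit: "bit x i \<longleftrightarrow> (case i of 0 \<Rightarrow> odd x | Suc j \<Rightarrow> bit (x div 2) j)" for x i :: nat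
    by (cases i) (simp_all add: bit_0 bit_Suc)
  show "odd a \<Longrightarrow> odd c \<Longrightarrow> common_bit 1 a c" by (simp add: common_bit_def bit_0)
  show "common_bit 0 (a div 2) (c div 2) \<Longrightarrow> \<not> (odd a \<and> odd c) \<Longrightarrow> common_bit 0 a c"
    unfolding common_bit_def nat.case by (subst (1 2) bit) (auto split: nat.splits)
  show "common_bit (Suc i) (a div 2) (c div 2) \<Longrightarrow> common_bit (Suc (Suc i)) a c"
    by (simp add: common_bit_def bit_Suc)
qed

lemma common_bit_le:
  assumes "common_bit t a c" "a < 2 ^ b"
  shows "t \<le> b"
proof (cases t)
  case (Suc i)
  then have "bit a i" using assms(1) by (simp add: common_bit_def)
  moreover have "\<not> bit a i" if "b \<le> i"
  proof -
    have "(2 :: nat) ^ b \<le> 2 ^ i" using that by (rule power_increasing) simp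
    with assms(2) have "a < 2 ^ i" by (rule less_le_trans)
    then show ?thesis by (simp add: bit_iff_odd)
  qed
  ultimately show ?thesis using Suc by (meson Suc_leI not_less)
qed simp

lemma wp_table_loop:
  assumes b: "reg s ''b'' = b" "\<And>i. i \<le> b \<Longrightarrow> arr s ''pw'' i = 2 ^ i" "0 < b"
    and zero: "\<And>i. arr s ''tab'' i = 0" and V: "4 ^ b + 1 < V"
  shows "wp V table_loop (\<lambda>s' _. \<forall>a c. a < 2 ^ b \<longrightarrow> c < 2 ^ b \<longrightarrow>
      common_bit (arr s' ''tab'' (a * 2 ^ b + c)) a c) s (4 ^ b)"
proof -
  let ?B = "2 ^ b :: nat"
  define ok where "ok i tab \<longleftrightarrow> (\<forall>j<i. common_bit (tab j) (j div ?B) (j mod ?B)) \<and> (\<forall>j\<ge>i. tab j = 0)"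
    for i and tab :: "nat \<Rightarrow> nat"
  let ?I = "\<lambda>s' k. reg s' ''b'' = b \<and> arr s' ''pw'' b = ?B \<and> reg s' ''i'' \<le> ?B * ?B \<and>
    ok (reg s' ''i'') (arr s' ''tab'') \<and> ?B * ?B \<le> k + reg s' ''i''"
  have bB: "b < ?B * ?B" by (rule less_exp[THEN less_le_trans]) simp
  show ?thesis
    unfolding table_loop_def wp_Seq wp_Assign
  proof (intro conjI, goal_cases)
    case 2
    show ?case
    proof (rule wp_While[where I = ?I], goal_cases)
      case 1
      then show ?case using b zero by (simp add: four_power ok_def)
    next
      case (2 s1 k)
      let ?i = "reg s1 ''i''" and ?tab = "arr s1 ''tab''"
      define a c where "a = ?i div ?B" and "c = ?i mod ?B"
      have i: "?i < ?B * ?B" "0 < k" using 2 by (auto split: if_splits)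
      have fr: "reg s1 ''b'' = b" "arr s1 ''pw'' b = ?B" using 2 by auto
      have ac: "a < ?B" "c < ?B" using i by (simp_all add: a_def c_def less_mult_imp_div_less)
      have ac_i: "?i = a * ?B + c" by (simp only: a_def c_def div_mult_mod_eq)
      define j where "j = a div 2 * ?B + c div 2"
      define t where "t = ?tab j"
      have j: "j div ?B = a div 2" "j mod ?B = c div 2" using ac by (simp_all add: j_def)
      have t: "common_bit t (a div 2) (c div 2)"
      proof (cases "j < ?i")
        case True
        then show ?thesis using 2 j by (auto simp: t_def ok_def)
      next
        case False
        \<comment> \<open>Only the pair of zero words refers to its own entry, which still has the
          initial value 0, the correct one.\<close>
        have "a div 2 * ?B \<le> a * ?B" by (intro mult_le_mono1) simp
        then have "c div 2 = c" "a div 2 * ?B = a * ?B" using False ac_i unfolding j_def by linarith+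
        then have "c = 0" "a = 0" by auto
        moreover have "t = 0" using 2 False by (simp add: t_def ok_def)
        ultimately show ?thesis by (simp add: common_bit_def)
      qed
      have t_le: "t \<le> b" by (rule common_bit_le[OF t]) (use ac in simp)
      have new: "ok (Suc ?i) (?tab(?i := u))" if "common_bit u a c" for u
        using 2 that by (auto simp: ok_def less_Suc_eq a_def[symmetric] c_def[symmetric])
      have "?tab(?i := 0) = ?tab" using 2 by (simp add: ok_def fun_upd_idem)
      then have new0: "ok (Suc ?i) ?tab" if "common_bit 0 a c" using new[OF that] by simp
      have budget: "?B * ?B \<le> (k - 1) + Suc ?i" using 2 i(2) by simp
      have "?B \<le> ?B * ?B" by simp
      then have bounds: "a < V" "c < V" "t < V" "Suc t < V" "Suc ?i < V"
        using ac i(1) t_le bB V unfolding four_power by linarith+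
      have par: "a mod 2 * (c mod 2) = 0 \<longleftrightarrow> \<not> (odd a \<and> odd c)" by (auto simp: odd_iff_mod_2_eq_one)
      show ?case
      proof (cases "odd a \<and> odd c")
        case True
        then show ?thesis
          using new[OF common_bit_double(1)] budget bounds i fr par
          by (simp add: a_def[symmetric] c_def[symmetric])
      next
        case odd: False
        show ?thesis
        proof (cases t)
          case 0
          have "common_bit 0 a c" by (rule common_bit_double(2)) (use t odd 0 in simp_all)
          then show ?thesis
            using new0 budget bounds i fr par odd 0
            by (simp add: a_def[symmetric] c_def[symmetric] j_def[symmetric] t_def[symmetric])
        next
          case (Suc u)
          have "common_bit (Suc t) a c"
            unfolding Suc by (rule common_bit_double(3)) (use t Suc in simp)
          then show ?thesis
            using new[of "Suc t"] budget bounds i fr par odd Suc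
            by (simp add: a_def[symmetric] c_def[symmetric] j_def[symmetric] t_def[symmetric])
        qed
      qed
    next
      case (3 s1 k)
      then have i: "reg s1 ''i'' = ?B * ?B" by (auto split: if_splits)
      show ?case
      proof (intro allI impI)
        fix a c assume ac: "a < ?B" "c < ?B"
        then have "Suc a * ?B \<le> ?B * ?B" by (intro mult_le_mono1) simp
        then have "a * ?B + c < reg s1 ''i''" using ac i by simp
        then have "common_bit (arr s1 ''tab'' (a * ?B + c)) ((a * ?B + c) div ?B) ((a * ?B + c) mod ?B)"
          using 3 unfolding ok_def by blast
        then show "common_bit (arr s1 ''tab'' (a * ?B + c)) a c" using ac by simp
      qed
    qed
  qed (use V in auto)
qed

lemma wp_count_loop:
  assumes s: "reg s ''n'' = n" "reg s ''b'' = b" "0 < b" "\<And>i. i \<le> b \<Longrightarrow> arr s ''pw'' i = 2 ^ i"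
    and zero: "\<And>i. arr s ''F'' i = 0" "\<And>i. arr s ''S'' i = 0" and V: "n + 2 < V" "2 ^ b < V"
  shows "wp V count_loop (\<lambda>s' _. reg s' ''cnt'' = card {y. y < n \<and> arr s ''inn'' y = 0} \<and>
      reps n b (arr s' ''F'') UNIV \<and> reps n b (arr s' ''S'') UNIV \<and>
      (\<forall>i\<ge>n. arr s' ''S'' i = 0)) s n"
proof -
  let ?I = "\<lambda>s' k. reg s' ''n'' = n \<and> reg s' ''b'' = b \<and> arr s' ''pw'' = arr s ''pw'' \<and>
    arr s' ''inn'' = arr s ''inn'' \<and> reg s' ''y'' \<le> n \<and>
    reg s' ''cnt'' = card {y. y < reg s' ''y'' \<and> arr s ''inn'' y = 0} \<and>
    reps n b (arr s' ''F'') {..<reg s' ''y''} \<and> arr s' ''S'' = arr s' ''F'' \<and>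
    (\<forall>i\<ge>n. arr s' ''F'' i = 0) \<and> n \<le> k + reg s' ''y''"
  show ?thesis
    unfolding count_loop_def wp_Seq wp_Assign
  proof (intro conjI, goal_cases)
    case 3
    show ?case
    proof (rule wp_While[where I = ?I], goal_cases)
      case 1
      have "arr s ''S'' = arr s ''F''" using zero by auto
      then show ?case using s zero by (simp add: reps_def)
    next
      case (2 s1 k)
      let ?y = "reg s1 ''y''" and ?F = "arr s1 ''F''" and ?inn = "arr s ''inn''"
      define q i where "q = ?y div b" and "i = ?y mod b"
      have y: "?y < n" using 2 by (simp split: if_splits)
      have i: "i < b" "q * b + i = ?y" using s(3) by (simp_all add: q_def i_def)
      have "q \<le> ?y" unfolding q_def by (rule div_le_dividend)
      then have q: "q < n" using y by simp
      have pw: "arr s ''pw'' i = 2 ^ i" using s(4) i(1) by simp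
      have "reps n b (?F(q := ?F q + 2 ^ i)) (insert ?y {..<?y})"
        using reps_insert[of n b ?F "{..<?y}" q i] 2 i q y by simp
      then have reps: "reps n b (?F(q := ?F q + 2 ^ i)) {..<Suc ?y}" by (simp add: lessThan_Suc)
      have word: "?F q + 2 ^ i < V" using reps_word_less[OF reps q] V by simp
      have cnt_le: "card {z. z < ?y \<and> ?inn z = 0} \<le> ?y"
        using card_mono[of "{..<?y}" "{z. z < ?y \<and> ?inn z = 0}"] by auto
      have "{z. z < Suc ?y \<and> ?inn z = 0} =
          (if ?inn ?y = 0 then insert ?y {z. z < ?y \<and> ?inn z = 0} else {z. z < ?y \<and> ?inn z = 0})"
        by (auto simp: less_Suc_eq)
      then have cnt: "card {z. z < Suc ?y \<and> ?inn z = 0} =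
          (if ?inn ?y = 0 then Suc (card {z. z < ?y \<and> ?inn z = 0}) else card {z. z < ?y \<and> ?inn z = 0})"
        by simp
      show ?case
        using 2 y q pw reps word cnt cnt_le V
        by (cases "?inn ?y = 0") (simp_all add: q_def[symmetric] i_def[symmetric])
    next
      case (3 s1 k)
      then have "reg s1 ''y'' = n" by (auto split: if_splits)
      then show ?case using 3 by (auto simp: reps_def)
    qed
  qed (use V in auto)
qed

lemma wp_sqrt_loop:
  assumes "reg s ''n'' = n" "n + 1 < V"
  shows "wp V sqrt_loop (\<lambda>s' _. n \<le> reg s' ''l'' * reg s' ''l'' \<and> (\<forall>j<reg s' ''l''. j * j < n)) s n"
proof -
  let ?I = "\<lambda>s' k. reg s' ''n'' = n \<and> (\<forall>j<reg s' ''l''. j * j < n) \<and> n \<le> k + reg s' ''l''"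
  show ?thesis
    unfolding sqrt_loop_def wp_Seq wp_Assign
  proof (intro conjI, goal_cases)
    case 2
    show ?case
    proof (rule wp_While[where I = ?I], goal_cases)
      case (2 s1 k)
      then have "reg s1 ''l'' * reg s1 ''l'' < n" by (simp split: if_splits)
      moreover from this have "reg s1 ''l'' < n" using le_square[of "reg s1 ''l''"] by linarith
      ultimately show ?case using 2 assms by (auto simp: less_Suc_eq)
    qed (use assms in \<open>auto split: if_splits\<close>)
  qed (use assms in auto)
qed

lemma wp_final_loop:
  assumes "reg s ''n'' = n" "n + 1 < V"
    and "\<And>y. y < n \<Longrightarrow> arr s ''mate'' y < V \<and> arr s ''inn'' y < V"
  shows "wp V final_loop (\<lambda>s' _. reg s' ''yes'' = 1 \<and> (\<forall>y<n. arr s' ''parent'' y =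
      (if arr s ''mate'' y = 0 then arr s ''inn'' y else arr s ''mate'' y))) s n"
proof -
  let ?I = "\<lambda>s' k. reg s' ''n'' = n \<and> arr s' ''mate'' = arr s ''mate'' \<and> arr s' ''inn'' = arr s ''inn'' \<and>
    reg s' ''y'' \<le> n \<and> (\<forall>y<reg s' ''y''. arr s' ''parent'' y =
      (if arr s ''mate'' y = 0 then arr s ''inn'' y else arr s ''mate'' y)) \<and> n \<le> k + reg s' ''y''"
  show ?thesis
    unfolding final_loop_def wp_Seq wp_Assign
  proof (intro conjI, goal_cases)
    case 2
    show ?case
    proof (rule wp_While[where I = ?I], goal_cases)
      case (2 s1 k)
      then have y: "reg s1 ''y'' < n" by (simp split: if_splits)
      show ?case
        using 2 assms(2) y assms(3)[OF y]
        by (cases "arr s ''mate'' (reg s1 ''y'') = 0") (auto simp: less_Suc_eq)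
    next
      case (3 s1 k)
      then have "reg s1 ''y'' = n" by (auto split: if_splits)
      then show ?case using 3 assms(2) by simp
    qed (use assms in auto)
  qed (use assms in auto)
qed

lemmas loop_defs = word_loop_def table_loop_def build_loop_def count_loop_def sqrt_loop_def
  search_loop_def phase1_body_def rounds_def reset_loop_def dfs_body_def final_loop_def

section \<open>The whole program\<close>

lemma wpE:
  assumes "wp V c (\<lambda>s' _. P s') s k"
  obtains i s' where "run V c s i s'" "i \<le> k" "P s'"
  using assms by (auto simp: wp_def)

lemma written [simp]:
  "written_regs word_loop = {''b''}" "written_arrs word_loop = {''pw''}"
  "written_regs table_loop = {''i'', ''a'', ''c'', ''t''}" "written_arrs table_loop = {''tab''}"
  "written_regs build_loop = {''x'', ''p'', ''e'', ''w'', ''q''}"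
  "written_arrs build_loop = {''inn'', ''cw'', ''st'', ''pos'', ''ci'', ''cs''}"
  "written_regs count_loop = {''y'', ''cnt'', ''q''}" "written_arrs count_loop = {''F'', ''S''}"
  "written_regs sqrt_loop = {''l''}" "written_arrs sqrt_loop = {}"
  "written_regs (search_loop phase1_body) =
     {''idx'', ''cur'', ''x'', ''p'', ''r'', ''t'', ''y'', ''z''}"
  "written_arrs (search_loop phase1_body) = {''S'', ''mate'', ''mx'', ''lev'', ''off''}"
  "written_regs rounds =
     {''found'', ''sp'', ''i'', ''idx'', ''cur'', ''x'', ''p'', ''r'', ''t'', ''y'', ''z''}"
  "written_arrs rounds = {''U'', ''off'', ''mate'', ''mx'', ''stk''}"
  "written_regs final_loop = {''y'', ''yes''}" "written_arrs final_loop = {''parent''}"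
  by (auto simp: loop_defs)

text \<open>The largest constant of the program is 4, and 10 bounds the atoms of its expressions, so
  all intermediate values stay below \<open>V ^ 10\<close>.\<close>

lemma com_ok_program: "4 < V \<Longrightarrow> com_ok V 10 minleaf_program"
  by (simp add: minleaf_program_def loop_defs)

text \<open>Here \<open>b\<close> is the number of bits per word, \<open>N\<close> the number of words, \<open>l\<close> the number of levels of
  the first phase and \<open>g\<close> the number of augmentations left to the second.\<close>

definition tick_bound :: "nat \<Rightarrow> nat \<Rightarrow> nat \<Rightarrow> bool" where
  "tick_bound n m i \<longleftrightarrow> i = 0 \<or> 0 < n \<and> n \<le> m + 1 \<and>
     (i \<le> 4 * n + 3 + m \<or>
      (\<exists>b l N g. 0 < b \<and> n < 4 ^ Suc b \<and> N \<le> m \<and> N \<le> n * Suc ((n - 1) div b) \<and>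
         n \<le> l * l \<and> (\<forall>j<l. j * j < n) \<and> l * g \<le> n \<and>
         i \<le> 6 * n + 3 + m + (l * (N + n) + N + n * l + 2 * n + 1) + Suc g * (N + 5 * n + 2)))"

text \<open>The left side is \<open>64 * (n + 2) ^ 2\<close>, ample room for the stored numbers,
  which are of order \<open>n * n\<close>; the factor 64 is at most
  \<open>(n + 2) ^ 6\<close>.\<close>

lemma sqr_le_V: "64 * (n * n + 4 * n + 4) \<le> (n + 2) ^ 8" for n :: nat
proof -
  have "(2 :: nat) ^ 6 * (n + 2) ^ 2 \<le> (n + 2) ^ 6 * (n + 2) ^ 2"
    by (intro mult_le_mono1 power_mono) simp_all
  also have "\<dots> = (n + 2) ^ 8" by (simp flip: power_add)
  finally show ?thesis by (simp add: power2_eq_square algebra_simps)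
qed

section \<open>From the input lists to the answer of the program\<close>

context
  fixes D :: "nat pair_pre_digraph" and L :: "nat list list" and n m :: nat
  assumes D: "acyclic_digraph D" and L: "adjacency_lists D L"
    and n: "n = length L" and m: "m = length (concat L)"
begin

lemma pverts_D: "pverts D = {..<n}"
  using L by (simp add: adjacency_lists_def n)

lemma list_facts:
  assumes "v < n"
  shows "distinct (L ! v)" "set (L ! v) = {w. (v, w) \<in> parcs D}"
  using L assms by (auto simp: adjacency_lists_def n)

lemma parcs_less: "parcs D \<subseteq> {..<n} \<times> {..<n}"
  using acyclic_digraphD(7)[OF D] by (auto simp: pverts_D)

lemma card_parcs: "card (parcs D) = m"
proof -
  have "parcs D = (SIGMA v:{..<n}. set (L ! v))"
    using parcs_less list_facts(2) by auto
  then have "card (parcs D) = (\<Sum>v<n. card (set (L ! v)))" by simp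
  also have "\<dots> = (\<Sum>v<n. length (L ! v))"
    using list_facts(1) by (intro sum.cong) (auto simp: distinct_card)
  also have "\<dots> = m"
    by (simp add: m n length_concat sum_list_sum_nth atLeast0LessThan)
  finally show ?thesis .
qed

lemma m_le: "m \<le> n * n"
  using card_mono[OF _ parcs_less] by (simp add: card_parcs)

lemma adj_array_input:
  assumes "0 < b"
  shows "adj_array n (parcs D) m b (\<lambda>v. length (concat (take v L))) (\<lambda>i. concat L ! i)"
proof unfold_locales
  fix v assume v: "v < n"
  have take: "take (Suc v) L = take v L @ [L ! v]" using v by (simp add: n take_Suc_conv_app_nth)
  then show "length (concat (take v L)) \<le> length (concat (take (Suc v) L))" by simp
  have "concat L = concat (take v L @ L ! v # drop (Suc v) L)"
    using v by (simp add: n id_take_nth_drop[symmetric])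
  then have nth: "concat L ! (length (concat (take v L)) + j) = L ! v ! j" if "j < length (L ! v)" for j
    using that by (simp add: nth_append)
  have seg: "{length (concat (take v L))..<length (concat (take (Suc v) L))} =
      (+) (length (concat (take v L))) ` {..<length (L ! v)}"
    by (simp add: take lessThan_atLeast0 add.commute)
  have "(\<lambda>i. concat L ! i) ` ((+) (length (concat (take v L))) ` {..<length (L ! v)}) = set (L ! v)"
    using nth by (auto simp: image_image in_set_conv_nth image_iff)
  then show "(\<lambda>i. concat L ! i) ` {length (concat (take v L))..<length (concat (take (Suc v) L))} =
      {w. (v, w) \<in> parcs D}"
    unfolding seg using list_facts(2)[OF v] by simp
  show "inj_on (\<lambda>i. concat L ! i) {length (concat (take v L))..<length (concat (take (Suc v) L))}"
    unfolding seg using nth list_facts(1)[OF v] by (auto simp: inj_on_def nth_eq_iff_index_eq)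
qed (use assms parcs_less m n in auto)

lemma minleaf_answer_no: "card (sources D) \<noteq> 1 \<Longrightarrow> reg s ''yes'' = 0 \<Longrightarrow> minleaf_answer D s"
  by (simp add: minleaf_answer_def minleaf.no)

lemma minleaf_answer_yes:
  assumes r: "sources D = {r}" and yes: "reg s ''yes'' = 1"
    and M: "maximum_pair_matching (parcs D) (pairs_of n (arr s ''mate''))"
    and inn: "\<And>y z. inn y = Suc z \<Longrightarrow> (z, y) \<in> parcs D" "\<And>y. inn y = 0 \<longleftrightarrow> (\<forall>z. (z, y) \<notin> parcs D)"
    and parent: "\<And>y. y < n \<Longrightarrow> arr s ''parent'' y =
      (if arr s ''mate'' y = 0 then inn y else arr s ''mate'' y)"
  shows "minleaf_answer D s"
proof -
  let ?M = "pairs_of n (arr s ''mate'')"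
  define U where "U = pverts D - {r} - snd ` ?M"
  have finD: "finite (parcs D)" by (rule acyclic_digraphD[OF D])
  have sndM: "snd ` ?M = {y. y < n \<and> arr s ''mate'' y \<noteq> 0}"
    by (force simp: pairs_of_def gr0_conv_Suc)
  have inn_U: "(inn y - 1, y) \<in> parcs D \<and> inn y \<noteq> 0" if "y \<in> U" for y
  proof -
    have "y \<in> pverts D" "y \<notin> sources D" using that r by (auto simp: U_def)
    then have "inn y \<noteq> 0" using inn(2)[of y] by (auto simp: sources_eq finD)
    then show ?thesis using inn(1)[of y "inn y - 1"] by simp
  qed
  \<comment> \<open>Ensures that the root receives no parent from \<open>inn\<close>.\<close>
  have "inn r = 0" using sources_singletonD(2)[OF r finD] inn(2) by simp
  have "pairs_of n (arr s ''parent'') = ?M \<union> (\<lambda>y. (inn y - 1, y)) ` U"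
  proof (rule set_eqI, rule iffI)
    fix e assume "e \<in> pairs_of n (arr s ''parent'')"
    then obtain x y where e: "e = (x, y)" "y < n" "arr s ''parent'' y = Suc x"
      by (auto simp: pairs_of_def)
    show "e \<in> ?M \<union> (\<lambda>y. (inn y - 1, y)) ` U"
    proof (cases "arr s ''mate'' y = 0")
      case True
      then have "inn y = Suc x" using parent[OF e(2)] e(3) by simp
      moreover from this have "y \<noteq> r" using \<open>inn r = 0\<close> by auto
      then have "y \<in> U" using True e(2) by (simp add: U_def sndM pverts_D)
      ultimately show ?thesis using e(1) by (auto simp: image_iff intro!: bexI[of _ y])
    next
      case False
      then show ?thesis using e parent[OF e(2)] by (simp add: pairs_of_def)
    qed
  next
    fix e assume "e \<in> ?M \<union> (\<lambda>y. (inn y - 1, y)) ` U"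
    then show "e \<in> pairs_of n (arr s ''parent'')"
    proof
      assume "e \<in> ?M"
      then show ?thesis using parent by (auto simp: pairs_of_def)
    next
      assume "e \<in> (\<lambda>y. (inn y - 1, y)) ` U"
      then obtain y where y: "y \<in> U" "e = (inn y - 1, y)" by auto
      then have "y < n" "arr s ''mate'' y = 0" by (auto simp: U_def sndM pverts_D)
      then show ?thesis using y inn_U[OF y(1)] parent by (simp add: pairs_of_def)
    qed
  qed
  moreover have "{{Inl x, Inr y} |x y. (x, y) \<in> ?M} = edge ` ?M"
    by (auto simp: edge_Pair image_iff)
  moreover have "minleaf_run D (edge ` ?M)
      \<lparr>pverts = pverts D, parcs = ?M \<union> (\<lambda>y. (inn y - 1, y)) ` U\<rparr>"
    by (rule minleaf_runI[OF D r M _ U_def]) (use inn_U in blast)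
  ultimately show ?thesis using yes by (simp add: minleaf_answer_def pverts_D)
qed

lemma minleaf_program_run:
  assumes V: "64 * (n * n + 4 * n + 4) \<le> V"
  shows "\<exists>i s. run V minleaf_program (input_state L) i s \<and> minleaf_answer D s \<and> tick_bound n m i"
proof -
  let ?s0 = "input_state L"
  \<comment> \<open>Treating \<open>n * n\<close> as an atom makes the bounds on stored values
    linear.\<close>
  define sq where "sq = n * n"
  have sq: "64 * sq + 256 * n + 256 \<le> V" "m \<le> sq" "n \<le> sq"
    using V m_le by (simp_all add: sq_def)
  have finD: "finite (parcs D)" by (rule acyclic_digraphD[OF D])
  have s0: "reg ?s0 ''n'' = n" "reg ?s0 ''m'' = m" by (simp_all add: input_state_def n m)
  have s0_zero: "arr ?s0 A i = 0" if "A \<noteq> ''start''" "A \<noteq> ''adj''" for A i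
    using that by (simp add: input_state_def)
  have s0_yes: "reg ?s0 ''yes'' = 0" by (simp add: input_state_def)
  have s0_start: "arr ?s0 ''start'' v = length (concat (take v L))" if "v \<le> n" for v
    using that by (simp add: input_state_def n)
  have s0_adj: "arr ?s0 ''adj'' i = concat L ! i" if "i < m" for i
    using that by (simp add: input_state_def m)
  consider "n = 0" | "m + 1 < n" | "0 < n" "n \<le> m + 1" by linarith
  then show ?thesis
  proof cases
    case 1
    have "wp V minleaf_program (\<lambda>s' _. s' = ?s0) ?s0 0"
      using s0 1 by (simp add: minleaf_program_def)
    then have "run V minleaf_program ?s0 0 ?s0" by (auto elim: wpE)
    moreover have "sources D = {}" using 1 by (simp add: sources_def pverts_D)
    then have "minleaf_answer D ?s0" using minleaf_answer_no s0_yes by simp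
    ultimately show ?thesis by (auto simp: tick_bound_def)
  next
    case 2
    have "wp V minleaf_program (\<lambda>s' _. s' = ?s0) ?s0 0"
      using s0 2 by (simp add: minleaf_program_def)
    then have "run V minleaf_program ?s0 0 ?s0" by (auto elim: wpE)
    \<comment> \<open>At most \<open>m\<close> vertices have an in-arc, so at least two of the
      \<open>n\<close> vertices are sources.\<close>
    moreover have "card (pverts D) - card (snd ` parcs D) \<le> card (pverts D - snd ` parcs D)"
      by (rule diff_card_le_card_Diff) (use finD in simp)
    then have "card (sources D) \<noteq> 1"
      using 2 card_image_le[OF finD, of snd] by (simp add: sources_eq finD pverts_D card_parcs)
    then have "minleaf_answer D ?s0" using minleaf_answer_no s0_yes by simp
    ultimately show ?thesis by (auto simp: tick_bound_def)
  next
    case 3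
    have mV: "m + 2 < V" using sq by linarith
    have nV: "n + 5 < V" using sq by linarith
    obtain i1 s1 where r1: "run V word_loop ?s0 i1 s1" "i1 \<le> n" and
      "\<exists>b. 0 < b \<and> reg s1 ''b'' = b \<and> (\<forall>i\<le>b. arr s1 ''pw'' i = 2 ^ i) \<and> 4 ^ b \<le> n + 3 \<and> n < 4 ^ Suc b"
      using wp_word_loop[OF s0(1) 3(1) nV] by (rule wpE)
    then obtain b where b: "0 < b" "reg s1 ''b'' = b" "\<And>i. i \<le> b \<Longrightarrow> arr s1 ''pw'' i = 2 ^ i"
      "4 ^ b \<le> n + 3" "n < 4 ^ Suc b" by blast
    note f1 = run_frame[OF r1(1)]
    have "(2 :: nat) ^ b \<le> 4 ^ b" by (rule power_mono) simp_all
    then have bV: "2 * 2 ^ b < V" "2 ^ b < V" "4 ^ b + 1 < V" "b < V"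
      using b(4) sq less_exp[of b] by linarith+
    have tab0: "arr s1 ''tab'' i = 0" for i using f1 s0_zero by simp
    obtain i2 s2 where r2: "run V table_loop s1 i2 s2" "i2 \<le> 4 ^ b" and
      tab: "\<forall>a c. a < 2 ^ b \<longrightarrow> c < 2 ^ b \<longrightarrow> common_bit (arr s2 ''tab'' (a * 2 ^ b + c)) a c"
      using wp_table_loop[OF b(2,3,1) tab0 bV(3)] by (rule wpE)
    note f2 = run_frame[OF r2(1)]
    let ?start = "\<lambda>v. length (concat (take v L))" and ?adj = "\<lambda>i. concat L ! i"
    interpret adj: adj_array n "parcs D" m b ?start ?adj by (rule adj_array_input[OF b(1)])
    have "n + 2 < V" using nV by simp
    note build = adj.wp_build[OF this mV bV(1), of s2]
    have "wp V build_loop (\<lambda>s' _. \<exists>p e k. adj.build n p e (arr s' ''st'') (arr s' ''pos'')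
      (arr s' ''ci'') (arr s' ''cw'') (arr s' ''cs'') (arr s' ''inn'') k) s2 (n + m)"
      using b by (intro build) (simp_all add: f1 f2 s0 s0_zero s0_start s0_adj)
    then obtain i3 s3 where r3: "run V build_loop s2 i3 s3" "i3 \<le> n + m" and
      "\<exists>p e k. adj.build n p e (arr s3 ''st'') (arr s3 ''pos'')
      (arr s3 ''ci'') (arr s3 ''cw'') (arr s3 ''cs'') (arr s3 ''inn'') k"
      by (rule wpE)
    then obtain p e k where bld: "adj.build n p e (arr s3 ''st'') (arr s3 ''pos'')
      (arr s3 ''ci'') (arr s3 ''cw'') (arr s3 ''cs'') (arr s3 ''inn'') k" by blast
    note f3 = run_frame[OF r3(1)]
    let ?cs = "arr s3 ''cs''" and ?inn = "arr s3 ''inn''"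
    have wg: "word_graph n (parcs D) b ?cs (arr s3 ''ci'') (arr s3 ''cw'') (arr s2 ''tab'')"
      "?cs n \<le> m" "?cs n \<le> n * Suc ((n - 1) div b)"
      using adj.build_final[OF bld, of "arr s2 ''tab''"] tab by auto
    have "wp V count_loop (\<lambda>s' _. reg s' ''cnt'' = card {y. y < n \<and> arr s3 ''inn'' y = 0} \<and>
      reps n b (arr s' ''F'') UNIV \<and> reps n b (arr s' ''S'') UNIV \<and>
      (\<forall>i\<ge>n. arr s' ''S'' i = 0)) s3 n"
      using b bV nV by (intro wp_count_loop) (simp_all add: f1 f2 f3 s0 s0_zero)
    then obtain i4 s4 where r4: "run V count_loop s3 i4 s4" "i4 \<le> n" and
      s4: "reg s4 ''cnt'' = card {y. y < n \<and> ?inn y = 0}" "reps n b (arr s4 ''F'') UNIV"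
      "reps n b (arr s4 ''S'') UNIV" "\<And>i. n \<le> i \<Longrightarrow> arr s4 ''S'' i = 0"
      by (rule wpE) blast
    note f4 = run_frame[OF r4(1)]
    have "{y. y < n \<and> ?inn y = 0} = sources D"
      using adj.build_inn(2)[OF bld] by (force simp: sources_eq finD pverts_D)
    then have cnt: "reg s4 ''cnt'' = card (sources D)" using s4(1) by simp
    let ?rest = "sqrt_loop ;; search_loop phase1_body ;; rounds ;; final_loop"
    have prog: "run V minleaf_program ?s0 (i1 + (i2 + (i3 + (i4 + i)))) s"
      if "run V (Cond (Bin Equal (Reg ''cnt'') (Const 1)) ?rest Skip) s4 i s" for i s
    proof -
      note body = run.intros(4)[OF r1(1) run.intros(4)[OF r2(1) run.intros(4)[OF r3(1)
        run.intros(4)[OF r4(1) that]]]]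
      show ?thesis
        unfolding minleaf_program_def
        by (rule run.intros(5)[OF _ run.intros(6)[OF _ body]]) (use s0 3 in simp_all)
    qed
    show ?thesis
    proof (cases "card (sources D) = 1")
      case False
      have "run V minleaf_program ?s0 (i1 + (i2 + (i3 + (i4 + 0)))) s4"
        using False cnt by (intro prog run.intros(6,1)) simp
      moreover have "minleaf_answer D s4"
        using False by (intro minleaf_answer_no) (simp_all add: f1 f2 f3 f4 s0_yes)
      moreover have "tick_bound n m (i1 + (i2 + (i3 + (i4 + 0))))"
        using r1(2) r2(2) r3(2) r4(2) b(4) 3 by (simp add: tick_bound_def)
      ultimately show ?thesis by blast
    next
      case True
      then obtain r where r: "sources D = {r}" by (rule card_1_singletonE)
      have n4: "reg s4 ''n'' = n" by (simp add: f1 f2 f3 f4 s0)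
      have "n + 1 < V" using nV by simp
      note wp_sqrt_loop[OF n4 this]
      then obtain i5 s5 where r5: "run V sqrt_loop s4 i5 s5" "i5 \<le> n" and
        l: "n \<le> reg s5 ''l'' * reg s5 ''l'' \<and> (\<forall>j<reg s5 ''l''. j * j < n)"
        by (rule wpE)
      note f5 = run_frame[OF r5(1)]
      define l where "l = reg s5 ''l''"
      have l_reg: "reg s5 ''l'' = l" by (simp add: l_def)
      have l_pos: "0 < l" using l 3(1) by (auto simp: l_def intro: ccontr)
      have "(l - 1) * (l - 1) < n" using l l_pos by (auto simp: l_def)
      moreover have "l - 1 \<le> (l - 1) * (l - 1)" by (rule le_square)
      ultimately have l_le: "l \<le> n" by linarith
      interpret word_graph n "parcs D" b ?cs "arr s3 ''ci''" "arr s3 ''cw''" "arr s2 ''tab''"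
        by (rule wg)
      interpret word_program n "parcs D" b ?cs "arr s3 ''ci''" "arr s3 ''cw''" "arr s2 ''tab''" V l
      proof unfold_locales
        have "l * n \<le> sq" unfolding sq_def using l_le by (rule mult_le_mono1)
        then show "(l + 2) * n < V" using sq by (simp add: algebra_simps)
      qed (use bV nV mV wg(2) l_le in auto)
      have ctx5: "ctx s5" using b l_reg by (simp add: ctx_def f1 f2 f3 f4 f5 s0)
      have "wp V (search_loop phase1_body)
        (\<lambda>s' _. mates n (parcs D) (arr s' ''mate'') (arr s' ''mx'') 0 \<and>
          l * matching_number (parcs D) \<le> l * card (matched n (arr s' ''mate'')) + n) s5 (budget1 l)"
        using s4 by (intro wp_phase1[OF ctx5]) (simp_all add: f1 f2 f3 f4 f5 s0_zero)
      then obtain i6 s6 where r6: "run V (search_loop phase1_body) s5 i6 s6" "i6 \<le> budget1 l" and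
        s6: "mates n (parcs D) (arr s6 ''mate'') (arr s6 ''mx'') 0"
          "l * matching_number (parcs D) \<le> l * card (matched n (arr s6 ''mate'')) + n"
        by (rule wpE) blast
      note f6 = run_frame[OF r6(1)]
      have ctx6: "ctx s6" using ctx5 by (simp add: ctx_def f6)
      define g where "g = matching_number (parcs D) - card (matched n (arr s6 ''mate''))"
      have g: "l * g \<le> n" using s6(2) by (simp add: g_def diff_mult_distrib2)
      have F6: "reps n b (arr s6 ''F'') UNIV" using s4(2) by (simp add: f5 f6)
      have "wp V rounds (\<lambda>s' _. mates n (parcs D) (arr s' ''mate'') (arr s' ''mx'') 0 \<and>
        card (matched n (arr s' ''mate'')) = matching_number (parcs D)) s6 (Suc g * budget_round)"
        by (rule wp_rounds[OF ctx6 s6(1) F6]) (simp add: g_def)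
      then obtain i7 s7 where r7: "run V rounds s6 i7 s7" "i7 \<le> Suc g * budget_round" and
        s7: "mates n (parcs D) (arr s7 ''mate'') (arr s7 ''mx'') 0"
          "card (matched n (arr s7 ''mate'')) = matching_number (parcs D)"
        by (rule wpE) blast
      note f7 = run_frame[OF r7(1)]
      have inn7: "arr s7 ''inn'' = ?inn" by (simp add: f4 f5 f6 f7)
      have inn_le: "?inn y \<le> n" for y
        using adj.build_inn(1)[OF bld] adj.A_less(1) by (cases "?inn y") (auto simp: Suc_le_eq)
      have "wp V final_loop (\<lambda>s' _. reg s' ''yes'' = 1 \<and> (\<forall>y<n. arr s' ''parent'' y =
        (if arr s7 ''mate'' y = 0 then arr s7 ''inn'' y else arr s7 ''mate'' y))) s7 n"
      proof (rule wp_final_loop)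
        show "reg s7 ''n'' = n" by (simp add: f5 f6 f7 n4)
        show "n + 1 < V" using nV by simp
        fix y assume "y < n"
        then have "arr s7 ''mate'' y \<le> n" by (rule adj.mate_le[OF s7(1)])
        then show "arr s7 ''mate'' y < V \<and> arr s7 ''inn'' y < V"
          using inn_le[of y] nV unfolding inn7 by linarith
      qed
      then obtain i8 s8 where r8: "run V final_loop s7 i8 s8" "i8 \<le> n" and
        s8: "reg s8 ''yes'' = 1" "\<And>y. y < n \<Longrightarrow> arr s8 ''parent'' y =
          (if arr s7 ''mate'' y = 0 then arr s7 ''inn'' y else arr s7 ''mate'' y)"
        by (rule wpE) blast
      note f8 = run_frame[OF r8(1)]
      have "run V ?rest s4 (i5 + (i6 + (i7 + i8))) s8"
        by (intro run.intros(4)) (rule r5(1) r6(1) r7(1) r8(1))+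
      then have "run V (Cond (Bin Equal (Reg ''cnt'') (Const 1)) ?rest Skip) s4 (i5 + (i6 + (i7 + i8))) s8"
        by (rule run.intros(5)[rotated]) (simp add: cnt True)
      note run = prog[OF this]
      have mate8: "arr s8 ''mate'' = arr s7 ''mate''" by (simp add: f8)
      have max: "maximum_pair_matching (parcs D) (pairs_of n (arr s8 ''mate''))"
        unfolding mate8
        using adj.pair_matching_pairs_of[OF s7(1)] s7(2) by (intro maximum_pair_matchingI[OF finD]) simp_all
      have answer: "minleaf_answer D s8"
      proof (rule minleaf_answer_yes[OF r s8(1) max])
        show "\<And>y z. ?inn y = Suc z \<Longrightarrow> (z, y) \<in> parcs D" by (rule adj.build_inn(1)[OF bld])
        show "\<And>y. ?inn y = 0 \<longleftrightarrow> (\<forall>z. (z, y) \<notin> parcs D)" by (rule adj.build_inn(2)[OF bld])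
      qed (simp add: s8(2) mate8 inn7)
      have "i1 + (i2 + (i3 + (i4 + (i5 + (i6 + (i7 + i8)))))) \<le>
          6 * n + 3 + m + (l * (?cs n + n) + ?cs n + n * l + 2 * n + 1) + Suc g * (?cs n + 5 * n + 2)"
      proof -
        have "budget_round = ?cs n + 5 * n + 2" by (simp add: budget_round_def budget2_def)
        then have "i7 \<le> Suc g * (?cs n + 5 * n + 2)" using r7(2) by simp
        moreover have "i6 \<le> l * (?cs n + n) + ?cs n + n * l + 2 * n + 1"
          using r6(2) by (simp add: budget1_def)
        ultimately show ?thesis using r1(2) r2(2) r3(2) r4(2) r5(2) r8(2) b(4) by linarith
      qed
      then have "tick_bound n m (i1 + (i2 + (i3 + (i4 + (i5 + (i6 + (i7 + i8)))))))"
        using 3 b(1,5) wg(2,3) l g unfolding tick_bound_def l_def by blast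
      with run answer show ?thesis by blast
    qed
  qed
qed

lemma bounded_input:
  assumes "64 * (n * n + 4 * n + 4) \<le> V"
  shows "bounded V (input_state L)"
proof -
  have V: "n < V" "m < V" using assms m_le le_square[of n] by auto
  have "length (concat (take v L)) \<le> m" if "v \<le> length L" for v
    by (metis append_take_drop_id concat_append le_add1 length_append m)
  moreover have "concat L ! i < n" if "i < m" for i
  proof -
    have "concat L ! i \<in> set (concat L)" using that unfolding m by (rule nth_mem)
    then have "concat L ! i \<in> (\<Union>xs\<in>set L. set xs)" unfolding set_concat .
    then obtain xs where "xs \<in> set L" "concat L ! i \<in> set xs" by auto
    then obtain v where "v < n" "concat L ! i \<in> set (L ! v)" by (auto simp: in_set_conv_nth n)
    then show ?thesis using list_facts(2) parcs_less by auto
  qed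
  ultimately show ?thesis
    using V unfolding bounded_def input_state_def by (auto simp: m n intro: le_less_trans less_trans)
qed

end

section \<open>The time bound\<close>

lemma tick_bound_imp_le:
  assumes "tick_bound n m i"
  shows "real i + 1 \<le> 60 * (1 + real m + real n powr (3/2) * sqrt (real m / log 2 (real n)))"
proof -
  define X where "X = real n powr (3/2) * sqrt (real m / log 2 (real n))"
  have X0: "0 \<le> X"
  proof (cases "n \<le> 1")
    case True
    then show ?thesis unfolding X_def by (cases "n = 0") auto
  next
    case False
    then show ?thesis by (simp add: X_def)
  qed
  have "60 * (1 + real m + X) = 60 + 60 * real m + 60 * X" by simp
  note X1 = X0 this
  have "real i + 1 \<le> 60 * (1 + real m + X)"
  proof (cases "i \<le> 4 * n + 3 + m \<and> n \<le> m + 1")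
    case True
    then have "i \<le> 5 * m + 7" by linarith
    then have "real i \<le> real (5 * m + 7)" by (simp only: of_nat_le_iff)
    then have "real i \<le> 5 * real m + 7" by simp
    then show ?thesis using X1 by linarith
  next
    case False
    show ?thesis
    proof (cases "i = 0")
      case True
      then show ?thesis using X1 by simp
    next
      case i: False
      then obtain b l N g where nm: "0 < n" "n \<le> m + 1" and b: "0 < b" "n < 4 ^ Suc b"
        and N: "N \<le> m" "N \<le> n * Suc ((n - 1) div b)"
        and l: "n \<le> l * l" "\<forall>j<l. j * j < n" and g: "l * g \<le> n"
        and ib: "i \<le> 6 * n + 3 + m + (l * (N + n) + N + n * l + 2 * n + 1) + Suc g * (N + 5 * n + 2)"
        using assms \<open>\<not> (i \<le> 4 * n + 3 + m \<and> n \<le> m + 1)\<close> unfolding tick_bound_def by blast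
      have l_pos: "0 < l" using l(1) nm(1) by (auto intro: ccontr)
      define s where "s = sqrt (real n)"
      have s: "1 \<le> s" "s * s = real n" using nm(1) by (auto simp: s_def)
      have ls: "real l \<le> s + 1"
      proof -
        have "(l - 1) * (l - 1) < n" using l(2) l_pos by auto
        then have "real (l - 1) ^ 2 \<le> real n"
          by (metis less_imp_le of_nat_le_iff of_nat_power power2_eq_square)
        then have "real (l - 1) \<le> s" unfolding s_def by (rule real_le_rsqrt)
        then show ?thesis using l_pos by (simp add: of_nat_diff)
      qed
      have gs: "real g \<le> s"
      proof -
        have "real n \<le> real l ^ 2" using l(1) by (metis of_nat_le_iff of_nat_power power2_eq_square)
        then have sl: "s \<le> real l" unfolding s_def by (simp add: real_le_lsqrt)
        have "s * real g \<le> real l * real g" using sl by (rule mult_right_mono) simp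
        also have "\<dots> \<le> s * s" using g s(2) by (metis of_nat_le_iff of_nat_mult)
        finally show ?thesis using s(1) by simp
      qed
      \<comment> \<open>These two products dominate. For \<open>n = 1\<close> the logarithm is 0,
        hence so are the quotient and \<open>X\<close>; the summand 1 covers this case.\<close>
      have sN: "s * real N \<le> 3 * X + 1" and sn: "s * real n \<le> X + 1"
      proof (atomize (full), cases "n = 1")
        case True
        then have "N \<le> 1" "s = 1" using N(2) by (simp_all add: s_def)
        then show "s * real N \<le> 3 * X + 1 \<and> s * real n \<le> X + 1" using True X0 by simp
      next
        case False
        define G where "G = log 2 (real n)"
        define R where "R = sqrt (real m / G)"
        have n2: "2 \<le> n" using nm(1) False by simp
        have G1: "1 \<le> G" using n2 by (simp add: G_def)
        \<comment> \<open>Leads to \<open>G \<le> n - 1 \<le> m\<close>, hence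
          \<open>1 \<le> R\<close>, which lets \<open>X\<close> absorb \<open>s * n\<close>.\<close>
        have "n \<le> 2 ^ (n - 1)" using less_exp[of "n - 1"] n2 by linarith
        then have "G \<le> real (n - 1)" unfolding G_def using nm(1) by (rule log2_of_power_le)
        then have Gm: "G \<le> real m" and Gn: "G \<le> real n" using nm(2) by linarith+
        have "n < 2 ^ (2 * Suc b)" using b(2) by (simp add: power_mult)
        then have "G < real (2 * Suc b)" unfolding G_def using nm(1) by (rule log2_of_power_less)
        \<comment> \<open>\<open>2 * (b + 1)\<close> is at most \<open>4 * b\<close> because
          \<open>b\<close> is positive.\<close>
        then have Gb: "G \<le> 4 * real b" using b(1) by simp
        have R1: "1 \<le> R" and RR: "R ^ 2 = real m / G" using G1 Gm by (simp_all add: R_def)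
        have "real n powr (3 / 2) = real n powr 1 * real n powr (1 / 2)"
          using powr_add[of "real n" 1 "1/2"] by simp
        then have X: "X = s * real n * R"
          using nm(1) by (simp add: X_def s_def R_def G_def powr_half_sqrt)
        have "real N \<le> 3 * real n * R"
        proof (rule power2_le_imp_le)
          have "real ((n - 1) div b) \<le> real (n - 1) / real b" by (rule of_nat_div_le_of_nat)
          also have "\<dots> \<le> real n / (G / 4)"
            using Gb G1 by (intro frac_le) simp_all
          finally have "real (Suc ((n - 1) div b)) \<le> 4 * real n / G + 1"
            by (simp add: mult.commute)
          moreover have "1 \<le> real n / G" "5 * real n / G = 4 * real n / G + real n / G"
            using Gn G1 by (simp_all add: le_divide_eq)
          ultimately have "real (Suc ((n - 1) div b)) \<le> 5 * real n / G" by linarith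
          then have "real n * real (Suc ((n - 1) div b)) \<le> real n * (5 * real n / G)"
            by (rule mult_left_mono) simp
          moreover have "real N \<le> real n * real (Suc ((n - 1) div b))"
            using N(2) by (metis of_nat_le_iff of_nat_mult)
          ultimately have "real N \<le> real n * (5 * real n / G)" by linarith
          then have "real N * real N \<le> real m * (real n * (5 * real n / G))"
            using N(1) by (intro mult_mono) simp_all
          also have "\<dots> = 5 * (real n * real n * R ^ 2)" by (simp add: RR)
          \<comment> \<open>The 5 consists of 4 from the word length and 1 from the rounding in
            \<open>Suc\<close>; it is raised to a square, 9, to obtain the root 3.\<close>
          also have "\<dots> \<le> 9 * (real n * real n * R ^ 2)" by simp
          finally show "real N ^ 2 \<le> (3 * real n * R) ^ 2"
            by (simp add: power2_eq_square algebra_simps)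
        qed (use R1 in simp)
        then have "s * real N \<le> s * (3 * real n * R)" using s(1) by (intro mult_left_mono) simp_all
        moreover have "s * real n * 1 \<le> s * real n * R"
          using R1 s(1) by (intro mult_left_mono) simp_all
        ultimately show "s * real N \<le> 3 * X + 1 \<and> s * real n \<le> X + 1"
          unfolding X by (simp add: algebra_simps)
      qed
      have "real i \<le> 6 * n + 3 + m + (real l * (N + n) + N + n * real l + 2 * n + 1) + (real g + 1) * (N + 5 * n + 2)"
      proof -
        have "real i \<le> real (6 * n + 3 + m + (l * (N + n) + N + n * l + 2 * n + 1) + Suc g * (N + 5 * n + 2))"
          using ib by (simp only: of_nat_le_iff)
        then show ?thesis by (simp add: algebra_simps)
      qed
      also have "\<dots> \<le> 6 * n + 3 + m + ((s + 1) * (N + n) + N + n * (s + 1) + 2 * n + 1) + (s + 1) * (N + 5 * n + 2)"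
        using ls gs by (intro add_mono mult_right_mono mult_left_mono order.refl) simp_all
      also have "\<dots> = 15 * real n + 6 + m + 3 * N + 2 * (s * N) + 7 * (s * n) + 2 * s"
        by (simp add: algebra_simps)
      \<comment> \<open>Inserting the bounds on \<open>n\<close>, \<open>N\<close>, \<open>s\<close>
        and the two products leaves at most \<open>21 * m + 13 * X + 32\<close>; the factor 60 is
        generous.\<close>
      also have "\<dots> \<le> 60 * (1 + real m + X) - 1"
      proof -
        have "s \<le> s * s" using s(1) by simp
        then have "s \<le> real n" using s(2) by simp
        moreover have "real n \<le> real m + 1" "real N \<le> real m" using nm(2) N(1) by linarith+
        ultimately show ?thesis using sN sn X1 by linarith
      qed
      finally show ?thesis by linarith
    qed
  qed
  then show ?thesis by (simp only: X_def)
qed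

lemma minleaf_time:
  "\<exists>(c :: com) (k :: nat) (K :: real).
            \<forall>(D :: nat pair_pre_digraph) (L :: nat list list) (n :: nat) (m :: nat).
              acyclic_digraph D \<and> adjacency_lists D L \<and>
              n = card (pverts D) \<and> m = card (parcs D) \<longrightarrow>
              (\<exists>t s. exec ((n + 2) ^ k) c (input_state L) t s \<and>
                 minleaf_answer D s \<and>
                 real t \<le> K * (1 + real m + real n powr (3/2) * sqrt (real m / log 2 (real n))))"
proof -
  let ?c = minleaf_program
  show ?thesis
  \<comment> \<open>The exponent 80 is 8 times 10: stored values are below
    \<open>V = (n + 2) ^ 8\<close>, and intermediate ones below \<open>V ^ 10\<close>.\<close>
  proof (rule exI[of _ ?c], rule exI[of _ 80], rule exI[of _ "real (com_cost ?c) * 60"],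
      intro allI impI)
    fix D :: "nat pair_pre_digraph" and L n m
    assume A: "acyclic_digraph D \<and> adjacency_lists D L \<and> n = card (pverts D) \<and> m = card (parcs D)"
    then have D: "acyclic_digraph D" and L: "adjacency_lists D L" by simp_all
    have n: "n = length L" using A pverts_D[OF D L refl refl] by simp
    have m: "m = length (concat L)" using A card_parcs[OF D L refl refl] by simp
    define V where "V = (n + 2) ^ 8"
    have V: "64 * (n * n + 4 * n + 4) \<le> V" unfolding V_def by (rule sqr_le_V)
    then have V4: "4 < V" "2 \<le> V" by auto
    obtain i s where run: "run V ?c (input_state L) i s" "minleaf_answer D s" "tick_bound n m i"
      using minleaf_program_run[OF D L n m V] by blast
    obtain t where t: "exec (V ^ 10) ?c (input_state L) t s" "t \<le> com_cost ?c * Suc i"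
      using run_imp_exec[OF run(1) bounded_input[OF D L n m V] com_ok_program[OF V4(1)] V4(2)]
      by blast
    have "real t \<le> real (com_cost ?c) * (real i + 1)"
      using t(2) by (metis of_nat_Suc of_nat_le_iff of_nat_mult add.commute)
    also have "\<dots> \<le> real (com_cost ?c) *
        (60 * (1 + real m + real n powr (3/2) * sqrt (real m / log 2 (real n))))"
      using tick_bound_imp_le[OF run(3)] by (rule mult_left_mono) simp
    finally show "\<exists>t s. exec ((n + 2) ^ 80) ?c (input_state L) t s \<and> minleaf_answer D s \<and>
        real t \<le> real (com_cost ?c) * 60 *
          (1 + real m + real n powr (3/2) * sqrt (real m / log 2 (real n)))"
      using t(1) run(2) by (auto simp: V_def mult.assoc simp flip: power_mult)
  qed
qed

theorem theorem1:
  shows "(\<forall>D :: 'a pair_pre_digraph. acyclic_digraph D \<longrightarrow>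
            (\<exists>res. minleaf D res) \<and>
            (\<forall>res. minleaf D res \<longrightarrow>
               (if \<exists>T. out_branching T D
                then \<exists>T. res = Some T \<and> min_leaf_out_branching T D
                else res = None))) \<and>
         (\<exists>(c :: com) (k :: nat) (K :: real).
            \<forall>(D :: nat pair_pre_digraph) (L :: nat list list) (n :: nat) (m :: nat).
              acyclic_digraph D \<and> adjacency_lists D L \<and>
              n = card (pverts D) \<and> m = card (parcs D) \<longrightarrow>
              (\<exists>t s. exec ((n + 2) ^ k) c (input_state L) t s \<and>
                 minleaf_answer D s \<and>
                 real t \<le> K * (1 + real m + real n powr (3/2) * sqrt (real m / log 2 (real n)))))"
proof (rule conjI)
  show "\<forall>D :: 'a pair_pre_digraph. acyclic_digraph D \<longrightarrow>
      (\<exists>res. minleaf D res) \<and>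
      (\<forall>res. minleaf D res \<longrightarrow>
         (if \<exists>T. out_branching T D
          then \<exists>T. res = Some T \<and> min_leaf_out_branching T D
          else res = None))"
    by (intro allI impI conjI) (rule minleaf_correct; assumption)+
qed (rule minleaf_time)

end
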